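(* Let $\mu\ge 0$, $L>0$, let $n\ge 0$ be an integer, $\xi_\nu=\frac{\nu\pi}{n+1}$ and $z_i=\frac L2\bigl(1+\cos\frac{(2i+1)\pi}{2n+2}\bigr)$ for $0\le \nu,i\le n$. Let $a\in\mathbb R$ be such that $C_{n+1}^{\mu+1/2}(t)+a\,C_n^{\mu+1/2}(t)$ has $n+1$ distinct zeros $t_{0,n},\dots,t_{n,n}$ in $(-1,1)$, and let $\lambda_{0,n},\dots,\lambda_{n,n}$ be the positive numbers such that $\int_{-1}^1g(t)(1-t^2)^\mu dt=\sum_{j=0}^n\lambda_{j,n}g(t_{j,n})$ for all polynomials $g$ of degree at most $2n$. For $f\in C(B_L)$ define $$\mathcal B_{n,L}^\mu(f;\mathbf x)=\sum_{\nu=0}^n\sum_{j=0}^n\sum_{i=0}^n\mathcal R_{\xi_\nu}^\mu(f(\cdot,\cdot,z_i);t_{j,n})\,T_{\nu,j,i}(\mathbf x),\qquad T_{\nu,j,i}(\mathbf x)=\frac{a_\mu\lambda_{j,n}}{(n+1)^2}(1-t_{j,n}^2)^{-\mu}\,\Phi_n^\mu(\xi_\nu,z_i,t_{j,n};\mathbf x).$$ Then $\mathcal B_{n,L}^\mu$ is a projection operator onto the space $\Pi_n^3$ of polynomials in three variables of total degree at most $n$: $\mathcal B_{n,L}^\mu f\in\Pi_n^3$ for all $f$, and $\mathcal B_{n,L}^\mu f=f$ if $f\in\Pi_n^3$.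
   Context: $B^2$ is the closed unit disk in $\mathbb R^2$; $W_\mu(x,y)=(1-x^2-y^2)^{\mu-1/2}$; $a_\mu=(\mu+1/2)/\pi=1/\int_{B^2}W_\mu$. $B_L=B^2\times[0,L]$. $W_L(z)=\frac1\pi\frac1{\sqrt{z(L-z)}}$ on $[0,L]$, and $p_k$ is the polynomial of degree $k$, with positive leading coefficient, such that $\int_0^Lp_kp_lW_L\,dz=\delta_{k,l}$. $\mathcal V_k^2(W_\mu)$ is the space of polynomials in two variables of degree $k$ (together with $0$) orthogonal to all polynomials of degree $<k$ under $\langle P,Q\rangle_\mu=a_\mu\int_{B^2}PQW_\mu\,dx\,dy$. For a function $g$ on $B^2$, $$\mathcal R_\theta^\mu(g;t)=\int_{-\sqrt{1-t^2}}^{\sqrt{1-t^2}}g(t\cos\theta-s\sin\theta,\,t\sin\theta+s\cos\theta)\,(1-s^2-t^2)^{\mu-1/2}\,ds .$$ $(a)_k=a(a+1)\cdots(a+k-1)$. $C_k^\lambda$ is the Gegenbauer polynomial of degree $k$, orthogonal for $(1-s^2)^{\lambda-1/2}$ on $[-1,1]$, with $C_k^\lambda(1)=(2\lambda)_k/k!$. $p_l^{(\alpha,\beta)}$ is the Jacobi polynomial of degree $l$ with positive leading coefficient, orthonormal for $(1-t)^\alpha(1+t)^\beta$ normalized to integral $1$ on $[-1,1]$. Orthonormal basis of $\mathcal V_k^2(W_\mu)$: with $x=r\cos\phi$, $y=r\sin\phi$, $$P_{l,\varepsilon}^k(x,y)=h_{l,k}\,p_l^{(\mu-1/2,\,k-2l)}(2r^2-1)\,r^{k-2l}S_{k-2l,\varepsilon}(\phi),$$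 $S_{j,0}(\phi)=\cos j\phi$, $S_{j,1}(\phi)=\sin j\phi$, $0\le 2l\le k$ if $\varepsilon=0$, $0\le 2l\le k-1$ if $\varepsilon=1$, $$h_{l,k}^2=\frac1{d_{l,k}}\,\frac{\Gamma(k-2l+\mu+3/2)}{\Gamma(\mu+3/2)\Gamma(k-2l+1)},\quad h_{l,k}>0,\qquad d_{l,k}=\tfrac12\ (2l<k),\ d_{l,k}=1\ (2l=k).$$ $$\lambda_{l,k}^\mu=\frac{l!\,(k-l)!\,(k-l+\mu+\frac12)}{(\mu+\frac12)_l(\mu+\frac32)_{k-l}(k+\mu+\frac12)},\qquad D_k^{\mu+1/2}(\xi;x,y)=\sum_{l,\varepsilon}\lambda_{l,k}^\mu P_{l,\varepsilon}^k(\cos\xi,\sin\xi)P_{l,\varepsilon}^k(x,y)$$ (all admissible $(l,\varepsilon)$), $$D_k^{\mu+1/2}(\xi,t;x,y)=\frac{k+\mu+1/2}{\mu+1/2}\,C_k^{\mu+1/2}(t)\,D_k^{\mu+1/2}(\xi;x,y),$$ $$\Phi_n^\mu(\xi,w,t;\mathbf x)=\sum_{k=0}^nD_k^{\mu+1/2}(\xi,t;x_1,x_2)\sum_{l=0}^{n-k}p_l(w)\,p_l(x_3).$$ (The constants $\lambda_{l,k}^\mu$ are unrelated to the quadrature weights $\lambda_{j,n}$.) *)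

theory Defs
  imports "HOL-Analysis.Analysis" "HOL-Computational_Algebra.Polynomial"
begin

text \<open>
  Points of $R^3$ are written \<open>((x, y), z)\<close> with the product Euclidean structure.
  All one-dimensional integrals are Henstock--Kurzweil integrals; every integrand occurring for a
  continuous \<open>f\<close> is absolutely integrable, so they agree with the Lebesgue integrals.
  The weights may be singular at the endpoints of the interval, where Isabelle's totalised
  \<open>powr\<close> and division give the value 0; this does not affect the integrals.
\<close>

definition B_L :: "real \<Rightarrow> ((real \<times> real) \<times> real) set" where
  "B_L L = cball (0, 0) 1 \<times> {0..L}"

definition Pi3 :: "nat \<Rightarrow> ((real \<times> real) \<times> real \<Rightarrow> real) set" where
  "Pi3 n = {q. \<exists>c :: nat \<Rightarrow> nat \<Rightarrow> nat \<Rightarrow> real. \<forall>x y z.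
      q ((x, y), z) =
        (\<Sum>(i, j, k) \<in> {(i, j, k). i + j + k \<le> n}. c i j k * x ^ i * y ^ j * z ^ k)}"

definition is_orthonormal_family ::
    "real \<Rightarrow> real \<Rightarrow> (real \<Rightarrow> real) \<Rightarrow> (nat \<Rightarrow> real poly) \<Rightarrow> bool" where
  "is_orthonormal_family a b w p \<longleftrightarrow>
     (\<forall>k. degree (p k) = k \<and> lead_coeff (p k) > 0) \<and>
     (\<forall>k l. integral {a..b} (\<lambda>x. poly (p k) x * poly (p l) x * w x) = (if k = l then 1 else 0))"

definition orthonormal_poly :: "real \<Rightarrow> real \<Rightarrow> (real \<Rightarrow> real) \<Rightarrow> nat \<Rightarrow> real poly" where
  "orthonormal_poly a b w = (THE p. is_orthonormal_family a b w p)"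

definition W_L :: "real \<Rightarrow> real \<Rightarrow> real" where
  "W_L L z = 1 / pi * (1 / sqrt (z * (L - z)))"

definition p_L :: "real \<Rightarrow> nat \<Rightarrow> real poly" where
  "p_L L = orthonormal_poly 0 L (W_L L)"

definition jacobi_weight :: "real \<Rightarrow> real \<Rightarrow> real \<Rightarrow> real" where
  "jacobi_weight \<alpha> \<beta> t = (1 - t) powr \<alpha> * (1 + t) powr \<beta>"

definition jacobi :: "nat \<Rightarrow> real \<Rightarrow> real \<Rightarrow> real poly" where
  "jacobi l \<alpha> \<beta> =
     orthonormal_poly (-1) 1
       (\<lambda>t. jacobi_weight \<alpha> \<beta> t / integral {-1..1} (jacobi_weight \<alpha> \<beta>)) l"

definition gegenbauer :: "nat \<Rightarrow> real \<Rightarrow> real poly" where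
  "gegenbauer k \<kappa> = (THE q. degree q = k \<and>
     (\<forall>r. degree r < k \<longrightarrow>
        integral {-1..1} (\<lambda>s. poly q s * poly r s * (1 - s\<^sup>2) powr (\<kappa> - 1/2)) = 0) \<and>
     poly q 1 = pochhammer (2 * \<kappa>) k / fact k)"

definition a_const :: "real \<Rightarrow> real" where
  "a_const \<mu> = (\<mu> + 1/2) / pi"

definition radon :: "real \<Rightarrow> real \<Rightarrow> (real \<times> real \<Rightarrow> real) \<Rightarrow> real \<Rightarrow> real" where
  "radon \<mu> \<theta> g t =
     integral {- sqrt (1 - t\<^sup>2) .. sqrt (1 - t\<^sup>2)}
       (\<lambda>s. g (t * cos \<theta> - s * sin \<theta>, t * sin \<theta> + s * cos \<theta>)
             * (1 - s\<^sup>2 - t\<^sup>2) powr (\<mu> - 1/2))"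

definition trig_S :: "nat \<Rightarrow> nat \<Rightarrow> real \<Rightarrow> real" where
  "trig_S j \<epsilon> \<phi> = (if \<epsilon> = 0 then cos (real j * \<phi>) else sin (real j * \<phi>))"

definition d_const :: "nat \<Rightarrow> nat \<Rightarrow> real" where
  "d_const l k = (if 2 * l < k then 1/2 else 1)"

definition h_const :: "real \<Rightarrow> nat \<Rightarrow> nat \<Rightarrow> real" where
  "h_const \<mu> l k = sqrt (1 / d_const l k *
     (Gamma (real (k - 2 * l) + \<mu> + 3/2) / (Gamma (\<mu> + 3/2) * Gamma (real (k - 2 * l) + 1))))"

text \<open>
  In \<open>disk_poly\<close>, \<open>r\<close> and \<open>\<phi>\<close> are the polar coordinates of \<open>(x, y)\<close>. At the origin
  \<open>Arg 0 = 0\<close> and \<open>0 ^ 0 = 1\<close>, so the formula gives the value of the polynomial there as well.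
\<close>

definition disk_poly :: "real \<Rightarrow> nat \<Rightarrow> nat \<Rightarrow> nat \<Rightarrow> real \<times> real \<Rightarrow> real" where
  "disk_poly \<mu> k l \<epsilon> = (\<lambda>(x, y).
     let r = cmod (Complex x y); \<phi> = Arg (Complex x y) in
       h_const \<mu> l k * poly (jacobi l (\<mu> - 1/2) (real (k - 2 * l))) (2 * r\<^sup>2 - 1)
         * r ^ (k - 2 * l) * trig_S (k - 2 * l) \<epsilon> \<phi>)"

definition admissible :: "nat \<Rightarrow> (nat \<times> nat) set" where
  "admissible k = {(l, \<epsilon>). \<epsilon> = 0 \<and> 2 * l \<le> k \<or> \<epsilon> = 1 \<and> 2 * l + 1 \<le> k}"

definition lambda_const :: "real \<Rightarrow> nat \<Rightarrow> nat \<Rightarrow> real" where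
  "lambda_const \<mu> l k =
     fact l * fact (k - l) * (real (k - l) + \<mu> + 1/2) /
     (pochhammer (\<mu> + 1/2) l * pochhammer (\<mu> + 3/2) (k - l) * (real k + \<mu> + 1/2))"

definition D_kernel0 :: "real \<Rightarrow> nat \<Rightarrow> real \<Rightarrow> real \<times> real \<Rightarrow> real" where
  "D_kernel0 \<mu> k \<xi> v =
     (\<Sum>(l, \<epsilon>) \<in> admissible k.
        lambda_const \<mu> l k * disk_poly \<mu> k l \<epsilon> (cos \<xi>, sin \<xi>) * disk_poly \<mu> k l \<epsilon> v)"

definition D_kernel :: "real \<Rightarrow> nat \<Rightarrow> real \<Rightarrow> real \<Rightarrow> real \<times> real \<Rightarrow> real" where
  "D_kernel \<mu> k \<xi> t v =
     (real k + \<mu> + 1/2) / (\<mu> + 1/2) * poly (gegenbauer k (\<mu> + 1/2)) t * D_kernel0 \<mu> k \<xi> v"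

definition Phi ::
    "real \<Rightarrow> real \<Rightarrow> nat \<Rightarrow> real \<Rightarrow> real \<Rightarrow> real \<Rightarrow> (real \<times> real) \<times> real \<Rightarrow> real" where
  "Phi \<mu> L n \<xi> w t = (\<lambda>(v, x3).
     \<Sum>k\<le>n. D_kernel \<mu> k \<xi> t v * (\<Sum>l\<le>n - k. poly (p_L L l) w * poly (p_L L l) x3))"

definition xi :: "nat \<Rightarrow> nat \<Rightarrow> real" where
  "xi n \<nu> = real \<nu> * pi / real (n + 1)"

definition zpt :: "real \<Rightarrow> nat \<Rightarrow> nat \<Rightarrow> real" where
  "zpt L n i = L / 2 * (1 + cos (real (2 * i + 1) * pi / real (2 * n + 2)))"

text \<open>\<open>t\<close> and \<open>lam\<close> are the nodes and weights of the quadrature rule on \<open>[-1, 1]\<close>.\<close>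

definition T_kernel ::
    "real \<Rightarrow> real \<Rightarrow> nat \<Rightarrow> (nat \<Rightarrow> real) \<Rightarrow> (nat \<Rightarrow> real) \<Rightarrow> nat \<Rightarrow> nat \<Rightarrow> nat
       \<Rightarrow> (real \<times> real) \<times> real \<Rightarrow> real" where
  "T_kernel \<mu> L n t lam \<nu> j i x =
     a_const \<mu> * lam j / (real (n + 1))\<^sup>2 * (1 - (t j)\<^sup>2) powr (- \<mu>)
       * Phi \<mu> L n (xi n \<nu>) (zpt L n i) (t j) x"

definition B_op ::
    "real \<Rightarrow> real \<Rightarrow> nat \<Rightarrow> (nat \<Rightarrow> real) \<Rightarrow> (nat \<Rightarrow> real)
       \<Rightarrow> ((real \<times> real) \<times> real \<Rightarrow> real) \<Rightarrow> (real \<times> real) \<times> real \<Rightarrow> real" where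
  "B_op \<mu> L n t lam f x =
     (\<Sum>\<nu>\<le>n. \<Sum>j\<le>n. \<Sum>i\<le>n.
        radon \<mu> (xi n \<nu>) (\<lambda>v. f (v, zpt L n i)) (t j) * T_kernel \<mu> L n t lam \<nu> j i x)"

text \<open>
  A function on all of $R^3$ represents the element of $C(B_L)$ obtained by restriction to
  \<open>B_L L\<close>. The last clause therefore says that an \<open>f\<close> which coincides on \<open>B_L L\<close> with a
  polynomial \<open>q\<close> of total degree at most \<open>n\<close> is mapped to that polynomial. Linearity is
  part of the notion of projection operator.
\<close>

definition projection_onto_Pi3 ::
    "real \<Rightarrow> nat \<Rightarrow> (((real \<times> real) \<times> real \<Rightarrow> real) \<Rightarrow> (real \<times> real) \<times> real \<Rightarrow> real) \<Rightarrow> bool" where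
  "projection_onto_Pi3 L n \<B> \<longleftrightarrow>
     (\<forall>f g a b. continuous_on (B_L L) f \<longrightarrow> continuous_on (B_L L) g \<longrightarrow>
        \<B> (\<lambda>x. a * f x + b * g x) = (\<lambda>x. a * \<B> f x + b * \<B> g x)) \<and>
     (\<forall>f. continuous_on (B_L L) f \<longrightarrow> \<B> f \<in> Pi3 n) \<and>
     (\<forall>f. \<forall>q \<in> Pi3 n. (\<forall>x \<in> B_L L. f x = q x) \<longrightarrow> \<B> f = q)"

end

theory Submission
  imports Defs
begin

text \<open>
  Let $P$ be an orthogonal polynomial of degree $k$ on the disk. Up to the factor $(1-t^2)^\mu$ its
  Radon transform in direction $\theta$ is a polynomial of degree at most $k$ in $t$; being orthogonal
  to all lower powers of $t$, it is a multiple of $C_k^{\mu+1/2}(t)$, and the value at $t=1$ shows that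
  the multiple is proportional to $P(\cos\theta,\sin\theta)$. Hence for $f = P(x,y)\,p_c(z)$ the triple
  sum splits into three one-dimensional discrete orthogonality relations: the quadrature rule in $t$,
  which selects the degree $k$ of the kernel; equidistant nodes in the angle, where the parity of the
  polynomials leaves only even frequencies of size at most $2n$; and Chebyshev nodes in $z$. The constants
  $\lambda_{l,k}^\mu$ are what makes the product of the normalisations equal to $1$. Products of the
  orthonormal basis functions span the polynomials of degree at most $n$.

  The orthogonality of the disk polynomials to powers of $t$ is obtained from moments: the disk integral annihilates derivatives along rotations, hence every
  $z^a\bar z^b$ with $a\neq b$, and its values on $|z|^{2b}$ are Beta integrals.
\<close>

section \<open>Orthogonal polynomials\<close>

text \<open>The nodes \<xi>_\<nu> fill only a half circle, and there the n + 1 point sum annihilates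
  nonzero even frequencies but not odd ones. The angular sum is therefore evaluated only for the
  kernel degree that the sum over the nodes t_j has already selected: within one degree m all
  frequencies m - 2 l have the parity of m. The remaining kernel in z then has degrees up to n - m,
  which is what total degree n leaves.

  The constants have a common origin. On the unit circle a basis polynomial is a constant K times a
  cosine or sine, and the \<lambda> constant is the reciprocal of K^2 times the mean square of that
  function. The factor (k + \<mu> + 1/2) / (\<mu> + 1/2) times C_k(1) is the reciprocal of a squared
  norm relative to degree 0, and a_\<mu> is the reciprocal of the mass of the disk.

  The disk integral is an iterated integral in Cartesian coordinates, where rotation invariance is
  not visible and the weight may be singular. Its infinitesimal form is therefore checked on
  monomials, by recursions for one-dimensional moments. The orthogonal polynomials are defined by
  descriptions, so each is identified through an explicit hypergeometric sum and a uniqueness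
  argument.\<close>

lemma poly_expansion:
  fixes J :: "nat \<Rightarrow> real poly"
  assumes J: "\<And>k. degree (J k) = k" "\<And>k. J k \<noteq> 0" and q: "degree q \<le> n"
  shows "\<exists>c. q = (\<Sum>k\<le>n. smult (c k) (J k))"
  using q
proof (induction n arbitrary: q)
  case 0
  have "J 0 = [:coeff (J 0) 0:]" "q = [:coeff q 0:]"
    using J(1)[of 0] 0 by (auto elim!: degree_eq_zeroE)
  moreover have "coeff (J 0) 0 \<noteq> 0"
    using J(2)[of 0] calculation(1) by (metis pCons_0_0)
  ultimately have "q = smult (coeff q 0 / coeff (J 0) 0) (J 0)"
    by (metis nonzero_eq_divide_eq smult_0_right smult_pCons)
  then show ?case
    by (intro exI[of _ "\<lambda>_. coeff q 0 / coeff (J 0) 0"]) simp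
next
  case (Suc n)
  define c where "c = coeff q (Suc n) / coeff (J (Suc n)) (Suc n)"
  have nz: "coeff (J (Suc n)) (Suc n) \<noteq> 0"
    using J[of "Suc n"] by (metis leading_coeff_0_iff)
  have "degree (q - smult c (J (Suc n))) \<le> n"
  proof (rule degree_le, intro allI impI)
    fix i assume "n < i"
    then show "coeff (q - smult c (J (Suc n))) i = 0"
      using nz Suc.prems J(1)[of "Suc n"]
      by (cases "i = Suc n") (auto simp: c_def coeff_eq_0)
  qed
  then obtain d where d: "q - smult c (J (Suc n)) = (\<Sum>k\<le>n. smult (d k) (J k))"
    using Suc.IH by blast
  show ?case
    by (rule exI[of _ "d(Suc n := c)"]) (use d in \<open>auto simp: algebra_simps\<close>)
qed

text \<open>Only linearity, orthogonality and positive squares of a functional on polynomials are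
  abstracted. The same facts about lower degrees then serve the uniqueness argument for an arbitrary
  weight and the Jacobi weights; integrability is settled at each interpretation.\<close>

locale ortho_system =
  fixes I :: "real poly \<Rightarrow> real" and J :: "nat \<Rightarrow> real poly"
  assumes add: "I (p + q) = I p + I q"
    and smult: "I (smult c p) = c * I p"
    and deg: "degree (J k) = k"
    and ortho: "k \<noteq> l \<Longrightarrow> I (J k * J l) = 0"
    and pos: "I (J k * J k) > 0"
begin

lemma I_0: "I 0 = 0"
  using smult[of 0 0] by simp

lemma sum: "I (sum f A) = (\<Sum>x\<in>A. I (f x))"
  by (induction A rule: infinite_finite_induct) (auto simp: I_0 add)

lemma nonzero: "J k \<noteq> 0"
  using pos[of k] I_0 by auto

lemma orthogonal_eq_smult:
  assumes q: "degree q \<le> k" and o: "\<And>i. i < k \<Longrightarrow> I (q * J i) = 0"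
  shows "\<exists>c. q = smult c (J k)"
proof -
  obtain c where c: "q = (\<Sum>i\<le>k. smult (c i) (J i))"
    using poly_expansion[of J q k] deg nonzero q by blast
  have "c i = 0" if "i < k" for i
  proof -
    have "I (q * J i) = (\<Sum>j\<le>k. c j * I (J j * J i))"
      by (simp add: c sum_distrib_right sum smult)
    also have "\<dots> = (\<Sum>j\<le>k. if j = i then c i * I (J i * J i) else 0)"
      by (intro sum.cong) (auto simp: ortho)
    also have "\<dots> = c i * I (J i * J i)"
      using that by simp
    finally show ?thesis
      using o[OF that] pos[of i] by auto
  qed
  then have "q = (\<Sum>i\<le>k. if i = k then smult (c k) (J k) else 0)"
    unfolding c by (intro sum.cong) auto
  then show ?thesis by auto
qed

lemma ortho_lower:
  assumes "degree q < k"
  shows "I (J k * q) = 0"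
proof -
  obtain c where c: "q = (\<Sum>i\<le>degree q. smult (c i) (J i))"
    using poly_expansion[of J q "degree q"] deg nonzero by blast
  have "I (J k * q) = (\<Sum>i\<le>degree q. c i * I (J k * J i))"
    by (subst c) (simp add: sum_distrib_left sum smult)
  also have "\<dots> = 0"
    using assms by (intro sum.neutral) (auto simp: ortho)
  finally show ?thesis .
qed

end

text \<open>A member of a second family is orthogonal to all lower degrees, hence a multiple c of
  the member of the first. The norms give c^2 = 1 and the positive leading coefficients decide the
  sign. Integrability makes the integral additive on polynomials, which its default value 0 would
  not guarantee.\<close>

lemma orthonormal_poly_eqI:
  assumes int: "\<And>q. (\<lambda>x. poly q x * w x) integrable_on {a..b}"
    and fam: "is_orthonormal_family a b w p"
  shows "orthonormal_poly a b w = p"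
  unfolding orthonormal_poly_def
proof (rule the_equality, rule fam)
  fix p' assume fam': "is_orthonormal_family a b w p'"
  define I where "I q = integral {a..b} (\<lambda>x. poly q x * w x)" for q
  have *: "ortho_system I p" if fam: "is_orthonormal_family a b w p" for p
  proof
    fix q r :: "real poly" and c :: real and k l :: nat
    show "I (q + r) = I q + I r"
      using int[of q] int[of r] by (simp add: I_def distrib_right integral_add)
    show "I (smult c q) = c * I q"
      by (simp add: I_def mult.assoc)
    show "degree (p k) = k"
      using fam by (simp add: is_orthonormal_family_def)
    show "k \<noteq> l \<Longrightarrow> I (p k * p l) = 0" "I (p k * p k) > 0"
      using fam by (simp_all add: is_orthonormal_family_def I_def)
  qed
  interpret p: ortho_system I p using *[OF fam] .
  interpret p': ortho_system I p' using *[OF fam'] .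
  show "p' = p"
  proof
    fix k
    have "I (p' k * p i) = 0" if "i < k" for i
      using that by (intro p'.ortho_lower) (simp add: p.deg)
    then obtain c where c: "p' k = smult c (p k)"
      using p.orthogonal_eq_smult[of "p' k" k] p'.deg by force
    have one: "I (q k * q k) = 1" if "is_orthonormal_family a b w q" for q
      using that by (simp add: is_orthonormal_family_def I_def)
    have "c * c = 1"
      using one[OF fam] one[OF fam'] by (simp add: c p.smult)
    moreover have "lead_coeff (p' k) > 0" "lead_coeff (p k) > 0"
      using fam fam' unfolding is_orthonormal_family_def by blast+
    then have "c * lead_coeff (p k) > 0" "lead_coeff (p k) > 0"
      unfolding c lead_coeff_smult by simp_all
    then have "c > 0"
      by (simp add: zero_less_mult_iff)
    ultimately have "c = 1"
      using square_eq_1_iff[of c] by auto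
    then show "p' k = p k" by (simp add: c)
  qed
qed

section \<open>Jacobi polynomials\<close>

text \<open>Exponents such as \<open>\<mu> - 1/2\<close> may be negative, so the weights are
  unbounded at the endpoints. A nonnegative integrable weight is absolutely integrable, and a
  bounded measurable factor preserves this.\<close>

lemma integrable_continuous_weight:
  fixes f :: "real \<Rightarrow> 'a :: euclidean_space" and w :: "real \<Rightarrow> real"
  assumes f: "continuous_on {a..b} f" and w: "w integrable_on {a..b}"
    and nn: "\<And>x. x \<in> {a..b} \<Longrightarrow> 0 \<le> w x"
  shows "(\<lambda>x. w x *\<^sub>R f x) integrable_on {a..b}"
proof -
  have "(\<lambda>x. (\<lambda>y c. c *\<^sub>R y) (f x) (w x)) absolutely_integrable_on {a..b}"
  proof (rule absolutely_integrable_bounded_measurable_product[where h = "\<lambda>y c. c *\<^sub>R y"])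
    show "bilinear (\<lambda>(y::'a) (c::real). c *\<^sub>R y)"
      by (auto simp: bilinear_def linear_iff scaleR_add_left scaleR_add_right)
    show "f \<in> borel_measurable (lebesgue_on {a..b})"
      using f by (intro continuous_imp_measurable_on_sets_lebesgue) auto
    show "bounded (f ` {a..b})"
      using f by (intro compact_imp_bounded compact_continuous_image) auto
    show "w absolutely_integrable_on {a..b}"
      using w nn by (intro nonnegative_absolutely_integrable_1) auto
  qed auto
  then show ?thesis
    by (simp add: set_lebesgue_integral_eq_integral)
qed

text \<open>The substitution v = (1 + u) / 2 reduces this to Euler's Beta integral; v carries the
  exponent of 1 + u, hence the exchanged arguments of \<open>Beta\<close> in the proof.\<close>

lemma has_integral_jacobi_weight:
  assumes "\<alpha> > -1" "\<beta> > -1"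
  shows "(jacobi_weight \<alpha> \<beta> has_integral 2 powr (\<alpha> + \<beta> + 1) * Beta (\<alpha> + 1) (\<beta> + 1)) {-1..1}"
proof -
  define f where "f v = v powr (\<beta> + 1 - 1) * (1 - v) powr (\<alpha> + 1 - 1)" for v :: real
  have "(f has_integral Beta (\<beta> + 1) (\<alpha> + 1)) (cbox 0 1)"
    unfolding f_def using assms has_integral_Beta_real[of "\<beta> + 1" "\<alpha> + 1"] by simp
  from has_integral_affinity'[OF this, of "1/2" "1/2"]
  have "((\<lambda>u. f (u / 2 + 1 / 2)) has_integral Beta (\<beta> + 1) (\<alpha> + 1) * 2) {-1..1}"
    by (simp add: mult.commute)
  from has_integral_mult_right[OF this, of "2 powr (\<alpha> + \<beta>)"]
  have "((\<lambda>u. 2 powr (\<alpha> + \<beta>) * f (u / 2 + 1 / 2)) has_integral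
          2 powr (\<alpha> + \<beta> + 1) * Beta (\<alpha> + 1) (\<beta> + 1)) {-1..1}"
    by (simp add: powr_add Beta_commute mult_ac)
  moreover have "2 powr (\<alpha> + \<beta>) * f (u / 2 + 1 / 2) = jacobi_weight \<alpha> \<beta> u"
    if "u \<in> {-1..1}" for u
  proof -
    have e: "u / 2 + 1 / 2 = (1 + u) / 2" "1 - (1 + u) / 2 = (1 - u) / 2"
      by (simp_all add: field_simps)
    have "f (u / 2 + 1 / 2) = ((1 + u) / 2) powr \<beta> * ((1 - u) / 2) powr \<alpha>"
      unfolding f_def e add_diff_cancel_right' by (rule refl)
    also have "\<dots> = (1 + u) powr \<beta> / 2 powr \<beta> * ((1 - u) powr \<alpha> / 2 powr \<alpha>)"
      using that by (subst (1 2) powr_divide) auto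
    finally have "f (u / 2 + 1 / 2) = \<dots>" .
    then show ?thesis
      by (simp add: jacobi_weight_def powr_add)
  qed
  ultimately show ?thesis
    by (rule has_integral_eq[rotated])
qed

lemma jacobi_weight_nonneg: "jacobi_weight \<alpha> \<beta> u \<ge> 0"
  by (simp add: jacobi_weight_def)

lemma integrable_jacobi_weight:
  fixes f :: "real \<Rightarrow> real"
  assumes "\<alpha> > -1" "\<beta> > -1" "continuous_on {-1..1} f"
  shows "(\<lambda>u. f u * jacobi_weight \<alpha> \<beta> u) integrable_on {-1..1}"
  using integrable_continuous_weight[of "-1" 1 f "jacobi_weight \<alpha> \<beta>"] assms
    has_integral_integrable[OF has_integral_jacobi_weight[of \<alpha> \<beta>]] jacobi_weight_nonneg
  by (simp add: mult.commute)

section \<open>The Jacobi weight as a functional on polynomials\<close>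

definition jacobi_int :: "real \<Rightarrow> real \<Rightarrow> real poly \<Rightarrow> real" where
  "jacobi_int \<alpha> \<beta> q = integral {-1..1} (\<lambda>u. poly q u * jacobi_weight \<alpha> \<beta> u)"

lemma has_integral_jacobi_int:
  assumes "\<alpha> > -1" "\<beta> > -1"
  shows "((\<lambda>u. poly q u * jacobi_weight \<alpha> \<beta> u) has_integral jacobi_int \<alpha> \<beta> q) {-1..1}"
  unfolding jacobi_int_def using assms
  by (intro integrable_integral integrable_jacobi_weight continuous_intros)

lemma jacobi_int_add: "\<alpha> > -1 \<Longrightarrow> \<beta> > -1 \<Longrightarrow> jacobi_int \<alpha> \<beta> (p + q) = jacobi_int \<alpha> \<beta> p + jacobi_int \<alpha> \<beta> q"
  unfolding jacobi_int_def poly_add distrib_right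
  by (intro integral_add has_integral_integrable[OF has_integral_jacobi_int])

lemma jacobi_int_smult: "jacobi_int \<alpha> \<beta> (smult c p) = c * jacobi_int \<alpha> \<beta> p"
  by (simp add: jacobi_int_def mult.assoc)

lemma jacobi_int_sum: "\<alpha> > -1 \<Longrightarrow> \<beta> > -1 \<Longrightarrow> jacobi_int \<alpha> \<beta> (sum f A) = (\<Sum>x\<in>A. jacobi_int \<alpha> \<beta> (f x))"
  using jacobi_int_smult[of \<alpha> \<beta> 0 0]
  by (induction A rule: infinite_finite_induct) (auto simp: jacobi_int_add)

text \<open>Products of powers of these two have Beta integrals. At u = 2 r^2 - 1 the value of
  \<open>half_plus\<close> is r^2, so on the disk its powers become powers of z times its
  conjugate.\<close>

definition half_minus :: "real poly" where "half_minus = [:1/2, -1/2:]"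
definition half_plus :: "real poly" where "half_plus = [:1/2, 1/2:]"

lemma poly_half_minus: "poly half_minus u = (1 - u) / 2" and poly_half_plus: "poly half_plus u = (1 + u) / 2"
  by (simp_all add: half_minus_def half_plus_def field_simps)

text \<open>Pascal's rule: the alternating binomial sum of order l is an l-fold difference, and
  order l + 1 is one more difference of it.\<close>

lemma alternating_sum_Suc:
  fixes f :: "real \<Rightarrow> real"
  shows "(\<Sum>i\<le>Suc l. (-1) ^ i * real (Suc l choose i) * f (x + real i)) =
     (\<Sum>i\<le>l. (-1) ^ i * real (l choose i) * f (x + real i)) -
     (\<Sum>i\<le>l. (-1) ^ i * real (l choose i) * f (x + 1 + real i))"
proof -
  have "(\<Sum>i\<le>Suc l. (-1) ^ i * real (Suc l choose i) * f (x + real i)) =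
     f x + (\<Sum>i\<le>l. (-1) ^ Suc i * real (Suc l choose Suc i) * f (x + real (Suc i)))"
    by (subst sum.atMost_Suc_shift) simp
  also have "(\<Sum>i\<le>l. (-1) ^ Suc i * real (Suc l choose Suc i) * f (x + real (Suc i))) =
     (\<Sum>i\<le>l. (-1) ^ Suc i * real (l choose Suc i) * f (x + real (Suc i))) -
     (\<Sum>i\<le>l. (-1) ^ i * real (l choose i) * f (x + 1 + real i))"
    unfolding sum_subtractf[symmetric] by (intro sum.cong) (auto simp: algebra_simps)
  also have "f x + ((\<Sum>i\<le>l. (-1) ^ Suc i * real (l choose Suc i) * f (x + real (Suc i))) - 
     (\<Sum>i\<le>l. (-1) ^ i * real (l choose i) * f (x + 1 + real i))) =
     (\<Sum>i\<le>Suc l. (-1) ^ i * real (l choose i) * f (x + real i)) - 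
     (\<Sum>i\<le>l. (-1) ^ i * real (l choose i) * f (x + 1 + real i))"
    by (subst sum.atMost_Suc_shift) simp
  finally show ?thesis by simp
qed

text \<open>Each difference of a rising factorial lowers its degree by one, so l differences
  annihilate degree k < l.\<close>

lemma alternating_sum_pochhammer:
  "k < l \<Longrightarrow> (\<Sum>i\<le>l. (-1) ^ i * real (l choose i) * pochhammer (x + real i) k) = 0"
proof (induction l arbitrary: x k)
  case (Suc l)
  have "(\<Sum>i\<le>Suc l. (-1) ^ i * real (Suc l choose i) * pochhammer (x + real i) k) =
     (\<Sum>i\<le>l. (-1) ^ i * real (l choose i) *
        (pochhammer (x + real i) k - pochhammer (x + 1 + real i) k))"
    using alternating_sum_Suc[where f = "\<lambda>x. pochhammer x k"]
    by (simp add: sum_subtractf right_diff_distrib)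
  also have "\<dots> = - real k * (\<Sum>i\<le>l. (-1) ^ i * real (l choose i) * pochhammer (x + 1 + real i) (k - 1))"
  proof -
    have "pochhammer y k - pochhammer (y + 1) k = - real k * pochhammer (y + 1) (k - 1)" for y :: real
    proof (cases k)
      case (Suc j)
      have "pochhammer y (Suc j) = y * pochhammer (y + 1) j"
        by (rule pochhammer_rec)
      moreover have "pochhammer (y + 1) (Suc j) = pochhammer (y + 1) j * (y + 1 + real j)"
        by (rule pochhammer_Suc)
      ultimately show ?thesis
        by (simp add: Suc algebra_simps)
    qed simp
    from this[of "x + real i" for i] show ?thesis
      by (simp add: sum_distrib_left add_ac mult_ac)
  qed
  also have "\<dots> = 0"
    using Suc.IH[of "k - 1" "x + 1"] Suc.prems by (cases "k = 0") auto
  finally show ?case .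
qed simp

text \<open>The partial fraction expansion of the reciprocal rising factorial, obtained as the
  l-fold difference of 1/x.\<close>

lemma alternating_sum_inverse:
  "x > 0 \<Longrightarrow> (\<Sum>i\<le>l. (-1) ^ i * real (l choose i) * (1 / (x + real i))) = fact l / pochhammer x (Suc l)"
proof (induction l arbitrary: x)
  case (Suc l)
  have "(\<Sum>i\<le>Suc l. (-1) ^ i * real (Suc l choose i) * (1 / (x + real i))) =
     fact l / pochhammer x (Suc l) - fact l / pochhammer (x + 1) (Suc l)"
    using alternating_sum_Suc[where f = "\<lambda>x. 1 / x"] Suc.IH[of x] Suc.IH[of "x + 1"] Suc.prems
    by simp
  also have "\<dots> = fact (Suc l) / pochhammer x (Suc (Suc l))"
  proof -
    define P where "P = pochhammer (x + 1) l"
    have "P > 0" using Suc.prems by (simp add: P_def pochhammer_pos)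
    have "pochhammer x (Suc l) = x * P" "pochhammer (x + 1) (Suc l) = P * (x + 1 + real l)"
      "pochhammer x (Suc (Suc l)) = x * P * (x + 1 + real l)"
      by (simp_all add: P_def pochhammer_rec[of x] pochhammer_Suc[of "x + 1"])
    then show ?thesis
      using \<open>P > 0\<close> Suc.prems by (simp add: divide_simps) (simp add: algebra_simps)
  qed
  finally show ?case .
qed (simp add: pochhammer_Suc)

lemma jacobi_int_half_powers:
  assumes "\<alpha> > -1" "\<beta> > -1"
  shows "jacobi_int \<alpha> \<beta> (half_minus ^ i * half_plus ^ j) =
    2 powr (\<alpha> + \<beta> + 1) * Beta (\<alpha> + 1 + real i) (\<beta> + 1 + real j)"
proof -
  have "((\<lambda>u. poly (half_minus ^ i * half_plus ^ j) u * jacobi_weight \<alpha> \<beta> u) has_integral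
     (1/2) ^ (i + j) * (2 powr (\<alpha> + real i + (\<beta> + real j) + 1) *
       Beta (\<alpha> + real i + 1) (\<beta> + real j + 1))) {-1..1}"
  \<comment> \<open>On the open interval the powers merge with the weight; at an endpoint one of the
    bases is 0 and the laws of \<open>powr\<close> for positive bases do not apply.\<close>
  proof (rule has_integral_spike_finite[of "{-1, 1}"])
    show "((\<lambda>u. (1/2) ^ (i + j) * jacobi_weight (\<alpha> + real i) (\<beta> + real j) u) has_integral
     (1/2) ^ (i + j) * (2 powr (\<alpha> + real i + (\<beta> + real j) + 1) *
       Beta (\<alpha> + real i + 1) (\<beta> + real j + 1))) {-1..1}"
      using assms by (intro has_integral_mult_right has_integral_jacobi_weight) auto
  next
    fix u :: real assume "u \<in> {-1..1} - {-1, 1}"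
    then have "1 - u > 0" "1 + u > 0" by auto
    then show "poly (half_minus ^ i * half_plus ^ j) u * jacobi_weight \<alpha> \<beta> u =
       (1/2) ^ (i + j) * jacobi_weight (\<alpha> + real i) (\<beta> + real j) u"
      by (simp add: jacobi_weight_def poly_half_minus poly_half_plus powr_add powr_realpow power_add power_divide)
  qed auto
  then have "jacobi_int \<alpha> \<beta> (half_minus ^ i * half_plus ^ j) = (1/2) ^ (i + j) * (2 powr (\<alpha> + real i + (\<beta> + real j) + 1) *
       Beta (\<alpha> + real i + 1) (\<beta> + real j + 1))"
    unfolding jacobi_int_def by (rule integral_unique)
  then show ?thesis
    by (simp add: powr_add powr_realpow power_add power_divide add_ac)
qed

text \<open>The coefficients of the hypergeometric series 2F1(-l, l + \<alpha> + \<beta> + 1;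
  \<alpha> + 1), with (-l)_i / i! written as a signed binomial coefficient.\<close>

definition jac_coeff :: "nat \<Rightarrow> real \<Rightarrow> real \<Rightarrow> nat \<Rightarrow> real" where
  "jac_coeff l \<alpha> \<beta> i = (-1) ^ i * real (l choose i) * pochhammer (real l + \<alpha> + \<beta> + 1) i / pochhammer (\<alpha> + 1) i"

text \<open>
  The Jacobi polynomial with value 1 at 1, as a hypergeometric sum in \<open>(1 - u) / 2\<close>; \<open>jacobi\<close> and
  \<open>gegenbauer\<close> are multiples of it.
\<close>

definition jac :: "nat \<Rightarrow> real \<Rightarrow> real \<Rightarrow> real poly" where
  "jac l \<alpha> \<beta> = (\<Sum>i\<le>l. smult (jac_coeff l \<alpha> \<beta> i) (half_minus ^ i))"

lemma poly_jac_1: "poly (jac l \<alpha> \<beta>) 1 = 1"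
proof -
  have "poly (jac l \<alpha> \<beta>) 1 = (\<Sum>i\<le>l. if i = 0 then 1 else 0)"
    unfolding jac_def poly_sum
    by (intro sum.cong) (auto simp: poly_half_minus jac_coeff_def)
  then show ?thesis by simp
qed

lemma degree_half_minus_power: "degree (half_minus ^ i) = i" and degree_half_plus_power: "degree (half_plus ^ i) = i"
  by (simp_all add: half_minus_def half_plus_def degree_power_eq)

lemma lead_coeff_half_minus_power: "coeff (half_minus ^ i) i = (-1/2) ^ i"
  and lead_coeff_half_plus_power: "coeff (half_plus ^ i) i = (1/2) ^ i"
  using lead_coeff_power[of half_minus i] lead_coeff_power[of half_plus i]
  by (simp_all add: degree_half_minus_power degree_half_plus_power) (simp_all add: half_minus_def half_plus_def)

lemma coeff_jac: "coeff (jac l \<alpha> \<beta>) l = pochhammer (real l + \<alpha> + \<beta> + 1) l / pochhammer (\<alpha> + 1) l / 2 ^ l"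
proof -
  have "coeff (jac l \<alpha> \<beta>) l = (\<Sum>i\<le>l. if i = l then jac_coeff l \<alpha> \<beta> l * coeff (half_minus ^ l) l else 0)"
    unfolding jac_def coeff_sum coeff_smult
    by (intro sum.cong) (auto simp: coeff_eq_0 degree_half_minus_power)
  also have "\<dots> = jac_coeff l \<alpha> \<beta> l * (-1/2) ^ l"
    by (simp add: lead_coeff_half_minus_power)
  also have "(-1/2 :: real) ^ l = (-1) ^ l / 2 ^ l"
    by (rule power_divide)
  finally show ?thesis
    by (simp add: jac_coeff_def)
qed

lemma coeff_jac_pos:
  assumes "\<alpha> > -1" "\<alpha> + \<beta> + 1 > 0"
  shows "coeff (jac l \<alpha> \<beta>) l > 0"
  unfolding coeff_jac using assms by (intro divide_pos_pos pochhammer_pos) auto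

lemma degree_jac_le: "degree (jac l \<alpha> \<beta>) \<le> l"
  unfolding jac_def by (intro degree_sum_le) (auto intro: order_trans[OF degree_smult_le] simp: degree_half_minus_power)

lemma degree_jac:
  assumes "\<alpha> > -1" "\<alpha> + \<beta> + 1 > 0"
  shows "degree (jac l \<alpha> \<beta>) = l"
  using degree_jac_le[of l] le_degree[of "jac l \<alpha> \<beta>" l] coeff_jac_pos[OF assms, of l]
  by (intro antisym) auto

text \<open>Pairing with powers of \<open>half_plus\<close>, although \<open>jac\<close> is expanded
  in \<open>half_minus\<close>, lets the factor (\<alpha> + 1)_i of the Beta integral cancel the
  denominator of \<open>jac_coeff\<close>. What is left is an alternating binomial sum.\<close>

lemma jacobi_int_jac_half_plus:
  assumes "\<alpha> > -1" "\<beta> > -1" "\<alpha> + \<beta> + 1 > 0"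
  shows "jacobi_int \<alpha> \<beta> (jac l \<alpha> \<beta> * half_plus ^ j) = 2 powr (\<alpha> + \<beta> + 1) * (Gamma (\<alpha> + 1) * Gamma (\<beta> + 1 + real j) *
     (\<Sum>i\<le>l. (-1) ^ i * real (l choose i) *
        (pochhammer (real l + \<alpha> + \<beta> + 1) i / Gamma (\<alpha> + \<beta> + 2 + real j + real i))))"
proof -
  have g: "Gamma (\<alpha> + 1 + real i) = pochhammer (\<alpha> + 1) i * Gamma (\<alpha> + 1)" for i
    using assms by (subst pochhammer_Gamma) (auto simp: Gamma_eq_zero_iff)
  have p: "pochhammer (\<alpha> + 1) i > 0" for i
    using assms by (intro pochhammer_pos) auto
  have "jacobi_int \<alpha> \<beta> (jac l \<alpha> \<beta> * half_plus ^ j) = (\<Sum>i\<le>l. jac_coeff l \<alpha> \<beta> i * jacobi_int \<alpha> \<beta> (half_minus ^ i * half_plus ^ j))"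
    using assms by (simp add: jac_def sum_distrib_right jacobi_int_sum jacobi_int_smult)
  also have "\<dots> = (\<Sum>i\<le>l. 2 powr (\<alpha> + \<beta> + 1) * (Gamma (\<alpha> + 1) * Gamma (\<beta> + 1 + real j) *
     ((-1) ^ i * real (l choose i) *
        (pochhammer (real l + \<alpha> + \<beta> + 1) i / Gamma (\<alpha> + \<beta> + 2 + real j + real i)))))"
  proof (rule sum.cong[OF refl])
    fix i
    have e: "\<alpha> + 1 + real i + (\<beta> + 1 + real j) = \<alpha> + \<beta> + 2 + real j + real i" by simp
    show "jac_coeff l \<alpha> \<beta> i * jacobi_int \<alpha> \<beta> (half_minus ^ i * half_plus ^ j) = 2 powr (\<alpha> + \<beta> + 1) * (Gamma (\<alpha> + 1) * Gamma (\<beta> + 1 + real j) *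
     ((-1) ^ i * real (l choose i) *
        (pochhammer (real l + \<alpha> + \<beta> + 1) i / Gamma (\<alpha> + \<beta> + 2 + real j + real i))))"
      using p[of i] unfolding jacobi_int_half_powers[OF assms(1,2)] jac_coeff_def Beta_def g e by simp
  qed
  finally show ?thesis by (simp add: sum_distrib_left)
qed

text \<open>The quotient inside the alternating sum is, up to a constant, a rising factorial of
  degree l - 1 - j in i, too low to survive l differences.\<close>

lemma jacobi_int_jac_half_plus_less:
  assumes ab: "\<alpha> > -1" "\<beta> > -1" "\<alpha> + \<beta> + 1 > 0" and "j < l"
  shows "jacobi_int \<alpha> \<beta> (jac l \<alpha> \<beta> * half_plus ^ j) = 0"
proof -
  define A where "A = \<alpha> + \<beta> + 1"
  have A: "A > 0" using ab by (simp add: A_def)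
  have "pochhammer (real l + A) i / Gamma (A + 1 + real j + real i) =
     pochhammer (A + 1 + real j + real i) (l - 1 - j) / Gamma (real l + A)" for i
  proof -
    have e: "real l + A + real i = A + 1 + real j + real i + real (l - 1 - j)"
      using assms(4) by (simp add: of_nat_diff)
    show ?thesis
      using A by (subst (1 2) pochhammer_Gamma) (auto simp: e nonpos_Ints_def)
  qed
  then have "(\<Sum>i\<le>l. (-1) ^ i * real (l choose i) * (pochhammer (real l + A) i / Gamma (A + 1 + real j + real i)))
    = (\<Sum>i\<le>l. (-1) ^ i * real (l choose i) * pochhammer (A + 1 + real j + real i) (l - 1 - j)) / Gamma (real l + A)"
    by (simp add: sum_divide_distrib)
  also have "\<dots> = 0"
    using assms(4) by (subst alternating_sum_pochhammer) auto
  finally show ?thesis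
    unfolding jacobi_int_jac_half_plus[OF ab] A_def by (simp add: add_ac)
qed

text \<open>For j = l the quotient is just 1 / (B + i) up to a constant, and the partial fraction
  sum applies.\<close>

lemma jacobi_int_jac_half_plus_eq:
  assumes ab: "\<alpha> > -1" "\<beta> > -1" "\<alpha> + \<beta> + 1 > 0"
  shows "jacobi_int \<alpha> \<beta> (jac l \<alpha> \<beta> * half_plus ^ l) = 2 powr (\<alpha> + \<beta> + 1) * (Gamma (\<alpha> + 1) * Gamma (\<beta> + 1 + real l) *
     (fact l / pochhammer (real l + \<alpha> + \<beta> + 1) (Suc l) / Gamma (real l + \<alpha> + \<beta> + 1)))"
proof -
  define B where "B = real l + (\<alpha> + \<beta> + 1)"
  have B: "B > 0" using ab by (simp add: B_def)
  have "pochhammer B i / Gamma (B + 1 + real i) = 1 / (B + real i) / Gamma B" for i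
  proof -
    have "Gamma (B + 1 + real i) = (B + real i) * Gamma (B + real i)"
      using B Gamma_plus1[of "B + real i"] by (auto simp: nonpos_Ints_def add_ac)
    moreover have "Gamma (B + real i) \<noteq> 0" "Gamma B \<noteq> 0"
      using B by (auto simp: Gamma_eq_zero_iff nonpos_Ints_def)
    moreover have "pochhammer B i = Gamma (B + real i) / Gamma B"
      using B by (subst pochhammer_Gamma) (auto simp: nonpos_Ints_def)
    ultimately show ?thesis
      using B by simp
  qed
  then have "(\<Sum>i\<le>l. (-1) ^ i * real (l choose i) * (pochhammer B i / Gamma (B + 1 + real i))) =
     (\<Sum>i\<le>l. (-1) ^ i * real (l choose i) * (1 / (B + real i))) / Gamma B"
    by (simp add: sum_divide_distrib)
  also have "\<dots> = fact l / pochhammer B (Suc l) / Gamma B"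
    by (subst alternating_sum_inverse[OF B]) simp
  finally show ?thesis
    unfolding jacobi_int_jac_half_plus[OF ab] B_def by (simp add: add_ac)
qed

lemma jacobi_int_jac_lower:
  assumes ab: "\<alpha> > -1" "\<beta> > -1" "\<alpha> + \<beta> + 1 > 0" and q: "q = 0 \<or> degree q < l"
  shows "jacobi_int \<alpha> \<beta> (jac l \<alpha> \<beta> * q) = 0"
proof (cases "q = 0")
  case True
  then show ?thesis using jacobi_int_smult[of \<alpha> \<beta> 0 0] by simp
next
  case False
  have "half_plus ^ k \<noteq> 0" for k by (simp add: half_plus_def)
  then obtain c where c: "q = (\<Sum>k\<le>degree q. smult (c k) (half_plus ^ k))"
    using poly_expansion[of "\<lambda>k. half_plus ^ k" q "degree q"] degree_half_plus_power by auto
  have "jacobi_int \<alpha> \<beta> (jac l \<alpha> \<beta> * q) = (\<Sum>k\<le>degree q. c k * jacobi_int \<alpha> \<beta> (jac l \<alpha> \<beta> * half_plus ^ k))"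
    using ab by (subst c) (simp add: sum_distrib_left jacobi_int_sum jacobi_int_smult)
  also have "\<dots> = 0"
    using False q by (intro sum.neutral) (auto simp: jacobi_int_jac_half_plus_less[OF ab])
  finally show ?thesis .
qed

section \<open>Norms, and identification of the orthonormal Jacobi and the Gegenbauer
  polynomials\<close>

definition jac_norm :: "nat \<Rightarrow> real \<Rightarrow> real \<Rightarrow> real" where
  "jac_norm l \<alpha> \<beta> = jacobi_int \<alpha> \<beta> (jac l \<alpha> \<beta> * jac l \<alpha> \<beta>)"

text \<open>In one of the two factors only the leading term matters: it is replaced by a multiple of
  \<open>half_plus ^ l\<close>, and the remainder has lower degree, hence is orthogonal to
  \<open>jac\<close>.\<close>

lemma jac_norm_eq:
  assumes ab: "\<alpha> > -1" "\<beta> > -1" "\<alpha> + \<beta> + 1 > 0"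
  shows "jac_norm l \<alpha> \<beta> = pochhammer (real l + \<alpha> + \<beta> + 1) l / pochhammer (\<alpha> + 1) l *
    (2 powr (\<alpha> + \<beta> + 1) * (Gamma (\<alpha> + 1) * Gamma (\<beta> + 1 + real l) *
     (fact l / pochhammer (real l + \<alpha> + \<beta> + 1) (Suc l) / Gamma (real l + \<alpha> + \<beta> + 1))))"
proof -
  \<comment> \<open>\<kappa> matches the leading coefficients: that of \<open>half_plus ^ l\<close>
    is 1 / 2^l, which is also the last factor in \<open>coeff_jac\<close>.\<close>
  define \<kappa> where "\<kappa> = pochhammer (real l + \<alpha> + \<beta> + 1) l / pochhammer (\<alpha> + 1) l"
  define r where "r = jac l \<alpha> \<beta> - smult \<kappa> (half_plus ^ l)"
  have "r = 0 \<or> degree r < l"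
  proof (cases "l = 0")
    case True
    then show ?thesis by (simp add: r_def \<kappa>_def jac_def jac_coeff_def one_pCons)
  next
    case False
    have "coeff r i = 0" if "i \<ge> l" for i
    proof (cases "i = l")
      case False
      then have "coeff (jac l \<alpha> \<beta>) i = 0" "coeff (half_plus ^ l) i = 0"
        using that degree_jac_le[of l \<alpha> \<beta>] by (auto intro!: coeff_eq_0 simp: degree_half_plus_power)
      then show ?thesis by (simp add: r_def)
    qed (simp add: r_def coeff_jac lead_coeff_half_plus_power \<kappa>_def power_divide)
    then show ?thesis
      using False by (metis degree_less_if_less_eqI linorder_not_le leading_coeff_0_iff)
  qed
  then have "jacobi_int \<alpha> \<beta> (jac l \<alpha> \<beta> * r) = 0"
    by (rule jacobi_int_jac_lower[OF ab])
  moreover have "jac l \<alpha> \<beta> * jac l \<alpha> \<beta> = smult \<kappa> (jac l \<alpha> \<beta> * half_plus ^ l) + jac l \<alpha> \<beta> * r"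
    by (simp add: r_def algebra_simps)
  ultimately show ?thesis
    unfolding jac_norm_def using ab by (simp add: jacobi_int_add jacobi_int_smult jacobi_int_jac_half_plus_eq \<kappa>_def)
qed

lemma jac_norm_pos:
  assumes ab: "\<alpha> > -1" "\<beta> > -1" "\<alpha> + \<beta> + 1 > 0"
  shows "jac_norm l \<alpha> \<beta> > 0"
  unfolding jac_norm_eq[OF ab] using ab
  by (intro mult_pos_pos divide_pos_pos pochhammer_pos Gamma_real_pos) auto

lemma ortho_system_jac:
  assumes ab: "\<alpha> > -1" "\<beta> > -1" "\<alpha> + \<beta> + 1 > 0"
  shows "ortho_system (jacobi_int \<alpha> \<beta>) (\<lambda>l. jac l \<alpha> \<beta>)"
proof
  fix k l :: nat
  show "jacobi_int \<alpha> \<beta> (jac k \<alpha> \<beta> * jac l \<alpha> \<beta>) = 0" if "k \<noteq> l"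
  proof (cases "k < l")
    case True
    then show ?thesis
      using jacobi_int_jac_lower[OF ab, of "jac k \<alpha> \<beta>" l] ab by (simp add: degree_jac mult.commute)
  next
    case False
    then show ?thesis
      using that jacobi_int_jac_lower[OF ab, of "jac l \<alpha> \<beta>" k] ab by (simp add: degree_jac)
  qed
qed (use ab jac_norm_pos[OF ab] in \<open>auto simp: jacobi_int_add jacobi_int_smult degree_jac jac_norm_def\<close>)

text \<open>The squared factor that makes \<open>jac\<close> orthonormal for the weight of mass 1.
  The power of 2 and the Gamma values at \<alpha> + 1 and \<beta> + 1 cancel in the
  quotient.\<close>

lemma jac_norm_ratio:
  assumes ab: "\<alpha> > -1" "\<beta> > -1" "\<alpha> + \<beta> + 1 > 0"
  shows "jac_norm 0 \<alpha> \<beta> / jac_norm l \<alpha> \<beta> =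
    pochhammer (\<alpha> + 1) l * pochhammer (\<alpha> + \<beta> + 2) l * (\<alpha> + \<beta> + 1 + 2 * real l) /
    ((\<alpha> + \<beta> + 1 + real l) * fact l * pochhammer (\<beta> + 1) l)"
proof -
  define A where "A = \<alpha> + \<beta> + 1"
  have A: "A > 0" using ab by (simp add: A_def)
  define P where "P = pochhammer (A + real l) l"
  have P: "P > 0" using A by (simp add: P_def pochhammer_pos)
  have 1: "pochhammer (A + real l) (Suc l) = P * (A + 2 * real l)"
    by (simp add: P_def pochhammer_Suc)
  have 2: "Gamma (\<beta> + 1 + real l) = pochhammer (\<beta> + 1) l * Gamma (\<beta> + 1)"
    using ab by (subst pochhammer_Gamma) (auto simp: Gamma_eq_zero_iff nonpos_Ints_def)
  have 3: "Gamma (A + real l) * (A + real l) = pochhammer (A + 1) l * (A * Gamma A)"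
  proof -
    have "Gamma (A + real l) * (A + real l) = Gamma (A + real l + 1)"
      using A by (subst Gamma_plus1) (auto simp: nonpos_Ints_def)
    also have "\<dots> = pochhammer (A + 1) l * Gamma (A + 1)"
    proof -
      have "Gamma (A + 1) \<noteq> 0" using A by (auto simp: Gamma_eq_zero_iff nonpos_Ints_def)
      then show ?thesis
        using A by (subst pochhammer_Gamma) (auto simp: nonpos_Ints_def add_ac)
    qed
    also have "Gamma (A + 1) = A * Gamma A"
      using A by (subst Gamma_plus1) (auto simp: nonpos_Ints_def)
    finally show ?thesis .
  qed
  have 4: "Gamma (A + real l) = pochhammer (A + 1) l * (A * Gamma A) / (A + real l)"
    using 3 A by (simp add: field_simps)
  define Q where "Q = pochhammer (\<alpha> + 1) l"
  define R where "R = pochhammer (\<beta> + 1) l"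
  define S where "S = pochhammer (A + 1) l"
  define X where "X = 2 powr A * Gamma (\<alpha> + 1) * Gamma (\<beta> + 1)"
  have pos: "Q > 0" "R > 0" "S > 0" "X > 0"
    using ab A by (auto simp: Q_def R_def S_def X_def intro!: pochhammer_pos mult_pos_pos Gamma_real_pos)
  have G: "Gamma A \<noteq> 0" using A by (auto simp: Gamma_eq_zero_iff nonpos_Ints_def)
  have n0: "jac_norm 0 \<alpha> \<beta> = X / (A * Gamma A)"
    using jac_norm_eq[OF ab, of 0] by (simp add: A_def X_def)
  have "jac_norm l \<alpha> \<beta> = P / Q * (X * R * (fact l / (P * (A + 2 * real l)) / (S * (A * Gamma A) / (A + real l))))"
  proof -
    have e: "real l + \<alpha> + \<beta> + 1 = A + real l" "\<alpha> + \<beta> + 1 = A"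
      by (simp_all add: A_def)
    show ?thesis
      unfolding jac_norm_eq[OF ab, of l] e 1 2 4 P_def Q_def R_def S_def X_def by simp
  qed
  then have nl: "jac_norm l \<alpha> \<beta> = X * R * fact l * (A + real l) / (Q * S * (A + 2 * real l) * (A * Gamma A))"
    using P by (simp add: mult_ac)
  have "jac_norm 0 \<alpha> \<beta> / jac_norm l \<alpha> \<beta> = Q * S * (A + 2 * real l) / ((A + real l) * fact l * R)"
    unfolding n0 nl using pos A G by (simp add: divide_simps)
  then show ?thesis
    by (simp add: A_def Q_def R_def S_def add_ac)
qed

text \<open>Since \<open>jac 0\<close> is the constant 1, \<open>jac_norm 0\<close> is the mass of
  the weight and accounts for its normalization; the leading coefficients of \<open>jac\<close> are
  positive, so the positive square root is the right multiple.\<close>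

lemma jacobi_eq:
  assumes ab: "\<alpha> > -1" "\<beta> > -1" "\<alpha> + \<beta> + 1 > 0"
  shows "jacobi l \<alpha> \<beta> = smult (sqrt (jac_norm 0 \<alpha> \<beta> / jac_norm l \<alpha> \<beta>)) (jac l \<alpha> \<beta>)"
proof -
  interpret ortho_system "jacobi_int \<alpha> \<beta>" "\<lambda>l. jac l \<alpha> \<beta>" by (rule ortho_system_jac[OF ab])
  let ?N = "integral {-1..1} (jacobi_weight \<alpha> \<beta>)"
  let ?w = "\<lambda>t. jacobi_weight \<alpha> \<beta> t / ?N"
  define p where "p l = smult (sqrt (jac_norm 0 \<alpha> \<beta> / jac_norm l \<alpha> \<beta>)) (jac l \<alpha> \<beta>)" for l
  have "jac 0 \<alpha> \<beta> = 1"
    by (simp add: jac_def jac_coeff_def)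
  then have N: "?N = jac_norm 0 \<alpha> \<beta>"
    by (simp add: jac_norm_def jacobi_int_def)
  note npos = jac_norm_pos[OF ab]
  have I: "integral {-1..1} (\<lambda>x. poly q x * ?w x) = jacobi_int \<alpha> \<beta> q / ?N" for q
    unfolding jacobi_int_def by simp
  have "is_orthonormal_family (-1) 1 ?w p"
    unfolding is_orthonormal_family_def
  proof (intro conjI allI)
    fix k l
    show "degree (p k) = k"
      using npos[of 0] npos[of k] by (simp add: p_def deg)
    then show "lead_coeff (p k) > 0"
      using coeff_jac_pos[of \<alpha> \<beta> k] ab npos[of 0] npos[of k] by (simp add: p_def)
    have "integral {-1..1} (\<lambda>x. poly (p k) x * poly (p l) x * ?w x) = jacobi_int \<alpha> \<beta> (p k * p l) / ?N"
      using I[of "p k * p l"] by simp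
    also have "\<dots> = (if k = l then 1 else 0)"
      using npos[of 0] npos[of k] ortho[of k l] unfolding N
      by (auto simp: p_def jacobi_int_smult jac_norm_def[symmetric])
    finally show "integral {-1..1} (\<lambda>x. poly (p k) x * poly (p l) x * ?w x) = (if k = l then 1 else 0)" .
  qed
  moreover have "(\<lambda>x. poly q x * ?w x) integrable_on {-1..1}" for q
    using integrable_on_divide[OF has_integral_integrable[OF has_integral_jacobi_int[of \<alpha> \<beta> q]], of ?N] ab by simp
  ultimately have "orthonormal_poly (-1) 1 ?w = p"
    by (intro orthonormal_poly_eqI)
  then show ?thesis
    by (simp add: jacobi_def p_def)
qed

lemma jacobi_weight_same: "jacobi_weight \<nu> \<nu> s = (1 - s\<^sup>2) powr \<nu>" if "s \<in> {-1..1}"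
  using that by (simp add: jacobi_weight_def flip: powr_mult) (simp add: power2_eq_square algebra_simps)

text \<open>For the parameter \<mu> + 1/2 the Gegenbauer weight is the Jacobi weight with both
  exponents \<mu>. Orthogonality leaves a scalar, which the prescribed value at 1 determines because
  \<open>jac\<close> is 1 there.\<close>

lemma gegenbauer_eq:
  assumes "\<mu> \<ge> 0"
  shows "gegenbauer k (\<mu> + 1/2) = smult (pochhammer (2 * \<mu> + 1) k / fact k) (jac k \<mu> \<mu>)"
proof -
  have ab: "\<mu> > -1" "\<mu> > -1" "\<mu> + \<mu> + 1 > 0" using assms by auto
  interpret ortho_system "jacobi_int \<mu> \<mu>" "\<lambda>l. jac l \<mu> \<mu>" by (rule ortho_system_jac[OF ab])
  have pp: "pochhammer (2 * \<mu> + 1) k > 0"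
    using assms by (intro pochhammer_pos) auto
  have I: "integral {-1..1} (\<lambda>s. poly q s * poly r s * (1 - s\<^sup>2) powr (\<mu> + 1/2 - 1/2)) = jacobi_int \<mu> \<mu> (q * r)" for q r
    unfolding jacobi_int_def by (rule integral_cong) (simp add: jacobi_weight_same)
  show ?thesis
    unfolding gegenbauer_def I
  proof (rule the_equality)
    show "degree (smult (pochhammer (2 * \<mu> + 1) k / fact k) (jac k \<mu> \<mu>)) = k \<and>
       (\<forall>r. degree r < k \<longrightarrow> jacobi_int \<mu> \<mu> (smult (pochhammer (2 * \<mu> + 1) k / fact k) (jac k \<mu> \<mu>) * r) = 0) \<and>
       poly (smult (pochhammer (2 * \<mu> + 1) k / fact k) (jac k \<mu> \<mu>)) 1 = pochhammer (2 * (\<mu> + 1/2)) k / fact k"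
      using pp ortho_lower[of _ k] by (simp add: deg smult poly_jac_1)
  next
    fix q
    assume q: "degree q = k \<and> (\<forall>r. degree r < k \<longrightarrow> jacobi_int \<mu> \<mu> (q * r) = 0) \<and>
       poly q 1 = pochhammer (2 * (\<mu> + 1/2)) k / fact k"
    then obtain c where "q = smult c (jac k \<mu> \<mu>)"
      using orthogonal_eq_smult[of q k] deg by auto
    then show "q = smult (pochhammer (2 * \<mu> + 1) k / fact k) (jac k \<mu> \<mu>)"
      using q by (simp add: poly_jac_1)
  qed
qed

section \<open>Moments of the weights on the interval and the disk\<close>

definition moment :: "real \<Rightarrow> nat \<Rightarrow> real" where
  "moment \<nu> a = integral {-1..1} (\<lambda>s. (1 - s\<^sup>2) powr \<nu> * s ^ a)"

lemma has_integral_sym_weight: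
  fixes \<nu> :: real
  assumes "\<nu> > -1"
  shows "((\<lambda>s. (1 - s\<^sup>2) powr \<nu>) has_integral 2 powr (2 * \<nu> + 1) * Beta (\<nu> + 1) (\<nu> + 1)) {-1..1}"
proof -
  have "(jacobi_weight \<nu> \<nu> has_integral 2 powr (2 * \<nu> + 1) * Beta (\<nu> + 1) (\<nu> + 1)) {-1..1}"
    using has_integral_jacobi_weight[OF assms assms] by simp
  then show ?thesis
    by (rule has_integral_eq[rotated]) (rule jacobi_weight_same)
qed

lemma integrable_sym_weight:
  fixes f :: "real \<Rightarrow> 'a :: euclidean_space" and \<nu> :: real
  assumes "\<nu> > -1" "continuous_on {-1..1} f"
  shows "(\<lambda>s. (1 - s\<^sup>2) powr \<nu> *\<^sub>R f s) integrable_on {-1..1}"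
  using assms has_integral_sym_weight[of \<nu>] by (intro integrable_continuous_weight) auto

lemma has_integral_moment:
  assumes "\<nu> > -1"
  shows "((\<lambda>s. (1 - s\<^sup>2) powr \<nu> * s ^ a) has_integral moment \<nu> a) {-1..1}"
proof -
  have "continuous_on {-1..1} (\<lambda>s::real. s ^ a)"
    by (intro continuous_intros)
  from integrable_sym_weight[OF assms this] show ?thesis
    unfolding moment_def by (intro integrable_integral) simp
qed

lemma moment_0: "\<nu> > -1 \<Longrightarrow> moment \<nu> 0 = 2 powr (2 * \<nu> + 1) * Beta (\<nu> + 1) (\<nu> + 1)"
  using integral_unique[OF has_integral_sym_weight[of \<nu>]] by (simp add: moment_def)

lemma moment_odd: "odd a \<Longrightarrow> moment \<nu> a = 0"
proof -
  assume "odd a"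
  have "integral {-1..1} (\<lambda>s. (1 - (-s)\<^sup>2) powr \<nu> * (-s) ^ a) = moment \<nu> a"
    using Henstock_Kurzweil_Integration.integral_reflect_real[of 1 "-1" "\<lambda>s. (1 - s\<^sup>2) powr \<nu> * s ^ a"]
    by (simp add: moment_def)
  moreover have "integral {-1..1} (\<lambda>s. (1 - (-s)\<^sup>2) powr \<nu> * (-s) ^ a) = - moment \<nu> a"
    unfolding moment_def using \<open>odd a\<close> by (simp add: power_minus_odd)
  ultimately show ?thesis by simp
qed

text \<open>Integration of the derivative of s^(a+1) (1 - s^2)^(\<nu>+1), whose boundary values
  vanish because \<nu> + 1 > 0.\<close>

lemma moment_parts:
  assumes \<nu>: "\<nu> > -1"
  shows "(real a + 1) * moment (\<nu> + 1) a = 2 * (\<nu> + 1) * moment \<nu> (a + 2)"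
proof -
  define F where "F s = s ^ (a + 1) * (1 - s\<^sup>2) powr (\<nu> + 1)" for s :: real
  let ?F' = "\<lambda>s. (real a + 1) * ((1 - s\<^sup>2) powr (\<nu> + 1) * s ^ a) -
                2 * (\<nu> + 1) * ((1 - s\<^sup>2) powr \<nu> * s ^ (a + 2))"
  have "(?F' has_integral (F 1 - F (-1))) {-1..1}"
  proof (rule fundamental_theorem_of_calculus_interior)
    show "continuous_on {-1..1} F"
      unfolding F_def using \<nu>
      by (intro continuous_intros continuous_on_powr') (auto simp: abs_square_le_1 abs_le_iff)
    fix s :: real assume s: "s \<in> {-1<..<1}"
    then have p: "1 - s\<^sup>2 > 0" by (simp add: abs_square_less_1 abs_less_iff)
    have "((\<lambda>s. 1 - s\<^sup>2) has_real_derivative (- 2 * s)) (at s)"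
      by (auto intro!: derivative_eq_intros)
    from DERIV_chain2[OF has_real_derivative_powr[OF p, of "\<nu> + 1"] this]
    have "((\<lambda>s. (1 - s\<^sup>2) powr (\<nu> + 1)) has_real_derivative (\<nu> + 1) * (1 - s\<^sup>2) powr \<nu> * (- 2 * s)) (at s)"
      by simp
    from DERIV_mult[OF DERIV_pow[of "a + 1" s] this]
    have "(F has_real_derivative (real a + 1) * s ^ a * (1 - s\<^sup>2) powr (\<nu> + 1) +
        (\<nu> + 1) * (1 - s\<^sup>2) powr \<nu> * (- 2 * s) * s ^ (a + 1)) (at s)"
      unfolding F_def by (simp add: add_ac)
    also have "(real a + 1) * s ^ a * (1 - s\<^sup>2) powr (\<nu> + 1) +
        (\<nu> + 1) * (1 - s\<^sup>2) powr \<nu> * (- 2 * s) * s ^ (a + 1) = ?F' s"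
      by (simp add: algebra_simps)
    finally have "(F has_real_derivative ?F' s) (at s)" .
    then show "(F has_vector_derivative ?F' s) (at s)"
      by (simp add: has_real_derivative_iff_has_vector_derivative)
  qed auto
  moreover have "(?F' has_integral ((real a + 1) * moment (\<nu> + 1) a - 2 * (\<nu> + 1) * moment \<nu> (a + 2))) {-1..1}"
    using \<nu> by (intro has_integral_diff has_integral_mult_right has_integral_moment) auto
  ultimately have "F 1 - F (-1) = (real a + 1) * moment (\<nu> + 1) a - 2 * (\<nu> + 1) * moment \<nu> (a + 2)"
    by (rule has_integral_unique)
  then show ?thesis by (simp add: F_def)
qed

lemma moment_Suc_weight:
  assumes "\<nu> > -1"
  shows "moment (\<nu> + 1) a = moment \<nu> a - moment \<nu> (a + 2)"
proof -
  have "((\<lambda>s. (1 - s\<^sup>2) powr (\<nu> + 1) * s ^ a) has_integral moment \<nu> a - moment \<nu> (a + 2)) {-1..1}"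
  proof (rule has_integral_eq)
    show "((\<lambda>s. (1 - s\<^sup>2) powr \<nu> * s ^ a - (1 - s\<^sup>2) powr \<nu> * s ^ (a + 2)) has_integral moment \<nu> a - moment \<nu> (a + 2)) {-1..1}"
      using assms by (intro has_integral_diff has_integral_moment)
    fix s :: real assume "s \<in> {-1..1}"
    then have "1 - s\<^sup>2 \<ge> 0" by (simp add: abs_square_le_1 abs_le_iff)
    then show "(1 - s\<^sup>2) powr \<nu> * s ^ a - (1 - s\<^sup>2) powr \<nu> * s ^ (a + 2) = (1 - s\<^sup>2) powr (\<nu> + 1) * s ^ a"
      by (simp add: powr_add algebra_simps power2_eq_square)
  qed
  then show ?thesis unfolding moment_def by (rule integral_unique)
qed

text \<open>Eliminates the moment with raised exponent between \<open>moment_parts\<close> and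
  \<open>moment_Suc_weight\<close>.\<close>

lemma moment_rec:
  assumes "\<nu> > -1"
  shows "(real a + 1) * moment \<nu> a = (real a + 2 * \<nu> + 3) * moment \<nu> (a + 2)"
proof -
  have "(real a + 1) * moment \<nu> a = (real a + 1) * moment (\<nu> + 1) a + (real a + 1) * moment \<nu> (a + 2)"
    unfolding moment_Suc_weight[OF assms] by (simp add: algebra_simps)
  then show ?thesis
    unfolding moment_parts[OF assms] by (simp add: algebra_simps)
qed

text \<open>
  The point of the disk at distance \<open>t\<close> from the centre in a fixed direction is parametrised by
  \<open>Complex t (s * sqrt (1 - t\<^sup>2))\<close> with \<open>s\<close> in $[-1,1]$, so that \<open>slice\<close> is the Radon transform
  without its factor $(1-t^2)^\mu$ and \<open>disk_int\<close> is the integral over the disk.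
\<close>

definition slice :: "real \<Rightarrow> (complex \<Rightarrow> complex) \<Rightarrow> real \<Rightarrow> complex" where
  "slice \<mu> F t = integral {-1..1} (\<lambda>s. (1 - s\<^sup>2) powr (\<mu> - 1/2) *\<^sub>R F (Complex t (s * sqrt (1 - t\<^sup>2))))"

definition disk_int :: "real \<Rightarrow> (complex \<Rightarrow> complex) \<Rightarrow> complex" where
  "disk_int \<mu> F = integral {-1..1} (\<lambda>t. (1 - t\<^sup>2) powr \<mu> *\<^sub>R slice \<mu> F t)"

text \<open>Bundles existence of the integral on every chord with polynomial dependence on t. The
  first makes \<open>slice\<close> additive, the second makes the outer integral in
  \<open>disk_int\<close> exist, and d records the degree in t.\<close>

definition poly_slice :: "real \<Rightarrow> nat \<Rightarrow> (complex \<Rightarrow> complex) \<Rightarrow> bool" where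
  "poly_slice \<mu> d F \<longleftrightarrow> (\<exists>g. degree g \<le> d \<and> (\<forall>t\<in>{-1..1}.
     ((\<lambda>s. (1 - s\<^sup>2) powr (\<mu> - 1/2) *\<^sub>R F (Complex t (s * sqrt (1 - t\<^sup>2)))) has_integral
        poly g (of_real t)) {-1..1}))"

section \<open>Calculus of slices and disk integrals\<close>

lemma poly_slice_mono: "poly_slice \<mu> d F \<Longrightarrow> d \<le> e \<Longrightarrow> poly_slice \<mu> e F"
  unfolding poly_slice_def by (meson order_trans)

lemma poly_slice_add:
  assumes "poly_slice \<mu> d F" "poly_slice \<mu> d G"
  shows "poly_slice \<mu> d (\<lambda>z. F z + G z)"
proof -
  from assms obtain f g where fg: "degree f \<le> d" "degree g \<le> d"
    "\<And>t. t \<in> {-1..1} \<Longrightarrow> ((\<lambda>s. (1 - s\<^sup>2) powr (\<mu> - 1/2) *\<^sub>R F (Complex t (s * sqrt (1 - t\<^sup>2)))) has_integral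
        poly f (of_real t)) {-1..1}"
    "\<And>t. t \<in> {-1..1} \<Longrightarrow> ((\<lambda>s. (1 - s\<^sup>2) powr (\<mu> - 1/2) *\<^sub>R G (Complex t (s * sqrt (1 - t\<^sup>2)))) has_integral
        poly g (of_real t)) {-1..1}"
    unfolding poly_slice_def by blast
  show ?thesis
    unfolding poly_slice_def poly_add scaleR_add_right
    by (intro exI[of _ "f + g"] conjI ballI degree_add_le fg) (simp add: has_integral_add fg)
qed

lemma poly_slice_scale:
  assumes "poly_slice \<mu> d F"
  shows "poly_slice \<mu> d (\<lambda>z. c * F z)"
proof -
  from assms obtain f where f: "degree f \<le> d"
    "\<And>t. t \<in> {-1..1} \<Longrightarrow> ((\<lambda>s. (1 - s\<^sup>2) powr (\<mu> - 1/2) *\<^sub>R F (Complex t (s * sqrt (1 - t\<^sup>2)))) has_integral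
        poly f (of_real t)) {-1..1}"
    unfolding poly_slice_def by blast
  have "((\<lambda>s. (1 - s\<^sup>2) powr (\<mu> - 1/2) *\<^sub>R (c * F (Complex t (s * sqrt (1 - t\<^sup>2))))) has_integral
        poly (smult c f) (of_real t)) {-1..1}" if "t \<in> {-1..1}" for t
    unfolding poly_smult mult_scaleR_right[symmetric] by (rule has_integral_mult_right[OF f(2)[OF that]])
  moreover have "degree (smult c f) \<le> d"
    using f(1) by simp
  ultimately show ?thesis
    unfolding poly_slice_def by blast
qed

lemma poly_slice_0: "poly_slice \<mu> d (\<lambda>z. 0)"
  unfolding poly_slice_def by (rule exI[of _ 0]) simp

lemma poly_slice_sum:
  "(\<And>i. i \<in> A \<Longrightarrow> poly_slice \<mu> d (F i)) \<Longrightarrow> poly_slice \<mu> d (\<lambda>z. \<Sum>i\<in>A. F i z)"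
  by (induction A rule: infinite_finite_induct) (auto simp: poly_slice_0 poly_slice_add)

lemma slice_add:
  assumes "poly_slice \<mu> d F" "poly_slice \<mu> e G" "t \<in> {-1..1}"
  shows "slice \<mu> (\<lambda>z. F z + G z) t = slice \<mu> F t + slice \<mu> G t"
  using assms unfolding slice_def scaleR_add_right
  by (intro integral_add) (auto simp: poly_slice_def has_integral_iff)

lemma slice_scale: "slice \<mu> (\<lambda>z. c * F z) t = c * slice \<mu> F t"
  unfolding slice_def mult_scaleR_right[symmetric] by (rule Henstock_Kurzweil_Integration.integral_mult_right)

lemma poly_sliceD:
  assumes "poly_slice \<mu> d F"
  obtains g where "degree g \<le> d" "\<And>t. t \<in> {-1..1} \<Longrightarrow> slice \<mu> F t = poly g (of_real t)"
proof -
  obtain g where g: "degree g \<le> d" "\<And>t. t \<in> {-1..1} \<Longrightarrow>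
      ((\<lambda>s. (1 - s\<^sup>2) powr (\<mu> - 1/2) *\<^sub>R F (Complex t (s * sqrt (1 - t\<^sup>2)))) has_integral
        poly g (of_real t)) {-1..1}"
    using assms unfolding poly_slice_def by blast
  show thesis
    by (rule that[OF g(1)]) (simp only: slice_def integral_unique[OF g(2)])
qed

lemma integrable_slice:
  assumes "\<mu> \<ge> 0" "poly_slice \<mu> d F"
  shows "(\<lambda>t. (1 - t\<^sup>2) powr \<mu> *\<^sub>R slice \<mu> F t) integrable_on {-1..1}"
proof -
  obtain g where g: "\<And>t. t \<in> {-1..1} \<Longrightarrow> slice \<mu> F t = poly g (of_real t)"
    using poly_sliceD[OF assms(2)] by blast
  have "(\<lambda>t. (1 - t\<^sup>2) powr \<mu> *\<^sub>R poly g (of_real t)) integrable_on {-1..1}"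
    using assms by (intro integrable_sym_weight continuous_intros) auto
  then show ?thesis
    by (rule integrable_eq) (simp add: g)
qed

lemma disk_int_add:
  assumes "\<mu> \<ge> 0" "poly_slice \<mu> d F" "poly_slice \<mu> e G"
  shows "disk_int \<mu> (\<lambda>z. F z + G z) = disk_int \<mu> F + disk_int \<mu> G"
proof -
  have "disk_int \<mu> (\<lambda>z. F z + G z) =
     integral {-1..1} (\<lambda>t. (1 - t\<^sup>2) powr \<mu> *\<^sub>R slice \<mu> F t + (1 - t\<^sup>2) powr \<mu> *\<^sub>R slice \<mu> G t)"
    unfolding disk_int_def
    by (rule integral_cong) (simp add: slice_add[OF assms(2,3)] scaleR_add_right)
  also have "\<dots> = disk_int \<mu> F + disk_int \<mu> G"
    unfolding disk_int_def using assms by (intro integral_add integrable_slice)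
  finally show ?thesis .
qed

lemma disk_int_scale: "disk_int \<mu> (\<lambda>z. c * F z) = c * disk_int \<mu> F"
  unfolding disk_int_def slice_scale mult_scaleR_right[symmetric] by (rule Henstock_Kurzweil_Integration.integral_mult_right)

lemma disk_int_sum:
  assumes "\<mu> \<ge> 0" "\<And>i. i \<in> A \<Longrightarrow> poly_slice \<mu> d (F i)"
  shows "disk_int \<mu> (\<lambda>z. \<Sum>i\<in>A. F i z) = (\<Sum>i\<in>A. disk_int \<mu> (F i))"
  using assms(2)
proof (induction A rule: infinite_finite_induct)
  case (insert x A)
  then show ?case
    using disk_int_add[OF assms(1), of d "F x" d "\<lambda>z. \<Sum>i\<in>A. F i z"] by (simp add: poly_slice_sum)
qed (use disk_int_scale[of \<mu> 0] in auto)

lemma has_integral_slice_monomial: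
  assumes "\<mu> \<ge> 0"
  shows "((\<lambda>s. (1 - s\<^sup>2) powr (\<mu> - 1/2) *\<^sub>R
            complex_of_real (Re (Complex t (s * r)) ^ a * Im (Complex t (s * r)) ^ b)) has_integral
           complex_of_real (t ^ a * r ^ b * moment (\<mu> - 1/2) b)) {-1..1}"
proof -
  have "((\<lambda>s. complex_of_real (t ^ a * r ^ b * ((1 - s\<^sup>2) powr (\<mu> - 1/2) * s ^ b))) has_integral
           complex_of_real (t ^ a * r ^ b * moment (\<mu> - 1/2) b)) {-1..1}"
    using assms by (intro has_integral_of_real has_integral_mult_right has_integral_moment) auto
  then show ?thesis
    by (simp add: scaleR_conv_of_real power_mult_distrib mult_ac)
qed

text \<open>An odd power of the square root of 1 - t^2 would not be a polynomial, but it comes with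
  an odd moment of the symmetric weight, which is 0.\<close>

lemma poly_slice_monomial:
  assumes "\<mu> \<ge> 0"
  shows "poly_slice \<mu> (a + b) (\<lambda>z. of_real (Re z ^ a * Im z ^ b))"
proof -
  define g :: "complex poly" where
    "g = smult (of_real (moment (\<mu> - 1/2) b)) ([:0, 1:] ^ a * [:1, 0, -1:] ^ (b div 2))"
  have "degree g \<le> a + b"
  proof -
    have "degree g \<le> degree ([:0, 1:] ^ a * [:1, 0, -1:] ^ (b div 2) :: complex poly)"
      unfolding g_def by (rule degree_smult_le)
    also have "\<dots> \<le> a + 2 * (b div 2)"
      by (intro order_trans[OF degree_mult_le] add_mono) (auto simp: degree_power_eq)
    finally show ?thesis by simp
  qed
  moreover have eq: "complex_of_real (t ^ a * sqrt (1 - t\<^sup>2) ^ b * moment (\<mu> - 1/2) b) = poly g (of_real t)"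
    if t: "t \<in> {-1..1}" for t
  proof (cases "even b")
    case True
    then obtain c where b: "b = 2 * c" by blast
    have "1 - t\<^sup>2 \<ge> 0" using t by (simp add: abs_square_le_1 abs_le_iff)
    then have "sqrt (1 - t\<^sup>2) ^ b = (1 - t\<^sup>2) ^ c"
      by (simp add: b power_mult)
    then show ?thesis
      by (simp add: g_def b poly_power power2_eq_square)
  qed (simp add: g_def moment_odd)
  ultimately show ?thesis
    unfolding poly_slice_def
  proof (intro exI[of _ g] conjI ballI)
    fix t :: real assume t: "t \<in> {-1..1}"
    show "((\<lambda>s. (1 - s\<^sup>2) powr (\<mu> - 1/2) *\<^sub>R
        complex_of_real (Re (Complex t (s * sqrt (1 - t\<^sup>2))) ^ a * Im (Complex t (s * sqrt (1 - t\<^sup>2))) ^ b))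
        has_integral poly g (of_real t)) {-1..1}"
      unfolding eq[OF t, symmetric] by (rule has_integral_slice_monomial[OF assms])
  qed
qed

text \<open>The power of the square root of 1 - t^2 produced by the slice raises the exponent of the
  outer weight from \<mu> to \<mu> + b/2.\<close>

lemma disk_int_monomial:
  assumes "\<mu> \<ge> 0"
  shows "disk_int \<mu> (\<lambda>z. of_real (Re z ^ a * Im z ^ b)) =
     of_real (moment (\<mu> - 1/2) b * moment (\<mu> + real b / 2) a)"
proof -
  have "disk_int \<mu> (\<lambda>z. of_real (Re z ^ a * Im z ^ b)) =
     integral {-1..1} (\<lambda>t. complex_of_real (moment (\<mu> - 1/2) b * ((1 - t\<^sup>2) powr (\<mu> + real b / 2) * t ^ a)))"
    unfolding disk_int_def
  proof (rule integral_cong)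
    fix t :: real assume t: "t \<in> {-1..1}"
    then have p: "1 - t\<^sup>2 \<ge> 0" by (simp add: abs_square_le_1 abs_le_iff)
    have "slice \<mu> (\<lambda>z. of_real (Re z ^ a * Im z ^ b)) t =
       complex_of_real (t ^ a * sqrt (1 - t\<^sup>2) ^ b * moment (\<mu> - 1/2) b)"
      unfolding slice_def by (rule integral_unique[OF has_integral_slice_monomial[OF assms]])
    moreover have "(1 - t\<^sup>2) powr \<mu> * sqrt (1 - t\<^sup>2) ^ b = (1 - t\<^sup>2) powr (\<mu> + real b / 2)"
    \<comment> \<open>At t = 1 and t = -1 both sides are 0, since \<open>0 powr x\<close> is 0 for
      every exponent.\<close>
    proof (cases "1 - t\<^sup>2 = 0")
      case False
      then have "sqrt (1 - t\<^sup>2) ^ b = (1 - t\<^sup>2) powr (real b / 2)"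
        using p by (simp add: powr_half_sqrt[symmetric] powr_realpow[symmetric] powr_powr)
      then show ?thesis by (simp add: powr_add)
    qed simp
    ultimately show "(1 - t\<^sup>2) powr \<mu> *\<^sub>R slice \<mu> (\<lambda>z. of_real (Re z ^ a * Im z ^ b)) t =
       complex_of_real (moment (\<mu> - 1/2) b * ((1 - t\<^sup>2) powr (\<mu> + real b / 2) * t ^ a))"
      by (simp add: scaleR_conv_of_real mult_ac flip: of_real_mult)
  qed
  also have "\<dots> = of_real (moment (\<mu> - 1/2) b * moment (\<mu> + real b / 2) a)"
    by (rule integral_unique, rule has_integral_of_real, rule has_integral_mult_right, rule has_integral_moment)
       (use assms in simp)
  finally show ?thesis .
qed

text \<open>
  \<open>rot_deriv d F G\<close>: \<open>F\<close> is a homogeneous polynomial of degree \<open>d\<close> in the real and imaginary parts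
  and \<open>G\<close> is its derivative along rotations, $x F_y - y F_x$.
\<close>

inductive rot_deriv :: "nat \<Rightarrow> (complex \<Rightarrow> complex) \<Rightarrow> (complex \<Rightarrow> complex) \<Rightarrow> bool" where
  monomial: "a + b = d \<Longrightarrow> rot_deriv d (\<lambda>z. of_real (Re z ^ a * Im z ^ b))
     (\<lambda>z. of_nat b * of_real (Re z ^ (a + 1) * Im z ^ (b - 1)) +
          (- of_nat a) * of_real (Re z ^ (a - 1) * Im z ^ (b + 1)))"
| add: "rot_deriv d F F' \<Longrightarrow> rot_deriv d G G' \<Longrightarrow> rot_deriv d (\<lambda>z. F z + G z) (\<lambda>z. F' z + G' z)"
| scale: "rot_deriv d F F' \<Longrightarrow> rot_deriv d (\<lambda>z. c * F z) (\<lambda>z. c * F' z)"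

lemma rot_deriv_poly_slice:
  assumes "\<mu> \<ge> 0" "rot_deriv d F G"
  shows "poly_slice \<mu> d F \<and> poly_slice \<mu> d G"
  using assms(2)
proof induction
  case (monomial a b d)
  have "poly_slice \<mu> d (\<lambda>z. of_nat b * of_real (Re z ^ (a + 1) * Im z ^ (b - 1)))"
  \<comment> \<open>For b = 0 the truncated b - 1 leaves a monomial of degree d + 1; its coefficient
    0 removes it. The same happens below for a = 0.\<close>
  proof (cases b)
    case (Suc b')
    then show ?thesis
      using poly_slice_scale[OF poly_slice_monomial[OF assms(1), of "a + 1" b'], of "of_nat b"] monomial by simp
  qed (simp add: poly_slice_0)
  moreover have "poly_slice \<mu> d (\<lambda>z. (- of_nat a) * of_real (Re z ^ (a - 1) * Im z ^ (b + 1)))"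
  proof (cases a)
    case (Suc a')
    then show ?thesis
      using poly_slice_scale[OF poly_slice_monomial[OF assms(1), of a' "b + 1"], of "- of_nat a"] monomial by simp
  qed (simp add: poly_slice_0)
  ultimately show ?case
    using poly_slice_monomial[OF assms(1), of a b] monomial poly_slice_add by blast
qed (auto intro: poly_slice_add poly_slice_scale)

text \<open>The infinitesimal form of rotation invariance. For a monomial the two terms of the
  derivative balance by a moment recursion in each variable; when a or b is 0, one term has
  coefficient 0 and the other an odd moment.\<close>

lemma disk_int_rot_deriv:
  assumes mu: "\<mu> \<ge> 0" and "rot_deriv d F G"
  shows "disk_int \<mu> G = 0"
  using assms(2)
proof induction
  case (monomial a b d)
  define A :: complex where "A = of_nat b * of_real (moment (\<mu> - 1/2) (b - 1) * moment (\<mu> + real (b - 1) / 2) (a + 1))"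
  define B :: complex where "B = of_nat a * of_real (moment (\<mu> - 1/2) (b + 1) * moment (\<mu> + real (b + 1) / 2) (a - 1))"
  have pos: "\<mu> - 1/2 > -1" using mu by simp
  have "A = B"
  proof (cases "a = 0 \<or> b = 0")
    case True
    then show ?thesis
      by (auto simp: A_def B_def moment_odd)
  next
    case False
    then obtain p q where pq: "a = Suc p" "b = Suc q"
      by (metis not0_implies_Suc)
    \<comment> \<open>The recursions in s and in t share the factor q + 2 \<mu> + 2, and this is
      what makes the two terms equal.\<close>
    have 1: "(real q + 1) * moment (\<mu> - 1/2) q = (real q + 2 * \<mu> + 2) * moment (\<mu> - 1/2) (q + 2)"
      using moment_rec[OF pos, of q] by (simp add: algebra_simps)
    have 2: "(real p + 1) * moment (\<mu> + real q / 2 + 1) p = (real q + 2 * \<mu> + 2) * moment (\<mu> + real q / 2) (p + 2)"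
      using moment_parts[of "\<mu> + real q / 2" p] mu by (simp add: algebra_simps)
    have c: "\<mu> + real (b + 1) / 2 = \<mu> + real q / 2 + 1"
      by (simp add: pq field_simps)
    have r: "real b = real q + 1" "real a = real p + 1" "b - 1 = q" "a - 1 = p" "b + 1 = q + 2" "a + 1 = p + 2"
      by (simp_all add: pq)
    have "real b * (moment (\<mu> - 1/2) (b - 1) * moment (\<mu> + real (b - 1) / 2) (a + 1)) =
       (real q + 1) * moment (\<mu> - 1/2) q * moment (\<mu> + real q / 2) (p + 2)"
      unfolding r by (rule mult.assoc[symmetric])
    also have "\<dots> = moment (\<mu> - 1/2) (q + 2) * ((real q + 2 * \<mu> + 2) * moment (\<mu> + real q / 2) (p + 2))"
      unfolding 1 by (simp only: mult_ac)
    also have "\<dots> = real a * (moment (\<mu> - 1/2) (b + 1) * moment (\<mu> + real (b + 1) / 2) (a - 1))"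
      unfolding c unfolding r 2[symmetric] by (simp only: mult_ac)
    finally have "real b * (moment (\<mu> - 1/2) (b - 1) * moment (\<mu> + real (b - 1) / 2) (a + 1)) =
      real a * (moment (\<mu> - 1/2) (b + 1) * moment (\<mu> + real (b + 1) / 2) (a - 1))" .
    from arg_cong[OF this, of complex_of_real] show ?thesis
      by (simp add: A_def B_def)
  qed
  moreover have "disk_int \<mu> (\<lambda>z. of_nat b * of_real (Re z ^ (a + 1) * Im z ^ (b - 1)) +
          (- of_nat a) * of_real (Re z ^ (a - 1) * Im z ^ (b + 1))) = A - B"
    unfolding disk_int_add[OF mu poly_slice_scale[OF poly_slice_monomial[OF mu]] poly_slice_scale[OF poly_slice_monomial[OF mu]]]
      disk_int_scale disk_int_monomial[OF mu] A_def B_def by simp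
  ultimately show ?case by simp
next
  case (add d F F' G G')
  then show ?case
    using rot_deriv_poly_slice[OF mu] disk_int_add[OF mu] by (metis add_0)
qed (simp add: disk_int_scale)

text \<open>In polar coordinates the constant is the quotient of the integrals of r^(d+3) and
  r^(d+1) against (1 - r^2)^(\<mu>-1/2); it depends only on the degree of F. The proof obtains it on
  monomials from the moment recursions, with \<open>rot_deriv\<close> supplying the induction over
  homogeneous polynomials.\<close>

lemma disk_int_norm_mult:
  assumes mu: "\<mu> \<ge> 0" and "rot_deriv d F G"
  shows "poly_slice \<mu> (d + 2) (\<lambda>z. z * cnj z * F z) \<and>
    disk_int \<mu> (\<lambda>z. z * cnj z * F z) = of_real ((real d + 2) / (real d + 2 * \<mu> + 3)) * disk_int \<mu> F"
  using assms(2)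
proof induction
  case (monomial a b d)
  have pos: "\<mu> - 1/2 > -1" "\<mu> + real b / 2 > -1" using mu by simp_all
  have eq: "(\<lambda>z. z * cnj z * of_real (Re z ^ a * Im z ^ b)) =
     (\<lambda>z. of_real (Re z ^ (a + 2) * Im z ^ b) + of_real (Re z ^ a * Im z ^ (b + 2)))"
    by (auto simp: fun_eq_iff complex_mult_cnj power2_eq_square algebra_simps simp flip: of_real_mult of_real_add)
  have s: "poly_slice \<mu> (d + 2) (\<lambda>z. of_real (Re z ^ (a + 2) * Im z ^ b))"
    "poly_slice \<mu> (d + 2) (\<lambda>z. of_real (Re z ^ a * Im z ^ (b + 2)))"
    using poly_slice_monomial[OF mu, of "a + 2" b] poly_slice_monomial[OF mu, of a "b + 2"] monomial
    by (simp_all add: add_ac)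
  have "(real d + 2 * \<mu> + 3) * (moment (\<mu> - 1/2) b * moment (\<mu> + real b / 2) (a + 2) +
      moment (\<mu> - 1/2) (b + 2) * moment (\<mu> + real (b + 2) / 2) a) =
      (real d + 2) * (moment (\<mu> - 1/2) b * moment (\<mu> + real b / 2) a)"
  proof -
    have 0: "\<mu> + real (b + 2) / 2 = \<mu> + real b / 2 + 1" by (simp add: field_simps)
    have 1: "(real b + 1) * moment (\<mu> - 1/2) b = (real b + 2 * \<mu> + 2) * moment (\<mu> - 1/2) (b + 2)"
      using moment_rec[OF pos(1), of b] by (simp add: algebra_simps)
    have 2: "moment (\<mu> + real b / 2 + 1) a = moment (\<mu> + real b / 2) a - moment (\<mu> + real b / 2) (a + 2)"
      by (rule moment_Suc_weight[OF pos(2)])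
    have d: "real d = real a + real b" using monomial by simp
    have 3: "(real a + 1) * moment (\<mu> + real b / 2) a = (real d + 2 * \<mu> + 3) * moment (\<mu> + real b / 2) (a + 2)"
      using moment_rec[OF pos(2), of a] unfolding d by (simp add: algebra_simps)
    define X Y U V where "X = moment (\<mu> - 1/2) b" and "Y = moment (\<mu> - 1/2) (b + 2)"
      and "U = moment (\<mu> + real b / 2) a" and "V = moment (\<mu> + real b / 2) (a + 2)"
    define c where "c = real b + 2 * \<mu> + 2"
    have c: "c > 0" using mu by (simp add: c_def)
    have e1: "(real b + 1) * X = c * Y" and e3: "(real a + 1) * U = (real a + 1 + c) * V"
      using 1 3 by (simp_all add: X_def Y_def U_def V_def c_def d algebra_simps)
    have "c * ((real a + 1 + c) * (X * V + Y * (U - V))) =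
      (real a + 1 + c) * V * (c * X) + (c * Y) * ((real a + 1 + c) * U - (real a + 1 + c) * V)"
      by (simp add: algebra_simps)
    also have "\<dots> = c * ((real a + real b + 2) * (X * U))"
      unfolding e1[symmetric] e3[symmetric] by (simp add: algebra_simps)
    finally have "(real a + 1 + c) * (X * V + Y * (U - V)) = (real a + real b + 2) * (X * U)"
      using c by simp
    then show ?thesis
      unfolding 0 2 by (simp add: X_def Y_def U_def V_def c_def d algebra_simps)
  qed
  then have "moment (\<mu> - 1/2) b * moment (\<mu> + real b / 2) (a + 2) +
      moment (\<mu> - 1/2) (b + 2) * moment (\<mu> + real (b + 2) / 2) a =
      (real d + 2) / (real d + 2 * \<mu> + 3) * (moment (\<mu> - 1/2) b * moment (\<mu> + real b / 2) a)"
    using mu by (simp add: field_simps)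
  then show ?case
    unfolding eq disk_int_add[OF mu s] disk_int_monomial[OF mu]
    using poly_slice_add[OF s] by (simp flip: of_real_mult of_real_add)
next
  case (add d F F' G G')
  have s: "poly_slice \<mu> d F" "poly_slice \<mu> d G"
    using add.hyps rot_deriv_poly_slice[OF mu] by auto
  show ?case
    using add.IH poly_slice_add disk_int_add[OF mu, of "d + 2" _ "d + 2"]
    by (simp add: distrib_left disk_int_add[OF mu s])
next
  case (scale d F F' c)
  have e: "(\<lambda>z. z * cnj z * (c * F z)) = (\<lambda>z. c * (z * cnj z * F z))" by (simp add: mult_ac)
  show ?case
    unfolding e disk_int_scale
    by (rule conjI, rule poly_slice_scale[OF scale.IH[THEN conjunct1]])
       (simp add: scale.IH[THEN conjunct2])
qed

text \<open>The product rule: along rotations the derivative of x is -y and that of y is x.\<close>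

lemma rot_deriv_Re_Im:
  assumes "rot_deriv d F G"
  shows "rot_deriv (d + 1) (\<lambda>z. of_real (Re z) * F z) (\<lambda>z. of_real (Re z) * G z - of_real (Im z) * F z) \<and>
    rot_deriv (d + 1) (\<lambda>z. of_real (Im z) * F z) (\<lambda>z. of_real (Im z) * G z + of_real (Re z) * F z)"
  using assms
proof induction
  case (monomial a b d)
  let ?G = "\<lambda>z. complex_of_nat b * of_real (Re z ^ (a + 1) * Im z ^ (b - 1)) +
          (- of_nat a) * of_real (Re z ^ (a - 1) * Im z ^ (b + 1))"
  have "rot_deriv (d + 1) (\<lambda>z. of_real (Re z ^ (a + 1) * Im z ^ b))
     (\<lambda>z. of_nat b * of_real (Re z ^ (a + 1 + 1) * Im z ^ (b - 1)) +
          (- of_nat (a + 1)) * of_real (Re z ^ (a + 1 - 1) * Im z ^ (b + 1)))"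
    using monomial by (intro rot_deriv.monomial) auto
  moreover have "(\<lambda>z. complex_of_real (Re z ^ (a + 1) * Im z ^ b)) = (\<lambda>z. of_real (Re z) * of_real (Re z ^ a * Im z ^ b))"
    by (simp add: mult_ac)
  moreover have "(\<lambda>z. complex_of_nat b * of_real (Re z ^ (a + 1 + 1) * Im z ^ (b - 1)) +
          (- of_nat (a + 1)) * of_real (Re z ^ (a + 1 - 1) * Im z ^ (b + 1))) =
     (\<lambda>z. of_real (Re z) * ?G z - of_real (Im z) * of_real (Re z ^ a * Im z ^ b))"
    by (cases a) (auto simp: fun_eq_iff algebra_simps)
  moreover have "rot_deriv (d + 1) (\<lambda>z. of_real (Re z ^ a * Im z ^ (b + 1)))
     (\<lambda>z. of_nat (b + 1) * of_real (Re z ^ (a + 1) * Im z ^ (b + 1 - 1)) +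
          (- of_nat a) * of_real (Re z ^ (a - 1) * Im z ^ (b + 1 + 1)))"
    using monomial by (intro rot_deriv.monomial) auto
  moreover have "(\<lambda>z. complex_of_real (Re z ^ a * Im z ^ (b + 1))) = (\<lambda>z. of_real (Im z) * of_real (Re z ^ a * Im z ^ b))"
    by (simp add: mult_ac)
  moreover have "(\<lambda>z. complex_of_nat (b + 1) * of_real (Re z ^ (a + 1) * Im z ^ (b + 1 - 1)) +
          (- of_nat a) * of_real (Re z ^ (a - 1) * Im z ^ (b + 1 + 1))) =
     (\<lambda>z. of_real (Im z) * ?G z + of_real (Re z) * of_real (Re z ^ a * Im z ^ b))"
    by (cases b) (auto simp: fun_eq_iff algebra_simps)
  ultimately show ?case by simp
next
  case (add d F F' G G')
  note r = rot_deriv.add[OF add.IH(1)[THEN conjunct1] add.IH(2)[THEN conjunct1]]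
    rot_deriv.add[OF add.IH(1)[THEN conjunct2] add.IH(2)[THEN conjunct2]]
  show ?case using r by (simp add: algebra_simps)
next
  case (scale d F F' c)
  note r = rot_deriv.scale[OF scale.IH[THEN conjunct1], of c] rot_deriv.scale[OF scale.IH[THEN conjunct2], of c]
  show ?case using r by (simp add: algebra_simps)
qed

text \<open>z and its conjugate are eigenfunctions of the rotational derivative, with eigenvalues
  \<open>\<i>\<close> and \<open>- \<i>\<close>; this is why complex monomials replace real ones
  from here on.\<close>

lemma rot_deriv_mult:
  assumes "rot_deriv d F G"
  shows "rot_deriv (d + 1) (\<lambda>z. z * F z) (\<lambda>z. z * G z + \<i> * (z * F z))"
    and "rot_deriv (d + 1) (\<lambda>z. cnj z * F z) (\<lambda>z. cnj z * G z - \<i> * (cnj z * F z))"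
proof -
  note r = rot_deriv_Re_Im[OF assms]
  have 1: "(\<lambda>z. of_real (Re z) * F z + \<i> * (of_real (Im z) * F z)) = (\<lambda>z. z * F z)"
    "(\<lambda>z. of_real (Re z) * F z + (- \<i>) * (of_real (Im z) * F z)) = (\<lambda>z. cnj z * F z)"
    by (auto simp: fun_eq_iff complex_eq_iff algebra_simps)
  have 2: "(\<lambda>z. of_real (Re z) * G z - of_real (Im z) * F z + \<i> * (of_real (Im z) * G z + of_real (Re z) * F z)) =
      (\<lambda>z. z * G z + \<i> * (z * F z))"
    "(\<lambda>z. of_real (Re z) * G z - of_real (Im z) * F z + (- \<i>) * (of_real (Im z) * G z + of_real (Re z) * F z)) =
      (\<lambda>z. cnj z * G z - \<i> * (cnj z * F z))"
    by (auto simp: fun_eq_iff complex_eq_iff algebra_simps)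
  show "rot_deriv (d + 1) (\<lambda>z. z * F z) (\<lambda>z. z * G z + \<i> * (z * F z))"
    using rot_deriv.add[OF r[THEN conjunct1] rot_deriv.scale[OF r[THEN conjunct2], of \<i>]] unfolding 1 2 .
  show "rot_deriv (d + 1) (\<lambda>z. cnj z * F z) (\<lambda>z. cnj z * G z - \<i> * (cnj z * F z))"
    using rot_deriv.add[OF r[THEN conjunct1] rot_deriv.scale[OF r[THEN conjunct2], of "- \<i>"]] unfolding 1 2 .
qed

lemma rot_deriv_z_cnj:
  "rot_deriv (a + b) (\<lambda>z. z ^ a * cnj z ^ b) (\<lambda>z. \<i> * (of_nat a - of_nat b) * (z ^ a * cnj z ^ b))"
proof (induction a)
  case 0
  show ?case
  proof (induction b)
    case 0
    show ?case using rot_deriv.monomial[of 0 0 0] by simp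
  next
    case (Suc b)
    have "(\<lambda>z. cnj z * (z ^ 0 * cnj z ^ b)) = (\<lambda>z. z ^ 0 * cnj z ^ Suc b)"
      "(\<lambda>z. cnj z * (\<i> * (of_nat 0 - of_nat b) * (z ^ 0 * cnj z ^ b)) - \<i> * (cnj z * (z ^ 0 * cnj z ^ b))) =
       (\<lambda>z. \<i> * (of_nat 0 - of_nat (Suc b)) * (z ^ 0 * cnj z ^ Suc b))"
      by (auto simp: fun_eq_iff algebra_simps)
    with rot_deriv_mult(2)[OF Suc] show ?case by simp
  qed
next
  case (Suc a)
  have "(\<lambda>z. z * (z ^ a * cnj z ^ b)) = (\<lambda>z. z ^ Suc a * cnj z ^ b)"
    "(\<lambda>z. z * (\<i> * (of_nat a - of_nat b) * (z ^ a * cnj z ^ b)) + \<i> * (z * (z ^ a * cnj z ^ b))) =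
     (\<lambda>z. \<i> * (of_nat (Suc a) - of_nat b) * (z ^ Suc a * cnj z ^ b))"
    by (auto simp: fun_eq_iff algebra_simps)
  with rot_deriv_mult(1)[OF Suc] show ?case by simp
qed

text \<open>The monomial is an eigenfunction with eigenvalue \<open>\<i> * (a - b)\<close>, which is
  nonzero, while the integral of its derivative is 0.\<close>

lemma disk_int_z_cnj_neq:
  assumes "\<mu> \<ge> 0" "a \<noteq> b"
  shows "disk_int \<mu> (\<lambda>z. z ^ a * cnj z ^ b) = 0"
proof -
  have "\<i> * (of_nat a - of_nat b) * disk_int \<mu> (\<lambda>z. z ^ a * cnj z ^ b) = 0"
    using disk_int_rot_deriv[OF assms(1) rot_deriv_z_cnj[of a b]] by (simp add: disk_int_scale)
  then show ?thesis using assms(2) by simp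
qed

text \<open>Both sides are multiplied by (2 b + 2) / (2 b + 2 \<mu> + 3) when b grows by 1. The
  right side is the radial integral in u = 2 |z|^2 - 1. The constant quotient stays unevaluated,
  because it will only multiply a vanishing sum.\<close>

lemma disk_int_z_cnj_eq:
  assumes "\<mu> \<ge> 0"
  shows "disk_int \<mu> (\<lambda>z. z ^ b * cnj z ^ b) =
     of_real (jacobi_int (\<mu> - 1/2) 0 (half_plus ^ b)) * (disk_int \<mu> (\<lambda>z. 1) / of_real (jacobi_int (\<mu> - 1/2) 0 1))"
proof -
  have J: "jacobi_int (\<mu> - 1/2) 0 (half_plus ^ b) = 2 powr (\<mu> + 1/2) * Beta (\<mu> + 1/2) (1 + real b)" for b
    using jacobi_int_half_powers[of "\<mu> - 1/2" 0 0 b] assms by (simp add: add.commute)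
  have J1: "jacobi_int (\<mu> - 1/2) 0 1 \<noteq> 0"
    using J[of 0] assms by (simp add: Beta_def Gamma_eq_zero_iff nonpos_Ints_def)
  show ?thesis
  proof (induction b)
    case 0
    then show ?case using J1 by simp
  next
    case (Suc b)
    have "(1 + real b + (\<mu> + 1/2)) * Beta (1 + real b + 1) (\<mu> + 1/2) = (1 + real b) * Beta (1 + real b) (\<mu> + 1/2)"
      using assms by (intro Beta_plus1_left) (auto simp: nonpos_Ints_def)
    then have B: "Beta (\<mu> + 1/2) (1 + real (Suc b)) =
       (2 * real b + 2) / (2 * real b + 2 * \<mu> + 3) * Beta (\<mu> + 1/2) (1 + real b)"
      using assms unfolding Beta_commute[of "\<mu> + 1/2"] by (simp add: field_simps)
    have "disk_int \<mu> (\<lambda>z. z ^ Suc b * cnj z ^ Suc b) = disk_int \<mu> (\<lambda>z. z * cnj z * (z ^ b * cnj z ^ b))"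
      by (simp add: mult_ac)
    also have "\<dots> = of_real ((real (b + b) + 2) / (real (b + b) + 2 * \<mu> + 3)) * disk_int \<mu> (\<lambda>z. z ^ b * cnj z ^ b)"
      using disk_int_norm_mult[OF assms rot_deriv_z_cnj[of b b]] by simp
    also have "\<dots> = of_real (jacobi_int (\<mu> - 1/2) 0 (half_plus ^ Suc b)) * (disk_int \<mu> (\<lambda>z. 1) / of_real (jacobi_int (\<mu> - 1/2) 0 1))"
      unfolding Suc.IH J B of_nat_add mult_2[symmetric] by simp
    finally show ?case .
  qed
qed

section \<open>The Radon transform of the disk polynomials\<close>

text \<open>The complex, unnormalized disk polynomial of degree j + 2 l: real parts of multiples of
  it give the cosine and the sine version together, and a rotation acts on it by a scalar.\<close>

definition disk_base :: "real \<Rightarrow> nat \<Rightarrow> nat \<Rightarrow> complex \<Rightarrow> complex" where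
  "disk_base \<mu> j l z = z ^ j * of_real (poly (jac l (\<mu> - 1/2) (real j)) (2 * (cmod z)\<^sup>2 - 1))"

lemma disk_base_expansion:
  obtains c where "jac l (\<mu> - 1/2) (real j) = (\<Sum>i\<le>l. smult (c i) (half_plus ^ i))"
    and "disk_base \<mu> j l = (\<lambda>z. \<Sum>i\<le>l. of_real (c i) * (z ^ (j + i) * cnj z ^ i))"
proof -
  have "half_plus ^ k \<noteq> 0" for k by (simp add: half_plus_def)
  then obtain c where c: "jac l (\<mu> - 1/2) (real j) = (\<Sum>i\<le>l. smult (c i) (half_plus ^ i))"
    using poly_expansion[of "\<lambda>k. half_plus ^ k" "jac l (\<mu> - 1/2) (real j)" l] degree_half_plus_power degree_jac_le by auto
  have "disk_base \<mu> j l z = (\<Sum>i\<le>l. of_real (c i) * (z ^ (j + i) * cnj z ^ i))" for z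
  proof -
    have h: "complex_of_real (poly half_plus (2 * (cmod z)\<^sup>2 - 1)) = z * cnj z"
      by (simp add: poly_half_plus complex_norm_square[symmetric])
    show ?thesis
      unfolding disk_base_def c
      by (simp add: poly_sum h power_mult_distrib sum_distrib_left power_add mult_ac)
  qed
  then show thesis using that c by blast
qed

lemma poly_slice_z_cnj:
  assumes "\<mu> \<ge> 0" "a + b \<le> d"
  shows "poly_slice \<mu> d (\<lambda>z. z ^ a * cnj z ^ b)"
  using rot_deriv_poly_slice[OF assms(1) rot_deriv_z_cnj[of a b]] poly_slice_mono assms(2) by blast

lemma poly_slice_disk_base:
  assumes "\<mu> \<ge> 0"
  shows "poly_slice \<mu> (j + 2 * l) (disk_base \<mu> j l)"
proof -
  obtain c where "disk_base \<mu> j l = (\<lambda>z. \<Sum>i\<le>l. of_real (c i) * (z ^ (j + i) * cnj z ^ i))"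
    by (rule disk_base_expansion)
  then show ?thesis
    by (auto intro!: poly_slice_sum poly_slice_scale poly_slice_z_cnj assms)
qed

text \<open>The power of (1 + u) / 2 is moved into the weight, which turns the second exponent 0
  into j, the one for which the radial factor of \<open>disk_base\<close> is orthogonal.\<close>

lemma jacobi_int_half_plus_shift: "jacobi_int \<alpha> 0 (half_plus ^ j * q) = jacobi_int \<alpha> (real j) q / 2 ^ j"
proof -
  have "jacobi_int \<alpha> 0 (half_plus ^ j * q) = integral {-1..1} (\<lambda>u. poly q u * jacobi_weight \<alpha> (real j) u / 2 ^ j)"
    unfolding jacobi_int_def
  proof (rule integral_cong)
    fix u :: real assume u: "u \<in> {-1..1}"
    show "poly (half_plus ^ j * q) u * jacobi_weight \<alpha> 0 u = poly q u * jacobi_weight \<alpha> (real j) u / 2 ^ j"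
    \<comment> \<open>At u = -1 both weights are 0, also for exponent 0, because
      \<open>0 powr 0\<close> is 0.\<close>
    proof (cases "u = -1")
      case False
      then show ?thesis
        using u by (simp add: jacobi_weight_def poly_half_plus powr_realpow power_divide)
    qed (simp add: jacobi_weight_def)
  qed
  then show ?thesis by (simp add: jacobi_int_def)
qed

lemma Re_power_eq:
  "complex_of_real (Re z) ^ m = (\<Sum>s\<le>m. of_nat (m choose s) / 2 ^ m * (z ^ s * cnj z ^ (m - s)))"
proof -
  have e: "complex_of_real (Re z) = (z + cnj z) / 2"
    by (simp add: complex_add_cnj)
  have "complex_of_real (Re z) ^ m = (z + cnj z) ^ m / 2 ^ m"
    by (simp only: e power_divide)
  then show ?thesis
    by (simp add: binomial_ring sum_divide_distrib mult_ac)
qed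

text \<open>After expanding the power of Re z in z and its conjugate, only terms with equal
  exponents survive. For fixed s they add up to an integral of the radial Jacobi polynomial against
  \<open>half_plus ^ s\<close>, with |z|^(2 j) absorbed into the weight.\<close>

lemma disk_int_Re_power_disk_base:
  assumes mu: "\<mu> \<ge> 0" and m: "m < j + 2 * l"
  shows "disk_int \<mu> (\<lambda>z. of_real (Re z) ^ m * disk_base \<mu> j l z) = 0"
proof -
  obtain c where c: "jac l (\<mu> - 1/2) (real j) = (\<Sum>i\<le>l. smult (c i) (half_plus ^ i))"
    and b: "disk_base \<mu> j l = (\<lambda>z. \<Sum>i\<le>l. of_real (c i) * (z ^ (j + i) * cnj z ^ i))"
    by (rule disk_base_expansion)
  have e: "(\<lambda>z. of_real (Re z) ^ m * disk_base \<mu> j l z) =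
     (\<lambda>z. \<Sum>s\<le>m. \<Sum>i\<le>l. (of_nat (m choose s) / 2 ^ m * of_real (c i)) * (z ^ (s + (j + i)) * cnj z ^ (m - s + i)))"
    unfolding b Re_power_eq sum_product power_add by (simp add: mult_ac)
  have ps: "poly_slice \<mu> (m + j + 2 * l) (\<lambda>z. k * (z ^ (s + (j + i)) * cnj z ^ (m - s + i)))"
    if "s \<le> m" "i \<le> l" for k s i
    using that by (intro poly_slice_scale poly_slice_z_cnj mu) auto
  have "disk_int \<mu> (\<lambda>z. of_real (Re z) ^ m * disk_base \<mu> j l z) =
     (\<Sum>s\<le>m. of_nat (m choose s) / 2 ^ m * (\<Sum>i\<le>l. of_real (c i) * disk_int \<mu> (\<lambda>z. z ^ (s + (j + i)) * cnj z ^ (m - s + i))))"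
  proof -
    have "disk_int \<mu> (\<lambda>z. of_real (Re z) ^ m * disk_base \<mu> j l z) = (\<Sum>s\<le>m. disk_int \<mu>
       (\<lambda>z. \<Sum>i\<le>l. (of_nat (m choose s) / 2 ^ m * of_real (c i)) * (z ^ (s + (j + i)) * cnj z ^ (m - s + i))))"
      unfolding e by (intro disk_int_sum[OF mu, where d = "m + j + 2 * l"] poly_slice_sum ps) auto
    also have "\<dots> = (\<Sum>s\<le>m. \<Sum>i\<le>l. disk_int \<mu>
       (\<lambda>z. (of_nat (m choose s) / 2 ^ m * of_real (c i)) * (z ^ (s + (j + i)) * cnj z ^ (m - s + i))))"
      by (intro sum.cong refl disk_int_sum[OF mu, where d = "m + j + 2 * l"] ps) auto
    finally show ?thesis
      by (simp only: disk_int_scale sum_distrib_left mult.assoc)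
  qed
  also have "\<dots> = 0"
  proof (rule sum.neutral, rule ballI)
    fix s assume s: "s \<in> {..m}"
    let ?C = "disk_int \<mu> (\<lambda>z. 1) / of_real (jacobi_int (\<mu> - 1/2) 0 1)"
    have "(\<Sum>i\<le>l. of_real (c i) * disk_int \<mu> (\<lambda>z. z ^ (s + (j + i)) * cnj z ^ (m - s + i))) = 0"
    proof (cases "s + j = m - s")
      case False
      then show ?thesis
        by (intro sum.neutral) (auto simp: disk_int_z_cnj_neq[OF mu])
    next
      case True
      \<comment> \<open>Equal exponents mean m = 2 s + j, so the bound on m becomes s < l: the
        degree at which Jacobi orthogonality applies.\<close>
      then have sl: "s < l" using m s by auto
      have "(\<Sum>i\<le>l. of_real (c i) * disk_int \<mu> (\<lambda>z. z ^ (s + (j + i)) * cnj z ^ (m - s + i))) =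
        (\<Sum>i\<le>l. of_real (c i * jacobi_int (\<mu> - 1/2) 0 (half_plus ^ (s + j + i))) * ?C)"
        unfolding True[symmetric] add.assoc[symmetric] disk_int_z_cnj_eq[OF mu]
        by (simp only: of_real_mult mult.assoc)
      also have "\<dots> = of_real (\<Sum>i\<le>l. c i * jacobi_int (\<mu> - 1/2) 0 (half_plus ^ (s + j + i))) * ?C"
        by (simp only: sum_distrib_right of_real_sum)
      also have "(\<Sum>i\<le>l. c i * jacobi_int (\<mu> - 1/2) 0 (half_plus ^ (s + j + i))) =
         jacobi_int (\<mu> - 1/2) 0 (half_plus ^ j * (jac l (\<mu> - 1/2) (real j) * half_plus ^ s))"
        using mu unfolding c
        by (simp add: sum_distrib_left sum_distrib_right jacobi_int_sum jacobi_int_smult power_add mult_ac)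
      also have "\<dots> = 0"
        unfolding jacobi_int_half_plus_shift using mu sl by (subst jacobi_int_jac_half_plus_less) auto
      finally show ?thesis by simp
    qed
    then show "of_nat (m choose s) / 2 ^ m *
      (\<Sum>i\<le>l. of_real (c i) * disk_int \<mu> (\<lambda>z. z ^ (s + (j + i)) * cnj z ^ (m - s + i))) = (0::complex)"
      by simp
  qed
  finally show ?thesis .
qed

lemma Re_Im_poly_of_real:
  "Re (poly g (of_real t)) = poly (map_poly Re g) t" "Im (poly g (of_real t)) = poly (map_poly Im g) t"
  by (induction g) (auto simp: map_poly_pCons)

lemma jac_multiple:
  assumes mu: "\<mu> \<ge> 0" and g: "degree g \<le> k" and o: "\<And>m. m < k \<Longrightarrow> jacobi_int \<mu> \<mu> (g * monom 1 m) = 0"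
  shows "g = smult (poly g 1) (jac k \<mu> \<mu>)"
proof -
  have ab: "\<mu> > -1" "\<mu> > -1" "\<mu> + \<mu> + 1 > 0" using mu by auto
  interpret ortho_system "jacobi_int \<mu> \<mu>" "\<lambda>l. jac l \<mu> \<mu>" by (rule ortho_system_jac[OF ab])
  have "jacobi_int \<mu> \<mu> (g * jac i \<mu> \<mu>) = 0" if "i < k" for i
  proof -
    have "g * jac i \<mu> \<mu> = (\<Sum>m\<le>i. smult (coeff (jac i \<mu> \<mu>) m) (g * monom 1 m))"
    proof -
      have "jac i \<mu> \<mu> = (\<Sum>m\<le>i. monom (coeff (jac i \<mu> \<mu>) m) m)"
        using poly_as_sum_of_monoms'[OF degree_jac_le[of i \<mu> \<mu>]] by simp
      also have "\<dots> = (\<Sum>m\<le>i. smult (coeff (jac i \<mu> \<mu>) m) (monom 1 m))"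
        by (simp add: smult_monom)
      finally show ?thesis
        by (metis (no_types, lifting) mult_smult_right sum.cong sum_distrib_left)
    qed
    then have "jacobi_int \<mu> \<mu> (g * jac i \<mu> \<mu>) = (\<Sum>m\<le>i. coeff (jac i \<mu> \<mu>) m * jacobi_int \<mu> \<mu> (g * monom 1 m))"
      by (simp only: sum smult)
    also have "\<dots> = 0" using o that by (intro sum.neutral) auto
    finally show ?thesis .
  qed
  then obtain c where "g = smult c (jac k \<mu> \<mu>)"
    using orthogonal_eq_smult[OF g] by blast
  then show ?thesis by (simp add: poly_jac_1)
qed

text \<open>
  The slice function of an orthogonal polynomial of degree \<open>k\<close> is a polynomial of degree at most
  \<open>k\<close>, and it is orthogonal to all lower powers because \<open>t ^ m\<close> can be pulled into the disk integral.
\<close>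

lemma slice_disk_base:
  assumes mu: "\<mu> \<ge> 0" and t: "t \<in> {-1..1}"
  shows "slice \<mu> (disk_base \<mu> j l) t = of_real (moment (\<mu> - 1/2) 0 * poly (jac (j + 2 * l) \<mu> \<mu>) t)"
proof -
  let ?k = "j + 2 * l" and ?F = "disk_base \<mu> j l"
  obtain g where g: "degree g \<le> ?k" "\<And>t. t \<in> {-1..1} \<Longrightarrow> slice \<mu> ?F t = poly g (of_real t)"
    using poly_sliceD[OF poly_slice_disk_base[OF mu]] by blast
  \<comment> \<open>\<open>g\<close> has complex coefficients, so its real and imaginary parts are
    treated apart; the value at 1 will later force the imaginary part to be 0.\<close>
  have 0: "jacobi_int \<mu> \<mu> (map_poly Re g * monom 1 m) = 0 \<and> jacobi_int \<mu> \<mu> (map_poly Im g * monom 1 m) = 0" if m: "m < ?k" for m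
  proof -
    have h: "((\<lambda>t. Complex (poly (map_poly Re g * monom 1 m) t * jacobi_weight \<mu> \<mu> t)
        (poly (map_poly Im g * monom 1 m) t * jacobi_weight \<mu> \<mu> t)) has_integral
       Complex (jacobi_int \<mu> \<mu> (map_poly Re g * monom 1 m)) (jacobi_int \<mu> \<mu> (map_poly Im g * monom 1 m))) {-1..1}"
      unfolding Complex_eq using mu
      by (intro has_integral_add has_integral_mult_right has_integral_of_real has_integral_jacobi_int) auto
    have "disk_int \<mu> (\<lambda>z. of_real (Re z) ^ m * ?F z) =
      Complex (jacobi_int \<mu> \<mu> (map_poly Re g * monom 1 m)) (jacobi_int \<mu> \<mu> (map_poly Im g * monom 1 m))"
      unfolding disk_int_def
    proof (rule integral_unique, rule has_integral_eq[OF _ h])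
      fix t :: real assume t: "t \<in> {-1..1}"
      have "slice \<mu> (\<lambda>z. of_real (Re z) ^ m * ?F z) t = of_real t ^ m * slice \<mu> ?F t"
        unfolding slice_def complex.sel by (simp flip: slice_scale[unfolded slice_def])
      then show "Complex (poly (map_poly Re g * monom 1 m) t * jacobi_weight \<mu> \<mu> t)
          (poly (map_poly Im g * monom 1 m) t * jacobi_weight \<mu> \<mu> t) =
          (1 - t\<^sup>2) powr \<mu> *\<^sub>R slice \<mu> (\<lambda>z. of_real (Re z) ^ m * ?F z) t"
        using t by (simp add: g(2) jacobi_weight_same complex_eq_iff Re_Im_poly_of_real poly_monom
            flip: of_real_power)
    qed
    then show ?thesis
      using disk_int_Re_power_disk_base[OF mu m] by (simp add: complex_eq_iff)
  qed
  have d: "degree (map_poly Re g) \<le> ?k" "degree (map_poly Im g) \<le> ?k"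
    using g(1) map_poly_degree_leq order_trans by blast+
  \<comment> \<open>At t = 1 the chord shrinks to the point 1, where \<open>disk_base\<close> equals
    1, so the slice there is the mass of the weight.\<close>
  have "poly g (of_real 1) = slice \<mu> ?F 1"
    using g(2)[of 1] by simp
  also have "\<dots> = of_real (moment (\<mu> - 1/2) 0)"
  proof -
    have "?F (Complex 1 (s * sqrt (1 - 1\<^sup>2))) = 1" for s
      by (simp add: disk_base_def cmod_def poly_jac_1 flip: one_complex.code)
    then have "slice \<mu> ?F 1 = integral {-1..1} (\<lambda>s. complex_of_real ((1 - s\<^sup>2) powr (\<mu> - 1/2) * s ^ 0))"
      unfolding slice_def by (simp add: scaleR_conv_of_real)
    also have "\<dots> = of_real (moment (\<mu> - 1/2) 0)"
      using mu by (intro integral_unique has_integral_of_real has_integral_moment) auto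
    finally show ?thesis .
  qed
  finally have 1: "poly (map_poly Re g) 1 = moment (\<mu> - 1/2) 0" "poly (map_poly Im g) 1 = 0"
    by (simp_all flip: Re_Im_poly_of_real)
  have "map_poly Re g = smult (moment (\<mu> - 1/2) 0) (jac ?k \<mu> \<mu>)" "map_poly Im g = 0"
    using jac_multiple[OF mu d(1)] jac_multiple[OF mu d(2)] 0 1 by auto
  then show ?thesis
    using t by (simp add: g(2) complex_eq_iff Re_Im_poly_of_real)
qed

text \<open>The factor \<open>cis (- \<theta>)\<close> turns the chord upright, and s is rescaled by
  r, the square root of 1 - t^2. The Jacobian r and the weight factor r^(2 \<mu> - 1) combine to (1
  - t^2)^\<mu>.\<close>

lemma radon_eq_slice:
  assumes t: "t \<in> {-1<..<1}" and F: "poly_slice \<mu> d F"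
  shows "radon \<mu> \<theta> (\<lambda>(x, y). Re (c * F (Complex x y * cis (- \<theta>)))) t = (1 - t\<^sup>2) powr \<mu> * Re (c * slice \<mu> F t)"
proof -
  define r where "r = sqrt (1 - t\<^sup>2)"
  have p: "1 - t\<^sup>2 > 0" using t by (simp add: abs_square_less_1 abs_less_iff)
  then have r: "r > 0" "r\<^sup>2 = 1 - t\<^sup>2" by (simp_all add: r_def)
  define f where "f s = Re (c * F (Complex t s)) * (1 - s\<^sup>2 - t\<^sup>2) powr (\<mu> - 1/2)" for s
  have "((\<lambda>s. (1 - s\<^sup>2) powr (\<mu> - 1/2) *\<^sub>R F (Complex t (s * r))) has_integral slice \<mu> F t) {-1..1}"
    using F t unfolding poly_slice_def slice_def r_def by (auto simp: has_integral_iff)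
  from has_integral_mult_right[OF this, of c]
  have "((\<lambda>s. Re (c * ((1 - s\<^sup>2) powr (\<mu> - 1/2) *\<^sub>R F (Complex t (s * r))))) has_integral Re (c * slice \<mu> F t)) {-1..1}"
    by (rule has_integral_Re)
  from has_integral_mult_right[OF this, of "r powr (2 * \<mu> - 1)"]
  have "((\<lambda>s. f (r * s)) has_integral r powr (2 * \<mu> - 1) * Re (c * slice \<mu> F t)) {-1..1}"
  proof (rule has_integral_eq[rotated])
    fix s :: real assume s: "s \<in> {-1..1}"
    have "1 - (r * s)\<^sup>2 - t\<^sup>2 = r\<^sup>2 * (1 - s\<^sup>2)"
      by (simp add: r(2) power_mult_distrib algebra_simps)
    moreover have "1 - s\<^sup>2 \<ge> 0" using s by (simp add: abs_square_le_1 abs_le_iff)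
    moreover have "(r\<^sup>2) powr (\<mu> - 1/2) = r powr (2 * \<mu> - 1)"
    proof -
      have "(r\<^sup>2) powr (\<mu> - 1/2) = (r powr 2) powr (\<mu> - 1/2)"
        using r(1) by simp
      also have "\<dots> = r powr (2 * \<mu> - 1)"
        unfolding powr_powr by (simp add: algebra_simps)
      finally show ?thesis .
    qed
    ultimately have "(1 - (r * s)\<^sup>2 - t\<^sup>2) powr (\<mu> - 1/2) = r powr (2 * \<mu> - 1) * (1 - s\<^sup>2) powr (\<mu> - 1/2)"
      by (simp add: powr_mult)
    then show "r powr (2 * \<mu> - 1) * Re (c * ((1 - s\<^sup>2) powr (\<mu> - 1/2) *\<^sub>R F (Complex t (s * r)))) = f (r * s)"
      by (simp add: f_def mult_ac)
  qed
  then have "((\<lambda>s. f (r * s)) has_integral r powr (2 * \<mu> - 1) * Re (c * slice \<mu> F t)) ((\<lambda>x. x / r) ` {-r..r})"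
  proof -
    have "(\<lambda>x. x / r) ` {-r..r} = {-1..1}"
      using r(1) by (simp add: image_divide_atLeastAtMost)
    then show ?thesis using \<open>((\<lambda>s. f (r * s)) has_integral _) {-1..1}\<close> by simp
  qed
  then have "(f has_integral r * (r powr (2 * \<mu> - 1) * Re (c * slice \<mu> F t))) {-r..r}"
    using r(1) by (subst (asm) has_integral_stretch_real_iff) auto
  moreover have "r * r powr (2 * \<mu> - 1) = (1 - t\<^sup>2) powr \<mu>"
  proof -
    have "r * r powr (2 * \<mu> - 1) = r powr (1 + (2 * \<mu> - 1))"
      using r(1) by (subst powr_add) simp
    also have "\<dots> = (r powr 2) powr \<mu>"
      by (simp add: powr_powr)
    finally show ?thesis using r by simp
  qed
  moreover have "(\<lambda>(x, y). Re (c * F (Complex x y * cis (- \<theta>)))) (t * cos \<theta> - s * sin \<theta>, t * sin \<theta> + s * cos \<theta>) =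
     Re (c * F (Complex t s))" for s
  proof -
    have "Complex (t * cos \<theta> - s * sin \<theta>) (t * sin \<theta> + s * cos \<theta>) = Complex t s * cis \<theta>"
      by (simp add: complex_eq_iff)
    then show ?thesis by (simp add: mult.assoc cis_mult)
  qed
  ultimately show ?thesis
    unfolding radon_def f_def r_def[symmetric] by (simp add: integral_unique mult.assoc[symmetric])
qed

text \<open>The radial factor ignores rotations and z^j acquires \<open>cis \<theta> ^ j\<close>, so
  every direction reduces to the slice in direction 0.\<close>

lemma radon_disk_base:
  assumes mu: "\<mu> \<ge> 0" and t: "t \<in> {-1<..<1}"
  shows "radon \<mu> \<theta> (\<lambda>(x, y). Re (c * disk_base \<mu> j l (Complex x y))) t =
    (1 - t\<^sup>2) powr \<mu> * moment (\<mu> - 1/2) 0 * poly (jac (j + 2 * l) \<mu> \<mu>) t * Re (c * cis \<theta> ^ j)"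
proof -
  have "disk_base \<mu> j l z = cis \<theta> ^ j * disk_base \<mu> j l (z * cis (- \<theta>))" for z
  proof -
    have "z ^ j = (cis \<theta> * (z * cis (- \<theta>))) ^ j"
      by (simp add: mult.left_commute[of "cis \<theta>"] cis_mult)
    then have "z ^ j = cis \<theta> ^ j * (z * cis (- \<theta>)) ^ j"
      by (simp only: power_mult_distrib)
    moreover have "cmod (z * cis (- \<theta>)) = cmod z"
      by (simp add: norm_mult)
    ultimately show ?thesis
      by (simp only: disk_base_def mult.assoc)
  qed
  then have e: "(\<lambda>(x, y). Re (c * disk_base \<mu> j l (Complex x y))) =
     (\<lambda>(x, y). Re (c * cis \<theta> ^ j * disk_base \<mu> j l (Complex x y * cis (- \<theta>))))"
    by (metis (no_types, lifting) mult.assoc)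
  have r: "Re (w * of_real x) = Re w * x" for w x by simp
  have "t \<in> {-1..1}" using t by auto
  then show ?thesis
    unfolding e radon_eq_slice[OF t poly_slice_disk_base[OF mu]]
    by (simp only: slice_disk_base[OF mu] r) (simp only: mult_ac)
qed

section \<open>Discrete orthogonality\<close>

text \<open>Multiplication by 2 sin a telescopes the sums, where a = p \<pi> / (n + 1). The bounds
  on p put a strictly between 0 and \<pi>, so sin a can be divided out.\<close>

lemma sum_cos_sin_equidistant:
  assumes "0 < p" "p \<le> n"
  shows "(\<Sum>\<nu>\<le>n. cos (2 * real p * xi n \<nu>)) = 0" "(\<Sum>\<nu>\<le>n. sin (2 * real p * xi n \<nu>)) = 0"
proof -
  define a where "a = real p * pi / real (n + 1)"
  have x: "2 * real p * xi n \<nu> = 2 * real \<nu> * a" for \<nu>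
    by (simp add: xi_def a_def)
  have an: "real (n + 1) * a = real p * pi" by (simp add: a_def field_simps)
  have "real p * pi < real (n + 1) * pi"
    using assms by (intro mult_strict_right_mono) auto
  then have "a < pi" by (simp add: a_def field_simps)
  moreover have "0 < a" using assms by (simp add: a_def)
  ultimately have sa: "sin a > 0" by (rule sin_gt_zero[rotated])
  have c: "2 * sin a * (\<Sum>\<nu>\<le>m. cos (2 * real \<nu> * a)) = sin ((2 * real m + 1) * a) + sin a" for m
  proof (induction m)
    case (Suc m)
    have "2 * sin a * cos (2 * real (Suc m) * a) = sin (2 * real (Suc m) * a + a) - sin (2 * real (Suc m) * a - a)"
      by (simp add: sin_add sin_diff)
    also have "2 * real (Suc m) * a + a = (2 * real (Suc m) + 1) * a" by (simp add: algebra_simps)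
    also have "2 * real (Suc m) * a - a = (2 * real m + 1) * a" by (simp add: algebra_simps)
    finally show ?case using Suc by (simp add: distrib_left)
  qed simp
  have e: "sin ((2 * real n + 1) * a) + sin a = 0" "cos a - cos ((2 * real n + 1) * a) = 0"
  proof -
    have "(2 * real n + 1) * a = 2 * (real (n + 1) * a) - a" by (simp add: algebra_simps)
    then have e: "(2 * real n + 1) * a = 2 * (real p * pi) - a" by (simp only: an)
    show "sin ((2 * real n + 1) * a) + sin a = 0" "cos a - cos ((2 * real n + 1) * a) = 0"
      unfolding e using sin_npi[of "2 * p"] cos_npi[of "2 * p"] by (simp_all add: sin_diff cos_diff mult.assoc)
  qed
  have s: "2 * sin a * (\<Sum>\<nu>\<le>m. sin (2 * real \<nu> * a)) = cos a - cos ((2 * real m + 1) * a)" for m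
  proof (induction m)
    case (Suc m)
    have "2 * sin a * sin (2 * real (Suc m) * a) = cos (2 * real (Suc m) * a - a) - cos (2 * real (Suc m) * a + a)"
      by (simp add: cos_add cos_diff)
    also have "2 * real (Suc m) * a + a = (2 * real (Suc m) + 1) * a" by (simp add: algebra_simps)
    also have "2 * real (Suc m) * a - a = (2 * real m + 1) * a" by (simp add: algebra_simps)
    finally show ?case using Suc by (simp add: distrib_left)
  qed simp
  show "(\<Sum>\<nu>\<le>n. cos (2 * real p * xi n \<nu>)) = 0" "(\<Sum>\<nu>\<le>n. sin (2 * real p * xi n \<nu>)) = 0"
    unfolding x using c[of n] s[of n] sa by (simp_all only: e) simp_all
qed

lemma sum_cos_sin_xi:
  assumes "even k" "\<bar>k\<bar> \<le> 2 * int n"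
  shows "(\<Sum>\<nu>\<le>n. cos (of_int k * xi n \<nu>)) = (if k = 0 then real (n + 1) else 0)"
    "(\<Sum>\<nu>\<le>n. sin (of_int k * xi n \<nu>)) = 0"
proof -
  obtain p where p: "k = 2 * int p \<or> k = - (2 * int p)"
    using assms(1) by (metis evenE int_cases2 mult_minus_right)
  have "p \<le> n" using p assms(2) by auto
  then show "(\<Sum>\<nu>\<le>n. cos (of_int k * xi n \<nu>)) = (if k = 0 then real (n + 1) else 0)"
    "(\<Sum>\<nu>\<le>n. sin (of_int k * xi n \<nu>)) = 0"
    using p sum_cos_sin_equidistant[of p n] by (cases "p = 0"; auto simp: sum_negf)+
qed

text \<open>Frequencies of equal parity have even sum and difference, both at most 2 n in absolute
  value, exactly the range covered by \<open>sum_cos_sin_xi\<close>. The conditions for index 1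
  exclude the sine of frequency 0, which is the zero function.\<close>

lemma trig_S_orthogonal:
  assumes "even (i + j)" "i \<le> n" "j \<le> n" "\<epsilon> \<le> 1" "\<delta> \<le> 1" "\<epsilon> = 1 \<Longrightarrow> i > 0" "\<delta> = 1 \<Longrightarrow> j > 0"
  shows "(\<Sum>\<nu>\<le>n. trig_S i \<epsilon> (xi n \<nu>) * trig_S j \<delta> (xi n \<nu>)) =
    (if i = j \<and> \<epsilon> = \<delta> then real (n + 1) * (if i = 0 then 1 else 1/2) else 0)"
proof -
  let ?m = "int i - int j" and ?p = "int i + int j"
  have "even ?m" "even ?p" "\<bar>?m\<bar> \<le> 2 * int n" "\<bar>?p\<bar> \<le> 2 * int n"
    using assms(1-3) by (auto simp flip: of_nat_add)
  note s = sum_cos_sin_xi[OF this(1,3)] sum_cos_sin_xi[OF this(2,4)]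
  have e: "real i * x - real j * x = of_int ?m * x" "real i * x + real j * x = of_int ?p * x" for x :: real
    by (simp_all add: algebra_simps)
  have \<epsilon>: "\<epsilon> = 0 \<or> \<epsilon> = 1" and \<delta>: "\<delta> = 0 \<or> \<delta> = 1" using assms by auto
  have [simp]: "?p = 0 \<longleftrightarrow> i = 0 \<and> j = 0" by auto
  show ?thesis
    using \<epsilon> \<delta> assms(6,7)
    by (elim disjE)
       (simp_all add: trig_S_def cos_times_cos sin_times_sin sin_times_cos cos_times_sin e sum_divide_distrib[symmetric]
         sum.distrib sum_subtractf s del: of_int_add of_int_diff of_int_of_nat_eq)
qed

section \<open>Chebyshev polynomials\<close>

fun cheb :: "nat \<Rightarrow> real poly" where
  "cheb 0 = 1"
| "cheb (Suc 0) = [:0, 1:]"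
| "cheb (Suc (Suc n)) = [:0, 2:] * cheb (Suc n) - cheb n"

lemma poly_cheb_cos: "poly (cheb n) (cos x) = cos (real n * x)"
proof (induction n rule: cheb.induct)
  case (3 n)
  have "cos (real (Suc (Suc n)) * x) = cos (real (Suc n) * x + x)"
    by (simp add: algebra_simps)
  moreover have "cos (real n * x) = cos (real (Suc n) * x - x)"
    by (simp add: algebra_simps)
  ultimately show ?case
    using 3 by (simp add: cos_add cos_diff)
qed auto

lemma degree_cheb: "degree (cheb n) = n \<and> lead_coeff (cheb n) > 0"
proof (induction n rule: cheb.induct)
  case (3 n)
  have nz: "cheb (Suc n) \<noteq> 0" using 3 by auto
  have d: "degree ([:0, 2:] * cheb (Suc n)) = Suc (Suc n)"
    using 3 nz by (subst degree_mult_eq) auto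
  have l: "degree (cheb n) < degree ([:0, 2:] * cheb (Suc n))"
    unfolding d using 3 by auto
  have *: "degree (cheb (Suc (Suc n))) = Suc (Suc n)"
    using degree_add_eq_left[of "- cheb n" "[:0, 2:] * cheb (Suc n)"] l d by simp
  have "lead_coeff (cheb (Suc (Suc n))) = lead_coeff ([:0, 2:] * cheb (Suc n))"
    using lead_coeff_add_le[of "- cheb n" "[:0, 2:] * cheb (Suc n)"] l by (simp add: add.commute)
  also have "\<dots> = 2 * lead_coeff (cheb (Suc n))"
    unfolding lead_coeff_mult by simp
  finally have eq: "lead_coeff (cheb (Suc (Suc n))) = 2 * lead_coeff (cheb (Suc n))" .
  have pos: "lead_coeff (cheb (Suc n)) > 0" using 3 by blast
  have "lead_coeff (cheb (Suc (Suc n))) > 0"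
    unfolding eq by (rule mult_pos_pos[OF _ pos]) simp
  with * show ?case by blast
qed auto

lemma cos_nat_times_cos_nat:
  "cos (real k * x) * cos (real l * x) =
    (cos (real (if k \<ge> l then k - l else l - k) * x) + cos (real (k + l) * x)) / 2"
proof -
  have "cos (real k * x - real l * x) = cos (real (if k \<ge> l then k - l else l - k) * x)"
  proof (cases "k \<ge> l")
    case True
    then show ?thesis by (simp add: of_nat_diff left_diff_distrib)
  next
    case False
    then show ?thesis
      by (subst cos_minus[symmetric]) (simp add: of_nat_diff left_diff_distrib)
  qed
  then show ?thesis
    by (simp only: cos_times_cos of_nat_add distrib_right)
qed

text \<open>The affine map carries [0, L] to [-1, 1]. The weight has mass 1 and the cosines of
  positive frequency have mean square 1/2, whence the factor \<open>sqrt 2\<close>.\<close>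

definition cheb_L :: "real \<Rightarrow> nat \<Rightarrow> real poly" where
  "cheb_L L k = smult (if k = 0 then 1 else sqrt 2) (pcompose (cheb k) [:-1, 2 / L:])"

lemma poly_cheb_L:
  assumes "L > 0"
  shows "poly (cheb_L L k) (L / 2 * (1 + cos x)) = (if k = 0 then 1 else sqrt 2) * cos (real k * x)"
proof -
  have "poly [:-1, 2 / L:] (L / 2 * (1 + cos x)) = cos x" using assms by (simp add: field_simps)
  then show ?thesis by (simp add: cheb_L_def poly_pcompose poly_cheb_cos)
qed

text \<open>For \<theta> = arccos (2 z / L - 1) the derivative of \<theta> is - \<pi> times the
  weight, so the integrand has the antiderivative \<open>G\<close>. It is continuous on the closed
  interval although the weight blows up at both ends.\<close>

lemma has_integral_cos_W_L:
  assumes L: "L > 0"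
  shows "((\<lambda>z. cos (real k * arccos (2 * z / L - 1)) * W_L L z) has_integral (if k = 0 then 1 else 0)) {0..L}"
proof -
  define \<theta> where "\<theta> z = arccos (2 * z / L - 1)" for z
  define G where "G z = (if k = 0 then - \<theta> z / pi else - sin (real k * \<theta> z) / (real k * pi))" for z
  have "((\<lambda>z. cos (real k * \<theta> z) * W_L L z) has_integral (G L - G 0)) {0..L}"
  proof (rule fundamental_theorem_of_calculus_interior)
    have "continuous_on {0..L} \<theta>"
      unfolding \<theta>_def using L
      by (intro continuous_intros) (auto simp: field_simps)
    then show "continuous_on {0..L} G"
      unfolding G_def by (cases "k = 0") (auto intro!: continuous_intros)
    fix z assume z: "z \<in> {0<..<L}"
    then have b: "-1 < 2 * z / L - 1" "2 * z / L - 1 < 1" by (auto simp: field_simps)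
    have sq: "sqrt (1 - (2 * z / L - 1)\<^sup>2) = 2 / L * sqrt (z * (L - z))"
    proof -
      have "1 - (2 * z / L - 1)\<^sup>2 = (2 / L)\<^sup>2 * (z * (L - z))"
        using L by (simp add: field_simps power2_eq_square)
      then show ?thesis using L by (simp add: real_sqrt_mult)
    qed
    have "(\<theta> has_real_derivative inverse (- sqrt (1 - (2 * z / L - 1)\<^sup>2)) * (2 / L)) (at z)"
      unfolding \<theta>_def
    proof (rule DERIV_chain2[where g = "\<lambda>z. 2 * z / L - 1"])
      show "(arccos has_real_derivative inverse (- sqrt (1 - (2 * z / L - 1)\<^sup>2))) (at (2 * z / L - 1))"
        using b by (rule DERIV_arccos)
      show "((\<lambda>z. 2 * z / L - 1) has_real_derivative 2 / L) (at z)"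
        using L by (auto intro!: derivative_eq_intros)
    qed
    also have "inverse (- sqrt (1 - (2 * z / L - 1)\<^sup>2)) * (2 / L) = - (pi * W_L L z)"
      unfolding sq W_L_def using L by (simp add: field_simps)
    finally have d: "(\<theta> has_real_derivative - (pi * W_L L z)) (at z)" .
    have "(G has_real_derivative cos (real k * \<theta> z) * W_L L z) (at z)"
    proof (cases "k = 0")
      case True
      then show ?thesis
        unfolding G_def using DERIV_cdivide[OF DERIV_minus[OF d], of pi] by simp
    next
      case False
      have "((\<lambda>z. - sin (real k * \<theta> z) / (real k * pi)) has_real_derivative
          - (cos (real k * \<theta> z) * (real k * - (pi * W_L L z))) / (real k * pi)) (at z)"
        by (intro DERIV_cdivide DERIV_minus DERIV_chain2[OF DERIV_sin] DERIV_cmult d)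
      then show ?thesis
        using False unfolding G_def by simp
    qed
    then show "(G has_vector_derivative cos (real k * \<theta> z) * W_L L z) (at z)"
      by (simp add: has_real_derivative_iff_has_vector_derivative)
  qed (use L in simp)
  moreover have "G L - G 0 = (if k = 0 then 1 else 0)"
    using L by (simp add: G_def \<theta>_def)
  ultimately show ?thesis by (simp add: \<theta>_def)
qed

lemma p_L_eq:
  assumes L: "L > 0"
  shows "p_L L = cheb_L L"
  unfolding p_L_def
proof (rule orthonormal_poly_eqI)
  have W: "(W_L L has_integral 1) {0..L}"
    using has_integral_cos_W_L[OF L, of 0] by simp
  have Wnn: "W_L L x \<ge> 0" if "x \<in> {0..L}" for x
    using that by (simp add: W_L_def)
  show "(\<lambda>x. poly q x * W_L L x) integrable_on {0..L}" for q
  proof -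
    have "continuous_on {0..L} (poly q)" by (intro continuous_intros)
    from integrable_continuous_weight[OF this has_integral_integrable[OF W] Wnn]
    show ?thesis by (simp add: mult.commute)
  qed
  show "is_orthonormal_family 0 L (W_L L) (cheb_L L)"
    unfolding is_orthonormal_family_def
  proof (intro conjI allI)
    fix k l :: nat
    show "degree (cheb_L L k) = k"
      using L degree_cheb[of k] by (simp add: cheb_L_def degree_pcompose pcompose_1)
    have "lead_coeff (pcompose (cheb k) [:-1, 2 / L:]) > 0"
      using L degree_cheb[of k] by (subst lead_coeff_comp) auto
    then show "lead_coeff (cheb_L L k) > 0"
      by (simp add: cheb_L_def lead_coeff_smult)
    define N where "N k = (if k = 0 then 1 else sqrt 2)" for k :: nat
    define d where "d = (if k \<ge> l then k - l else l - k)"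
    have "((\<lambda>z. N k * N l / 2 * (cos (real d * arccos (2 * z / L - 1)) * W_L L z +
        cos (real (k + l) * arccos (2 * z / L - 1)) * W_L L z)) has_integral
        N k * N l / 2 * ((if d = 0 then 1 else 0) + (if k + l = 0 then 1 else 0))) {0..L}"
      by (intro has_integral_mult_right has_integral_add has_integral_cos_W_L L)
    moreover have "N k * N l / 2 * (cos (real d * arccos (2 * z / L - 1)) * W_L L z +
        cos (real (k + l) * arccos (2 * z / L - 1)) * W_L L z) =
        poly (cheb_L L k) z * poly (cheb_L L l) z * W_L L z" if z: "z \<in> {0..L}" for z
    proof -
      define x where "x = arccos (2 * z / L - 1)"
      have "cos x = 2 * z / L - 1"
        unfolding x_def using z L by (intro cos_arccos) (auto simp: field_simps)
      then have ze: "z = L / 2 * (1 + cos x)" using L by (simp add: field_simps)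
      have p: "poly (cheb_L L m) z = N m * cos (real m * x)" for m
        unfolding N_def by (subst ze) (rule poly_cheb_L[OF L])
      have "N k * N l / 2 * (cos (real d * x) * W_L L z + cos (real (k + l) * x) * W_L L z) =
        N k * N l * ((cos (real d * x) + cos (real (k + l) * x)) / 2) * W_L L z"
        by (simp add: distrib_left distrib_right)
      also have "\<dots> = N k * N l * (cos (real k * x) * cos (real l * x)) * W_L L z"
        unfolding cos_nat_times_cos_nat d_def by (rule refl)
      finally show ?thesis
        unfolding p x_def[symmetric] by (simp only: mult_ac)
    qed
    ultimately have "((\<lambda>z. poly (cheb_L L k) z * poly (cheb_L L l) z * W_L L z) has_integral
        N k * N l / 2 * ((if d = 0 then 1 else 0) + (if k + l = 0 then 1 else 0))) {0..L}"
      by (rule has_integral_eq[rotated])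
    also have "N k * N l / 2 * ((if d = 0 then 1 else 0) + (if k + l = 0 then 1 else 0)) = (if k = l then 1 else 0)"
      by (auto simp: N_def d_def)
    finally show "integral {0..L} (\<lambda>x. poly (cheb_L L k) x * poly (cheb_L L l) x * W_L L x) = (if k = l then 1 else 0)"
      by (rule integral_unique)
  qed
qed

text \<open>Telescoping again: 2 sin a times the sum is sin (k \<pi>). The range k < 2 n + 2 covers
  all frequencies k + l that arise from products of two polynomials of degree at most n.\<close>

lemma sum_cos_midpoints:
  assumes "0 < k" "k < 2 * n + 2"
  shows "(\<Sum>i\<le>n. cos (real k * (real (2 * i + 1) * pi / real (2 * n + 2)))) = 0"
proof -
  define a where "a = real k * pi / real (2 * n + 2)"
  have x: "real k * (real (2 * i + 1) * pi / real (2 * n + 2)) = (2 * real i + 1) * a" for i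
    by (simp add: a_def)
  have "real k * pi < real (2 * n + 2) * pi"
    using assms by (intro mult_strict_right_mono) auto
  then have "a < pi" by (simp add: a_def field_simps)
  moreover have "0 < a" using assms by (simp add: a_def)
  ultimately have sa: "sin a > 0" by (rule sin_gt_zero[rotated])
  have "2 * sin a * (\<Sum>i\<le>m. cos ((2 * real i + 1) * a)) = sin ((2 * real m + 2) * a)" for m
  proof (induction m)
    case 0
    show ?case by (simp add: sin_double)
  next
    case (Suc m)
    have "2 * sin a * cos ((2 * real (Suc m) + 1) * a) =
      sin ((2 * real (Suc m) + 1) * a + a) - sin ((2 * real (Suc m) + 1) * a - a)"
      by (simp add: sin_add sin_diff)
    also have "(2 * real (Suc m) + 1) * a + a = (2 * real (Suc m) + 2) * a" by (simp add: algebra_simps)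
    also have "(2 * real (Suc m) + 1) * a - a = (2 * real m + 2) * a" by (simp add: algebra_simps)
    finally show ?case using Suc by (simp add: distrib_left)
  qed
  moreover have "(2 * real n + 2) * a = real k * pi" by (simp add: a_def field_simps)
  ultimately have "2 * sin a * (\<Sum>i\<le>n. cos ((2 * real i + 1) * a)) = 0"
    by simp
  then show ?thesis unfolding x using sa by simp
qed

lemma p_L_discrete_orthogonal:
  assumes L: "L > 0" and k: "k \<le> n" "l \<le> n"
  shows "(\<Sum>i\<le>n. poly (p_L L k) (zpt L n i) * poly (p_L L l) (zpt L n i)) = (if k = l then real (n + 1) else 0)"
proof -
  define \<psi> where "\<psi> i = real (2 * i + 1) * pi / real (2 * n + 2)" for i
  define N where "N k = (if k = 0 then 1 else sqrt 2)" for k :: nat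
  define d where "d = (if k \<ge> l then k - l else l - k)"
  have p: "poly (p_L L m) (zpt L n i) = N m * cos (real m * \<psi> i)" for m i
    unfolding p_L_eq[OF L] zpt_def N_def \<psi>_def by (rule poly_cheb_L[OF L])
  have s: "(\<Sum>i\<le>n. cos (real m * \<psi> i)) = (if m = 0 then real (n + 1) else 0)" if "m < 2 * n + 2" for m
    using sum_cos_midpoints[of m n] that by (simp add: \<psi>_def)
  have "poly (p_L L k) (zpt L n i) * poly (p_L L l) (zpt L n i) =
     N k * N l / 2 * (cos (real d * \<psi> i) + cos (real (k + l) * \<psi> i))" for i
  proof -
    have "N k * cos (real k * \<psi> i) * (N l * cos (real l * \<psi> i)) =
      N k * N l * (cos (real k * \<psi> i) * cos (real l * \<psi> i))"
      by (simp only: mult_ac)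
    then show ?thesis
      unfolding p cos_nat_times_cos_nat d_def by simp
  qed
  then have "(\<Sum>i\<le>n. poly (p_L L k) (zpt L n i) * poly (p_L L l) (zpt L n i)) =
     (\<Sum>i\<le>n. N k * N l / 2 * (cos (real d * \<psi> i) + cos (real (k + l) * \<psi> i)))"
    by (rule sum.cong[OF refl])
  also have "\<dots> = N k * N l / 2 * ((\<Sum>i\<le>n. cos (real d * \<psi> i)) + (\<Sum>i\<le>n. cos (real (k + l) * \<psi> i)))"
    by (simp only: sum.distrib sum_distrib_left[symmetric])
  also have "\<dots> = N k * N l / 2 * ((if d = 0 then real (n + 1) else 0) + (if k + l = 0 then real (n + 1) else 0))"
    using k by (subst (1 2) s) (auto simp: d_def)
  also have "\<dots> = (if k = l then real (n + 1) else 0)"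
    by (auto simp: N_def d_def)
  finally show ?thesis .
qed

section \<open>The orthonormal basis on the disk\<close>

text \<open>Multiplying by \<open>- \<i>\<close> before taking the real part yields the imaginary
  part, so one formula covers cosine and sine.\<close>

definition phase :: "nat \<Rightarrow> complex" where
  "phase \<epsilon> = (if \<epsilon> = 0 then 1 else - \<i>)"

lemma Re_phase_cis: "Re (phase \<epsilon> * cis \<theta> ^ j) = trig_S j \<epsilon> \<theta>"
  by (simp add: phase_def trig_S_def cos_n_Re_cis_pow_n sin_n_Im_cis_pow_n)

text \<open>The constant left when a disk polynomial is restricted to the unit circle, where
  \<open>jac\<close> is evaluated at 1.\<close>

definition disk_const :: "real \<Rightarrow> nat \<Rightarrow> nat \<Rightarrow> real" where
  "disk_const \<mu> k l = h_const \<mu> l k *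
     sqrt (jac_norm 0 (\<mu> - 1/2) (real (k - 2 * l)) / jac_norm l (\<mu> - 1/2) (real (k - 2 * l)))"

text \<open>The polar form z = |z| \<open>cis (Arg z)\<close>, valid at 0 as well, identifies the
  radial power times the angular function with the real part of
  \<open>phase \<epsilon> * z ^ j\<close>.\<close>

lemma disk_poly_eq:
  assumes "\<mu> \<ge> 0"
  shows "disk_poly \<mu> k l \<epsilon> =
    (\<lambda>(x, y). disk_const \<mu> k l * Re (phase \<epsilon> * disk_base \<mu> (k - 2 * l) l (Complex x y)))"
proof (rule ext, clarify)
  fix x y
  define j where "j = k - 2 * l"
  define z where "z = Complex x y"
  have "z = of_real (cmod z) * cis (Arg z)"
    using rcis_cmod_Arg[of z] by (simp add: rcis_def)
  then have "z ^ j = of_real (cmod z ^ j) * cis (Arg z) ^ j"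
    by (metis of_real_power power_mult_distrib)
  then have "phase \<epsilon> * z ^ j = of_real (cmod z ^ j) * (phase \<epsilon> * cis (Arg z) ^ j)"
    by simp
  then have "Re (phase \<epsilon> * z ^ j) = cmod z ^ j * Re (phase \<epsilon> * cis (Arg z) ^ j)"
    by (simp only: Re_complex_of_real Im_complex_of_real times_complex.sel)
  then have f1: "cmod z ^ j * trig_S j \<epsilon> (Arg z) = Re (phase \<epsilon> * z ^ j)"
    by (simp only: Re_phase_cis)
  have f2: "Re (phase \<epsilon> * disk_base \<mu> j l z) =
     Re (phase \<epsilon> * z ^ j) * poly (jac l (\<mu> - 1/2) (real j)) (2 * (cmod z)\<^sup>2 - 1)"
    unfolding disk_base_def mult.assoc[symmetric] by (simp del: times_complex.sel add: times_complex.sel(1)[of _ "of_real _"])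
  have f3: "jacobi l (\<mu> - 1/2) (real j) =
     smult (sqrt (jac_norm 0 (\<mu> - 1/2) (real j) / jac_norm l (\<mu> - 1/2) (real j))) (jac l (\<mu> - 1/2) (real j))"
    using assms by (intro jacobi_eq) auto
  have "disk_poly \<mu> k l \<epsilon> (x, y) = h_const \<mu> l k *
      poly (jacobi l (\<mu> - 1/2) (real j)) (2 * (cmod z)\<^sup>2 - 1) * cmod z ^ j * trig_S j \<epsilon> (Arg z)"
    unfolding disk_poly_def prod.case Let_def z_def[symmetric] j_def[symmetric] by (rule refl)
  also have "\<dots> = disk_const \<mu> k l * Re (phase \<epsilon> * disk_base \<mu> j l z)"
    unfolding f3 poly_smult f2 f1[symmetric] disk_const_def j_def[symmetric] by (simp only: mult_ac)
  finally show "disk_poly \<mu> k l \<epsilon> (x, y) =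
      disk_const \<mu> k l * Re (phase \<epsilon> * disk_base \<mu> (k - 2 * l) l (Complex x y))"
    unfolding z_def j_def .
qed

lemma disk_poly_circle:
  assumes "\<mu> \<ge> 0"
  shows "disk_poly \<mu> k l \<epsilon> (cos \<theta>, sin \<theta>) = disk_const \<mu> k l * trig_S (k - 2 * l) \<epsilon> \<theta>"
proof -
  have "disk_base \<mu> (k - 2 * l) l (cis \<theta>) = cis \<theta> ^ (k - 2 * l)"
    by (simp add: disk_base_def poly_jac_1)
  then show ?thesis
    by (simp only: disk_poly_eq[OF assms] prod.case cis.code[symmetric] Re_phase_cis)
qed

lemma radon_mult_right: "radon \<mu> \<theta> (\<lambda>v. g v * c) t = radon \<mu> \<theta> g t * c"
  unfolding radon_def by (simp add: mult.assoc mult.commute[of c] flip: integral_mult_left)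

lemma radon_disk_poly:
  assumes mu: "\<mu> \<ge> 0" and t: "t \<in> {-1<..<1}" and l: "2 * l \<le> k"
  shows "radon \<mu> \<theta> (disk_poly \<mu> k l \<epsilon>) t =
    (1 - t\<^sup>2) powr \<mu> * moment (\<mu> - 1/2) 0 * poly (jac k \<mu> \<mu>) t * disk_poly \<mu> k l \<epsilon> (cos \<theta>, sin \<theta>)"
proof -
  have e: "disk_poly \<mu> k l \<epsilon> =
    (\<lambda>v. (\<lambda>(x, y). Re (phase \<epsilon> * disk_base \<mu> (k - 2 * l) l (Complex x y))) v * disk_const \<mu> k l)"
    unfolding disk_poly_eq[OF mu] by (auto simp: fun_eq_iff mult.commute)
  have "k - 2 * l + 2 * l = k" using l by simp
  then have "radon \<mu> \<theta> (disk_poly \<mu> k l \<epsilon>) t =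
    (1 - t\<^sup>2) powr \<mu> * moment (\<mu> - 1/2) 0 * poly (jac k \<mu> \<mu>) t *
      trig_S (k - 2 * l) \<epsilon> \<theta> * disk_const \<mu> k l"
    by (subst e) (simp only: radon_mult_right radon_disk_base[OF mu t] Re_phase_cis)
  then show ?thesis
    by (simp only: disk_poly_circle[OF mu] mult_ac)
qed

text \<open>The last factor is the mean square of the angular function over the nodes. It equals
  \<open>d_const\<close> and cancels the one inside \<open>h_const\<close>; the remaining Gamma and
  Jacobi factors are the reciprocal of \<open>lambda_const\<close>.\<close>

lemma lambda_disk_const:
  assumes mu: "\<mu> \<ge> 0" and l: "2 * l \<le> k"
  shows "lambda_const \<mu> l k * (disk_const \<mu> k l)\<^sup>2 * (if k - 2 * l = 0 then 1 else 1/2) = 1"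
proof -
  define j where "j = k - 2 * l"
  have k: "k = j + 2 * l" using l by (simp add: j_def)
  define \<beta> where "\<beta> = real j"
  have \<beta>: "\<beta> \<ge> 0" by (simp add: \<beta>_def)
  have ab: "\<mu> - 1/2 > -1" "\<beta> > -1" "\<mu> - 1/2 + \<beta> + 1 > 0" using mu \<beta> by auto
  have d: "d_const l k = (if j = 0 then 1 else 1/2)"
    using l by (auto simp: d_const_def j_def)
  define G where "G = Gamma (\<beta> + \<mu> + 3/2) / (Gamma (\<mu> + 3/2) * Gamma (\<beta> + 1))"
  have G: "G = pochhammer (\<mu> + 3/2) j / fact j"
  proof -
    have "Gamma (\<beta> + 1) = fact j" using Gamma_fact[of j, where 'a = real] by (simp add: \<beta>_def add.commute)
    moreover have "pochhammer (\<mu> + 3/2) j = Gamma (\<beta> + \<mu> + 3/2) / Gamma (\<mu> + 3/2)"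
      using mu by (subst pochhammer_Gamma) (auto simp: \<beta>_def add_ac nonpos_Ints_def)
    ultimately show ?thesis by (simp add: G_def)
  qed
  define R where "R = jac_norm 0 (\<mu> - 1/2) \<beta> / jac_norm l (\<mu> - 1/2) \<beta>"
  have R: "R = pochhammer (\<mu> + 1/2) l * pochhammer (\<mu> + 3/2 + \<beta>) l * (\<mu> + 1/2 + \<beta> + 2 * real l) /
      ((\<mu> + 1/2 + \<beta> + real l) * fact l * pochhammer (\<beta> + 1) l)"
    using jac_norm_ratio[OF ab, of l] by (simp add: R_def algebra_simps)
  have Rpos: "R > 0" using jac_norm_pos[OF ab] by (simp add: R_def)
  have Gpos: "G > 0" unfolding G using mu by (intro divide_pos_pos pochhammer_pos) auto
  have h2: "(h_const \<mu> l k)\<^sup>2 = 1 / d_const l k * G"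
    unfolding h_const_def j_def[symmetric] \<beta>_def[symmetric] G_def[symmetric]
    using Gpos by (intro real_sqrt_pow2) (simp add: d_const_def)
  have K: "(disk_const \<mu> k l)\<^sup>2 = 1 / d_const l k * G * R"
    unfolding disk_const_def j_def[symmetric] \<beta>_def[symmetric] R_def[symmetric] power_mult_distrib h2
    using Rpos by simp
  have kl: "k - l = j + l" "real k = \<beta> + 2 * real l" "real (j + l) = \<beta> + real l"
    by (simp_all add: k \<beta>_def)
  have p1: "pochhammer (\<mu> + 3/2) (j + l) = pochhammer (\<mu> + 3/2) j * pochhammer (\<mu> + 3/2 + \<beta>) l"
    by (simp add: pochhammer_product' \<beta>_def)
  have p2: "fact (j + l) = fact j * pochhammer (\<beta> + 1) l"
    using pochhammer_product'[of "1::real" j l] by (simp add: pochhammer_fact \<beta>_def add.commute)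
  define A B C D E where "A = pochhammer (\<mu> + 1/2) l" and "B = pochhammer (\<mu> + 3/2) j"
    and "C = pochhammer (\<mu> + 3/2 + \<beta>) l" and "D = pochhammer (\<beta> + 1) l" and "E = \<beta> + real l + \<mu> + 1/2"
  define M where "M = \<beta> + 2 * real l + \<mu> + 1/2"
  have nz: "A \<noteq> 0" "B \<noteq> 0" "C \<noteq> 0" "D \<noteq> 0" "E \<noteq> 0" "M \<noteq> 0"
    using mu \<beta> pochhammer_pos[of "\<mu> + 1/2" l] pochhammer_pos[of "\<mu> + 3/2" j]
      pochhammer_pos[of "\<mu> + 3/2 + \<beta>" l] pochhammer_pos[of "\<beta> + 1" l]
    by (auto simp: A_def B_def C_def D_def E_def M_def)
  have e: "\<mu> + 1/2 + \<beta> + 2 * real l = M" "\<mu> + 1/2 + \<beta> + real l = E" by (simp_all add: M_def E_def)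
  have "lambda_const \<mu> l k = fact l * (fact j * D) * E / (A * (B * C) * M)"
    unfolding lambda_const_def kl p1 p2 A_def B_def C_def D_def E_def M_def by (rule refl)
  moreover have "G * R = B / fact j * (A * C * M / (E * fact l * D))"
    unfolding G R e A_def B_def C_def D_def by (rule refl)
  ultimately have "lambda_const \<mu> l k * (G * R) = 1"
    using nz by simp
  then show ?thesis
    unfolding K d j_def[symmetric] by simp
qed

text \<open>The factor of \<open>D_kernel\<close> together with the value of the Gegenbauer
  polynomial at 1 is the quotient of \<open>jac_norm 0\<close> by \<open>jac_norm k\<close>, so the
  product does not depend on k. For k = 0 it says that a_\<mu> is the reciprocal of the mass of the
  disk weight.\<close>

lemma normalization_const:
  assumes mu: "\<mu> \<ge> 0"
  shows "a_const \<mu> * moment (\<mu> - 1/2) 0 * ((real k + \<mu> + 1/2) / (\<mu> + 1/2)) *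
    (pochhammer (2 * \<mu> + 1) k / fact k) * jac_norm k \<mu> \<mu> = 1"
proof -
  have ab: "\<mu> > -1" "\<mu> > -1" "\<mu> + \<mu> + 1 > 0" using mu by auto
  have n0: "jac_norm 0 \<mu> \<mu> = moment \<mu> 0"
  proof -
    have "jac 0 \<mu> \<mu> * jac 0 \<mu> \<mu> = 1" by (simp add: jac_def jac_coeff_def)
    then show ?thesis
      using jacobi_int_half_powers[OF ab(1,2), of 0 0] mu by (simp add: jac_norm_def moment_0 mult_2[symmetric])
  qed
  have base: "a_const \<mu> * moment (\<mu> - 1/2) 0 * moment \<mu> 0 = 1"
  proof -
    have leg: "Gamma (\<mu> + 1/2) * Gamma (\<mu> + 1) = 2 powr (- 2 * \<mu>) * sqrt pi * Gamma (2 * \<mu> + 1)"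
    proof -
      \<comment> \<open>Legendre's duplication formula at \<mu> + 1/2 links the Gamma values of the
        two moments; it is applied over the complex numbers and then read off for reals.\<close>
      let ?z = "of_real (\<mu> + 1/2) :: complex"
      have "Gamma ?z * Gamma (?z + 1/2) = exp ((1 - 2 * ?z) * of_real (ln 2)) * of_real (sqrt pi) * Gamma (2 * ?z)"
        using mu by (intro Gamma_legendre_duplication) (auto simp: nonpos_Ints_def complex_eq_iff)
      also have "?z + 1/2 = of_real (\<mu> + 1)" by simp
      also have "2 * ?z = of_real (2 * \<mu> + 1)" by simp
      also have "(1 - of_real (2 * \<mu> + 1)) * complex_of_real (ln 2) = of_real (- 2 * \<mu> * ln 2)" by simp
      finally have "complex_of_real (Gamma (\<mu> + 1/2) * Gamma (\<mu> + 1)) =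
        of_real (exp (- 2 * \<mu> * ln 2) * sqrt pi * Gamma (2 * \<mu> + 1))"
        unfolding Gamma_complex_of_real exp_of_real by (simp only: of_real_mult)
      then show ?thesis
        by (simp only: of_real_eq_iff powr_def) simp
    qed
    define X where "X = 2 powr \<mu>"
    define U V W where "U = Gamma (\<mu> + 1/2)" and "V = Gamma (\<mu> + 1)" and "W = Gamma (2 * \<mu> + 1)"
    have X: "X > 0" by (simp add: X_def)
    have W: "W > 0" using mu by (simp add: W_def Gamma_real_pos)
    have X2: "2 powr (2 * \<mu>) = X\<^sup>2"
    proof -
      have "2 powr (2 * \<mu>) = 2 powr (\<mu> + \<mu>)" by simp
      also have "\<dots> = X\<^sup>2" unfolding powr_add X_def power2_eq_square by (rule refl)
      finally show ?thesis .
    qed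
    have m1: "moment (\<mu> - 1/2) 0 = X\<^sup>2 * (U * U / W)"
    proof -
      have "2 * (\<mu> - 1/2) + 1 = 2 * \<mu>" "\<mu> - 1/2 + 1 = \<mu> + 1/2" "\<mu> + 1/2 + (\<mu> + 1/2) = 2 * \<mu> + 1"
        by simp_all
      moreover have "\<mu> - 1/2 > -1" using mu by simp
      ultimately show ?thesis
        by (simp only: moment_0 Beta_def U_def W_def X2)
    qed
    have g2: "Gamma (2 * \<mu> + 2) = (2 * \<mu> + 1) * W"
    proof -
      have e: "2 * \<mu> + 2 = 2 * \<mu> + 1 + 1" by simp
      show ?thesis
        unfolding W_def e using mu by (intro Gamma_plus1) (auto simp: nonpos_Ints_def)
    qed
    have m2: "moment \<mu> 0 = 2 * X\<^sup>2 * (V * V / ((2 * \<mu> + 1) * W))"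
    proof -
      have "\<mu> + 1 + (\<mu> + 1) = 2 * \<mu> + 2" "2 powr (2 * \<mu> + 1) = 2 * X\<^sup>2"
        by (simp_all add: powr_add X2)
      moreover have "\<mu> > -1" using mu by simp
      ultimately show ?thesis
        by (simp only: moment_0 Beta_def g2 V_def)
    qed
    have "U * V = sqrt pi * W / X\<^sup>2"
      using leg unfolding U_def V_def W_def X2[symmetric] by (simp add: powr_minus field_simps)
    then have uv: "(U * V) * (U * V) = pi * W\<^sup>2 / (X\<^sup>2 * X\<^sup>2)"
      by (simp add: power2_eq_square)
    have "moment (\<mu> - 1/2) 0 * moment \<mu> 0 = 2 * (X\<^sup>2 * X\<^sup>2) / ((2 * \<mu> + 1) * (W * W)) * ((U * V) * (U * V))"
      unfolding m1 m2 by (simp add: mult_ac)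
    also have "\<dots> = 2 * pi / (2 * \<mu> + 1)"
      unfolding uv using X W mu by (simp add: power2_eq_square)
    finally have "moment (\<mu> - 1/2) 0 * moment \<mu> 0 = 2 * pi / (2 * \<mu> + 1)" .
    then show ?thesis
      using mu by (simp add: a_const_def mult.assoc)
  qed
  define P Q R where "P = pochhammer (\<mu> + 1) k" and "Q = pochhammer (2 * \<mu> + 2) k" and "R = pochhammer (2 * \<mu> + 1) k"
  have pos: "P > 0" "Q > 0" "R > 0" using mu by (auto simp: P_def Q_def R_def intro!: pochhammer_pos)
  have QR: "Q * (2 * \<mu> + 1) = R * (2 * \<mu> + 1 + real k)"
    using pochhammer_rec[of "2 * \<mu> + 1" k] pochhammer_Suc[of "2 * \<mu> + 1" k]
    by (simp add: Q_def R_def mult.commute add.assoc)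
  have N: "jac_norm k \<mu> \<mu> > 0" by (rule jac_norm_pos[OF ab])
  have "jac_norm 0 \<mu> \<mu> / jac_norm k \<mu> \<mu> =
    P * Q * (2 * \<mu> + 1 + 2 * real k) / ((2 * \<mu> + 1 + real k) * fact k * P)"
  proof -
    have e: "\<mu> + \<mu> = 2 * \<mu>" by simp
    show ?thesis
      unfolding jac_norm_ratio[OF ab, of k] e P_def Q_def by (rule refl)
  qed
  also have "\<dots> = Q * (2 * \<mu> + 1) * (2 * \<mu> + 1 + 2 * real k) / ((2 * \<mu> + 1) * (2 * \<mu> + 1 + real k) * fact k)"
    using pos mu by (simp add: divide_simps)
  also have "\<dots> = R * (2 * \<mu> + 1 + 2 * real k) / ((2 * \<mu> + 1) * fact k)"
    unfolding QR using mu by (simp add: divide_simps)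
  also have "\<dots> = (2 * \<mu> + 1 + 2 * real k) / (2 * \<mu> + 1) * (R / fact k)"
    by simp
  also have "(2 * \<mu> + 1 + 2 * real k) / (2 * \<mu> + 1) = (real k + \<mu> + 1/2) / (\<mu> + 1/2)"
  proof -
    have "2 * \<mu> + 1 + 2 * real k = 2 * (real k + \<mu> + 1/2)" "2 * \<mu> + 1 = 2 * (\<mu> + 1/2)" by simp_all
    then show ?thesis by (simp only: mult_divide_mult_cancel_left)
  qed
  finally have "(real k + \<mu> + 1/2) / (\<mu> + 1/2) * (R / fact k) * jac_norm k \<mu> \<mu> = moment \<mu> 0"
    using N by (simp add: n0 field_simps)
  then show ?thesis
    using base unfolding R_def by (simp only: mult.assoc)
qed

section \<open>Reproduction of the basis functions by the discrete kernels\<close>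

lemma finite_admissible: "finite (admissible k)"
  by (rule finite_subset[of _ "{..k} \<times> {..1}"]) (auto simp: admissible_def)

text \<open>All frequencies in the kernel of degree m have the parity of m, so the discrete
  orthogonality applies and leaves one term, whose constant is 1 by
  \<open>lambda_disk_const\<close>.\<close>

lemma D_kernel0_reproduces:
  assumes mu: "\<mu> \<ge> 0" and m: "m \<le> n" and le: "(l, \<epsilon>) \<in> admissible m"
  shows "(\<Sum>\<nu>\<le>n. disk_poly \<mu> m l \<epsilon> (cos (xi n \<nu>), sin (xi n \<nu>)) * D_kernel0 \<mu> m (xi n \<nu>) v) =
    real (n + 1) * disk_poly \<mu> m l \<epsilon> v"
proof -
  define K where "K l = disk_const \<mu> m l" for l
  define S where "S p \<nu> = trig_S (m - 2 * fst p) (snd p) (xi n \<nu>)" for p :: "nat \<times> nat" and \<nu>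
  define G where "G p = lambda_const \<mu> (fst p) m * K (fst p) * disk_poly \<mu> m (fst p) (snd p) v" for p
  have adm: "2 * fst p \<le> m \<and> snd p \<le> 1 \<and> (snd p = 1 \<longrightarrow> m - 2 * fst p > 0)" if "p \<in> admissible m" for p
    using that by (auto simp: admissible_def)
  have o: "(\<Sum>\<nu>\<le>n. S (l, \<epsilon>) \<nu> * S p \<nu>) =
    (if p = (l, \<epsilon>) then real (n + 1) * (if m - 2 * l = 0 then 1 else 1/2) else 0)" if p: "p \<in> admissible m" for p
  proof -
    have "(\<Sum>\<nu>\<le>n. S (l, \<epsilon>) \<nu> * S p \<nu>) = (if m - 2 * l = m - 2 * fst p \<and> \<epsilon> = snd p
        then real (n + 1) * (if m - 2 * l = 0 then 1 else 1/2) else 0)"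
      unfolding S_def fst_conv snd_conv
      by (rule trig_S_orthogonal) (use adm[OF p] adm[OF le] m in auto)
    moreover have "m - 2 * l = m - 2 * fst p \<and> \<epsilon> = snd p \<longleftrightarrow> p = (l, \<epsilon>)"
      using adm[OF p] adm[OF le] by (auto simp: prod_eq_iff)
    ultimately show ?thesis by simp
  qed
  have "(\<Sum>\<nu>\<le>n. disk_poly \<mu> m l \<epsilon> (cos (xi n \<nu>), sin (xi n \<nu>)) * D_kernel0 \<mu> m (xi n \<nu>) v) =
    (\<Sum>\<nu>\<le>n. \<Sum>p\<in>admissible m. K l * (G p * (S (l, \<epsilon>) \<nu> * S p \<nu>)))"
    unfolding D_kernel0_def disk_poly_circle[OF mu] sum_distrib_left
    by (intro sum.cong refl) (simp add: case_prod_beta G_def S_def K_def mult_ac)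
  also have "\<dots> = (\<Sum>p\<in>admissible m. K l * (G p * (\<Sum>\<nu>\<le>n. S (l, \<epsilon>) \<nu> * S p \<nu>)))"
    by (subst sum.swap) (simp only: sum_distrib_left)
  also have "\<dots> = (\<Sum>p\<in>admissible m. if p = (l, \<epsilon>)
      then K l * (G (l, \<epsilon>) * (real (n + 1) * (if m - 2 * l = 0 then 1 else 1/2))) else 0)"
    by (intro sum.cong refl) (simp add: o)
  also have "\<dots> = K l * (G (l, \<epsilon>) * (real (n + 1) * (if m - 2 * l = 0 then 1 else 1/2)))"
    using le by (simp add: finite_admissible)
  also have "\<dots> = (lambda_const \<mu> l m * (disk_const \<mu> m l)\<^sup>2 * (if m - 2 * l = 0 then 1 else 1/2)) *
     (real (n + 1) * disk_poly \<mu> m l \<epsilon> v)"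
    unfolding G_def K_def by (simp only: fst_conv snd_conv power2_eq_square mult_ac)
  also have "lambda_const \<mu> l m * (disk_const \<mu> m l)\<^sup>2 * (if m - 2 * l = 0 then 1 else 1/2) = 1"
    using adm[OF le] by (intro lambda_disk_const[OF mu]) simp
  finally show ?thesis by simp
qed

lemma p_L_kernel_reproduces:
  assumes L: "L > 0" and c: "c \<le> d" "d \<le> n"
  shows "(\<Sum>i\<le>n. poly (p_L L c) (zpt L n i) * (\<Sum>l\<le>d. poly (p_L L l) (zpt L n i) * poly (p_L L l) z)) =
    real (n + 1) * poly (p_L L c) z"
proof -
  have "(\<Sum>i\<le>n. poly (p_L L c) (zpt L n i) * (\<Sum>l\<le>d. poly (p_L L l) (zpt L n i) * poly (p_L L l) z)) =
    (\<Sum>l\<le>d. (\<Sum>i\<le>n. poly (p_L L c) (zpt L n i) * poly (p_L L l) (zpt L n i)) * poly (p_L L l) z)"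
    unfolding sum_distrib_left sum_distrib_right by (subst sum.swap) (simp only: mult.assoc)
  also have "\<dots> = (\<Sum>l\<le>d. if l = c then real (n + 1) * poly (p_L L c) z else 0)"
    using c by (intro sum.cong refl) (auto simp: p_L_discrete_orthogonal[OF L])
  also have "\<dots> = real (n + 1) * poly (p_L L c) z"
    using c by simp
  finally show ?thesis .
qed

lemma sum_product_separated:
  fixes a b c :: "'d \<Rightarrow> _ \<Rightarrow> 'r :: comm_semiring_0"
  shows "(\<Sum>x\<in>A. \<Sum>y\<in>B. \<Sum>z\<in>C. \<Sum>k\<in>D. a k y * b k x * c k z) =
    (\<Sum>k\<in>D. (\<Sum>y\<in>B. a k y) * (\<Sum>x\<in>A. b k x) * (\<Sum>z\<in>C. c k z))"
proof -
  have "(\<Sum>x\<in>A. \<Sum>y\<in>B. \<Sum>z\<in>C. \<Sum>k\<in>D. a k y * b k x * c k z) =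
    (\<Sum>k\<in>D. \<Sum>x\<in>A. \<Sum>y\<in>B. \<Sum>z\<in>C. a k y * b k x * c k z)"
    by (simp only: sum.swap[of _ D C] sum.swap[of _ D B] sum.swap[of _ D A])
  also have "\<dots> = (\<Sum>k\<in>D. (\<Sum>x\<in>A. \<Sum>y\<in>B. a k y * b k x) * (\<Sum>z\<in>C. c k z))"
    by (simp only: sum_distrib_left[symmetric] sum_distrib_right[symmetric])
  also have "\<dots> = (\<Sum>k\<in>D. (\<Sum>y\<in>B. a k y) * (\<Sum>x\<in>A. b k x) * (\<Sum>z\<in>C. c k z))"
    by (simp only: sum_distrib_left[symmetric] sum_distrib_right[symmetric])
  finally show ?thesis .
qed

lemma B_op_reproduces:
  assumes mu: "\<mu> \<ge> 0" and L: "L > 0"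
    and t: "\<And>j. j \<le> n \<Longrightarrow> t j \<in> {-1<..<1}"
    and quad: "\<And>g :: real poly. degree g \<le> 2 * n \<Longrightarrow>
           integral {-1..1} (\<lambda>s. poly g s * (1 - s\<^sup>2) powr \<mu>) = (\<Sum>j\<le>n. lam j * poly g (t j))"
    and le: "(l, \<epsilon>) \<in> admissible m" and mc: "m + c \<le> n"
  shows "B_op \<mu> L n t lam (\<lambda>(v, z). disk_poly \<mu> m l \<epsilon> v * poly (p_L L c) z) (v, z) =
    disk_poly \<mu> m l \<epsilon> v * poly (p_L L c) z"
proof -
  have ab: "\<mu> > -1" "\<mu> > -1" "\<mu> + \<mu> + 1 > 0" using mu by auto
  interpret ortho_system "jacobi_int \<mu> \<mu>" "\<lambda>l. jac l \<mu> \<mu>" by (rule ortho_system_jac[OF ab])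
  define N where "N = real (n + 1)"
  have N: "N > 0" by (simp add: N_def)
  define C where "C k = pochhammer (2 * \<mu> + 1) k / fact k" for k
  define a where "a k j = a_const \<mu> * moment (\<mu> - 1/2) 0 * ((real k + \<mu> + 1/2) / (\<mu> + 1/2)) * C k *
      (lam j * (poly (jac m \<mu> \<mu>) (t j) * poly (jac k \<mu> \<mu>) (t j)))" for k j
  define b where "b k \<nu> = disk_poly \<mu> m l \<epsilon> (cos (xi n \<nu>), sin (xi n \<nu>)) * D_kernel0 \<mu> k (xi n \<nu>) v / N" for k \<nu>
  define E where "E k i = (\<Sum>l\<le>n - k. poly (p_L L l) (zpt L n i) * poly (p_L L l) z)" for k i
  define e where "e k i = poly (p_L L c) (zpt L n i) * E k i / N" for k i
  have l: "2 * l \<le> m" using le by (auto simp: admissible_def)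
  have sa: "(\<Sum>j\<le>n. a k j) = (if k = m then 1 else 0)" if k: "k \<le> n" for k
  proof -
    have "degree (jac m \<mu> \<mu> * jac k \<mu> \<mu>) \<le> 2 * n"
      using degree_mult_le[of "jac m \<mu> \<mu>" "jac k \<mu> \<mu>"] k mc by (simp add: deg)
    then have "(\<Sum>j\<le>n. lam j * poly (jac m \<mu> \<mu> * jac k \<mu> \<mu>) (t j)) =
        integral {-1..1} (\<lambda>s. poly (jac m \<mu> \<mu> * jac k \<mu> \<mu>) s * (1 - s\<^sup>2) powr \<mu>)"
      by (rule quad[symmetric])
    also have "\<dots> = jacobi_int \<mu> \<mu> (jac m \<mu> \<mu> * jac k \<mu> \<mu>)"
      unfolding jacobi_int_def by (rule integral_cong) (simp add: jacobi_weight_same)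
    also have "\<dots> = (if k = m then jac_norm m \<mu> \<mu> else 0)"
      using ortho[of m k] by (simp add: jac_norm_def)
    finally have "(\<Sum>j\<le>n. lam j * (poly (jac m \<mu> \<mu>) (t j) * poly (jac k \<mu> \<mu>) (t j))) =
      (if k = m then jac_norm m \<mu> \<mu> else 0)" by simp
    then have "(\<Sum>j\<le>n. a k j) = a_const \<mu> * moment (\<mu> - 1/2) 0 * ((real k + \<mu> + 1/2) / (\<mu> + 1/2)) * C k *
       (if k = m then jac_norm m \<mu> \<mu> else 0)"
      unfolding a_def by (simp only: sum_distrib_left[symmetric])
    then show ?thesis
      using normalization_const[OF mu, of m] by (cases "k = m") (simp_all only: C_def simp_thms if_True if_False mult_zero_right)
  qed
  have summand: "radon \<mu> (xi n \<nu>) (\<lambda>w. (\<lambda>(v, z). disk_poly \<mu> m l \<epsilon> v * poly (p_L L c) z) (w, zpt L n i)) (t j) *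
      T_kernel \<mu> L n t lam \<nu> j i (v, z) = (\<Sum>k\<le>n. a k j * b k \<nu> * e k i)" if j: "j \<le> n" for \<nu> j i
  proof -
    \<comment> \<open>The node lies in the open interval; at an endpoint \<open>powr\<close> would
      give 0 and the two powers would not cancel.\<close>
    have "(t j)\<^sup>2 < 1" using t[OF j] by (simp add: abs_square_less_1 abs_less_iff)
    then have pw: "(1 - (t j)\<^sup>2) powr \<mu> * (1 - (t j)\<^sup>2) powr (- \<mu>) = 1"
      by (simp add: powr_minus)
    have r: "radon \<mu> (xi n \<nu>) (\<lambda>w. (\<lambda>(v, z). disk_poly \<mu> m l \<epsilon> v * poly (p_L L c) z) (w, zpt L n i)) (t j) =
       (1 - (t j)\<^sup>2) powr \<mu> * moment (\<mu> - 1/2) 0 * poly (jac m \<mu> \<mu>) (t j) *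
         disk_poly \<mu> m l \<epsilon> (cos (xi n \<nu>), sin (xi n \<nu>)) * poly (p_L L c) (zpt L n i)"
      by (simp only: prod.case radon_mult_right radon_disk_poly[OF mu t[OF j] l])
    have P: "Phi \<mu> L n (xi n \<nu>) (zpt L n i) (t j) (v, z) =
        (\<Sum>k\<le>n. D_kernel \<mu> k (xi n \<nu>) (t j) v * E k i)"
      by (simp only: Phi_def prod.case E_def)
    have "radon \<mu> (xi n \<nu>) (\<lambda>w. (\<lambda>(v, z). disk_poly \<mu> m l \<epsilon> v * poly (p_L L c) z) (w, zpt L n i)) (t j) *
      T_kernel \<mu> L n t lam \<nu> j i (v, z) =
      (\<Sum>k\<le>n. ((1 - (t j)\<^sup>2) powr \<mu> * (1 - (t j)\<^sup>2) powr (- \<mu>)) * (a k j * b k \<nu> * e k i))"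
      unfolding r T_kernel_def P sum_distrib_left a_def b_def e_def D_kernel_def
        gegenbauer_eq[OF mu] C_def[symmetric] N_def[symmetric] poly_smult
      by (intro sum.cong refl) (simp add: power2_eq_square mult_ac)
    then show ?thesis by (simp only: pw mult_1)
  qed
  have "B_op \<mu> L n t lam (\<lambda>(v, z). disk_poly \<mu> m l \<epsilon> v * poly (p_L L c) z) (v, z) =
    (\<Sum>\<nu>\<le>n. \<Sum>j\<le>n. \<Sum>i\<le>n. \<Sum>k\<le>n. a k j * b k \<nu> * e k i)"
    unfolding B_op_def using summand by (intro sum.cong refl) simp
  also have "\<dots> = (\<Sum>k\<le>n. (\<Sum>j\<le>n. a k j) * (\<Sum>\<nu>\<le>n. b k \<nu>) * (\<Sum>i\<le>n. e k i))"
    by (rule sum_product_separated)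
  \<comment> \<open>Other degrees are discarded by their factor in j alone: for k of the opposite
    parity the angular sum need not vanish.\<close>
  also have "\<dots> = (\<Sum>k\<le>n. if k = m then (\<Sum>\<nu>\<le>n. b m \<nu>) * (\<Sum>i\<le>n. e m i) else 0)"
    by (intro sum.cong refl) (simp add: sa)
  also have "\<dots> = (\<Sum>\<nu>\<le>n. b m \<nu>) * (\<Sum>i\<le>n. e m i)"
    using mc by simp
  also have "(\<Sum>\<nu>\<le>n. b m \<nu>) = disk_poly \<mu> m l \<epsilon> v"
    unfolding b_def sum_divide_distrib[symmetric] using D_kernel0_reproduces[OF mu _ le, of n v] mc N
    by (simp add: N_def)
  also have "(\<Sum>i\<le>n. e m i) = poly (p_L L c) z"
    unfolding e_def E_def sum_divide_distrib[symmetric] using p_L_kernel_reproduces[OF L, of c "n - m" n z] mc N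
    by (simp add: N_def)
  finally show ?thesis .
qed

section \<open>Polynomials of bounded total degree\<close>

text \<open>A linear subspace of functions. Membership in \<open>Pi3\<close> and being fixed by the
  operator are both handled through this closure, so each needs checking only on spanning
  functions.\<close>

definition lin_closed :: "('a \<Rightarrow> real) set \<Rightarrow> bool" where
  "lin_closed S \<longleftrightarrow> (\<lambda>x. 0) \<in> S \<and> (\<forall>f\<in>S. \<forall>g\<in>S. \<forall>a b. (\<lambda>x. a * f x + b * g x) \<in> S)"

lemma lin_closed_add: "lin_closed S \<Longrightarrow> f \<in> S \<Longrightarrow> g \<in> S \<Longrightarrow> (\<lambda>x. a * f x + b * g x) \<in> S"
  by (simp add: lin_closed_def)

lemma lin_closed_scale: "lin_closed S \<Longrightarrow> f \<in> S \<Longrightarrow> (\<lambda>x. a * f x) \<in> S"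
  using lin_closed_add[of S f f a 0] by simp

lemma lin_closed_sum:
  assumes "lin_closed S" "\<And>i. i \<in> A \<Longrightarrow> F i \<in> S"
  shows "(\<lambda>x. \<Sum>i\<in>A. c i * F i x) \<in> S"
  using assms(2)
proof (induction A rule: infinite_finite_induct)
  case (insert i A)
  then have "(\<lambda>x. c i * F i x + 1 * (\<Sum>i\<in>A. c i * F i x)) \<in> S"
    by (intro lin_closed_add[OF assms(1)]) auto
  then show ?case using insert by simp
qed (use assms(1) in \<open>auto simp: lin_closed_def\<close>)

abbreviation (input) mono3 :: "nat \<Rightarrow> nat \<Rightarrow> nat \<Rightarrow> (real \<times> real) \<times> real \<Rightarrow> real" where
  "mono3 i j k \<equiv> (\<lambda>p. fst (fst p) ^ i * snd (fst p) ^ j * snd p ^ k)"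

lemma finite_degree3: "finite {(i, j, k). i + j + k \<le> (n::nat)}"
  by (rule finite_subset[of _ "{..n} \<times> {..n} \<times> {..n}"]) auto

lemma Pi3_iff: "q \<in> Pi3 n \<longleftrightarrow> (\<exists>c. q = (\<lambda>p. \<Sum>s\<in>{(i, j, k). i + j + k \<le> n}.
    c s * mono3 (fst s) (fst (snd s)) (snd (snd s)) p))"
proof
  assume "q \<in> Pi3 n"
  then obtain c where "\<forall>x y z. q ((x, y), z) =
        (\<Sum>(i, j, k) \<in> {(i, j, k). i + j + k \<le> n}. c i j k * x ^ i * y ^ j * z ^ k)"
    unfolding Pi3_def by auto
  then show "\<exists>c. q = (\<lambda>p. \<Sum>s\<in>{(i, j, k). i + j + k \<le> n}.
    c s * mono3 (fst s) (fst (snd s)) (snd (snd s)) p)"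
    by (intro exI[of _ "\<lambda>(i, j, k). c i j k"]) (auto simp: fun_eq_iff case_prod_beta mult.assoc)
next
  assume "\<exists>c. q = (\<lambda>p. \<Sum>s\<in>{(i, j, k). i + j + k \<le> n}.
    c s * mono3 (fst s) (fst (snd s)) (snd (snd s)) p)"
  then obtain c where "q = (\<lambda>p. \<Sum>s\<in>{(i, j, k). i + j + k \<le> n}.
    c s * mono3 (fst s) (fst (snd s)) (snd (snd s)) p)" by blast
  then show "q \<in> Pi3 n"
    unfolding Pi3_def by (auto intro!: exI[of _ "\<lambda>i j k. c (i, j, k)"] simp: case_prod_beta mult.assoc)
qed

lemma Pi3_subset:
  assumes "lin_closed S" "\<And>i j k. i + j + k \<le> n \<Longrightarrow> mono3 i j k \<in> S"
  shows "Pi3 n \<subseteq> S"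
proof
  fix q assume "q \<in> Pi3 n"
  then obtain c where q: "q = (\<lambda>p. \<Sum>s\<in>{(i, j, k). i + j + k \<le> n}.
    c s * mono3 (fst s) (fst (snd s)) (snd (snd s)) p)" unfolding Pi3_iff by blast
  show "q \<in> S"
    unfolding q using assms by (intro lin_closed_sum) auto
qed

lemma lin_closed_Pi3: "lin_closed (Pi3 n)"
  unfolding lin_closed_def
proof (intro conjI ballI allI)
  show "(\<lambda>x. 0) \<in> Pi3 n"
    unfolding Pi3_iff by (rule exI[of _ "\<lambda>_. 0"]) simp
  fix f g a b assume "f \<in> Pi3 n" "g \<in> Pi3 n"
  then obtain c d where fg: "f = (\<lambda>p. \<Sum>s\<in>{(i, j, k). i + j + k \<le> n}.
    c s * mono3 (fst s) (fst (snd s)) (snd (snd s)) p)"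
    "g = (\<lambda>p. \<Sum>s\<in>{(i, j, k). i + j + k \<le> n}.
    d s * mono3 (fst s) (fst (snd s)) (snd (snd s)) p)"
    unfolding Pi3_iff by blast
  show "(\<lambda>x. a * f x + b * g x) \<in> Pi3 n"
    unfolding Pi3_iff fg
    by (rule exI[of _ "\<lambda>s. a * c s + b * d s"])
       (simp add: fun_eq_iff sum_distrib_left distrib_right sum.distrib mult.assoc)
qed

lemma mono3_in_Pi3:
  assumes "i + j + k \<le> n"
  shows "mono3 i j k \<in> Pi3 n"
proof -
  have "mono3 i j k p = (\<Sum>s\<in>{(i, j, k). i + j + k \<le> n}. (if s = (i, j, k) then 1 else 0) *
      mono3 (fst s) (fst (snd s)) (snd (snd s)) p)" for p
  proof -
    have "(\<Sum>s\<in>{(i, j, k). i + j + k \<le> n}. (if s = (i, j, k) then 1 else 0) *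
        mono3 (fst s) (fst (snd s)) (snd (snd s)) p) =
      (\<Sum>s\<in>{(i, j, k). i + j + k \<le> n}. if s = (i, j, k) then mono3 i j k p else 0)"
      by (intro sum.cong) auto
    also have "\<dots> = mono3 i j k p"
      using assms finite_degree3[of n] by simp
    finally show ?thesis by simp
  qed
  then show ?thesis
    unfolding Pi3_iff by (intro exI[of _ "\<lambda>s. if s = (i, j, k) then 1 else 0"] ext)
qed

lemma Pi3_mult_mono3:
  assumes "q \<in> Pi3 m" "m + a + b + c \<le> n"
  shows "(\<lambda>p. mono3 a b c p * q p) \<in> Pi3 n"
proof -
  have "Pi3 m \<subseteq> {q. (\<lambda>p. mono3 a b c p * q p) \<in> Pi3 n}"
  proof (rule Pi3_subset)
    show "lin_closed {q. (\<lambda>p. mono3 a b c p * q p) \<in> Pi3 n}"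
      unfolding lin_closed_def
    proof (intro conjI ballI allI; unfold mem_Collect_eq)
      show "(\<lambda>p. mono3 a b c p * 0) \<in> Pi3 n"
        using lin_closed_Pi3[of n] by (simp add: lin_closed_def)
      fix f g u v assume "(\<lambda>p. mono3 a b c p * f p) \<in> Pi3 n" "(\<lambda>p. mono3 a b c p * g p) \<in> Pi3 n"
      from lin_closed_add[OF lin_closed_Pi3 this, of u v]
      show "(\<lambda>p. mono3 a b c p * (u * f p + v * g p)) \<in> Pi3 n"
        by (simp add: distrib_left mult_ac)
    qed
    fix i j k assume "i + j + k \<le> m"
    then have "mono3 (a + i) (b + j) (c + k) \<in> Pi3 n"
      using assms(2) by (intro mono3_in_Pi3) auto
    then show "mono3 i j k \<in> {q. (\<lambda>p. mono3 a b c p * q p) \<in> Pi3 n}"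
      by (simp add: power_add mult_ac)
  qed
  then show ?thesis using assms(1) by blast
qed

lemma continuous_on_Pi3:
  assumes "q \<in> Pi3 n"
  shows "continuous_on A q"
proof -
  have "Pi3 n \<subseteq> {q. continuous_on A q}"
    by (rule Pi3_subset) (auto simp: lin_closed_def intro!: continuous_intros)
  then show ?thesis using assms by blast
qed

section \<open>Harmonic generators and the degree of the kernels\<close>

abbreviation (input) pt :: "(real \<times> real) \<times> real \<Rightarrow> complex" where
  "pt p \<equiv> Complex (fst (fst p)) (snd (fst p))"

text \<open>
  These are all homogeneous polynomials of degree \<open>d\<close> (see \<open>Re_Im_powers_in_harm\<close>), generated in the
  form in which the disk polynomials are given.
\<close>

inductive_set harm :: "nat \<Rightarrow> (complex \<Rightarrow> real) set" for d where
  base: "2 * i + j = d \<Longrightarrow> (\<lambda>z. cmod z ^ (2 * i) * Re (c * z ^ j)) \<in> harm d"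
| add: "f \<in> harm d \<Longrightarrow> g \<in> harm d \<Longrightarrow> (\<lambda>z. a * f z + b * g z) \<in> harm d"

text \<open>The product of two real parts is half the sum of the real parts of u w and of cnj u w.
  The second term trades one power of z for |z|^2, which keeps the generating form.\<close>

lemma harm_mult:
  assumes "f \<in> harm d"
  shows "(\<lambda>z. Re (c * z) * f z) \<in> harm (Suc d)"
  using assms
proof induction
  case (base i j e)
  have prod: "Re u * Re w = 1/2 * Re (u * w) + 1/2 * Re (cnj u * w)" for u w
    by (simp add: algebra_simps)
  have 1: "(\<lambda>z. cmod z ^ (2 * i) * Re ((c * e) * z ^ Suc j)) \<in> harm (Suc d)"
    by (rule harm.base) (use base in simp)
  show ?case
  proof (cases j)
    \<comment> \<open>With no power of z to pair with the conjugate of c z, the conjugate is put on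
      the constant e instead.\<close>
    case 0
    have 2: "(\<lambda>z. cmod z ^ (2 * i) * Re ((c * cnj e) * z ^ 1)) \<in> harm (Suc d)"
      by (rule harm.base) (use base 0 in simp)
    have "Re (c * z) * (cmod z ^ (2 * i) * Re (e * z ^ j)) =
      1/2 * (cmod z ^ (2 * i) * Re ((c * e) * z ^ Suc j)) + 1/2 * (cmod z ^ (2 * i) * Re ((c * cnj e) * z ^ 1))" for z
      unfolding 0 by (simp add: algebra_simps)
    then show ?thesis using harm.add[OF 1 2, of "1/2" "1/2"] by presburger
  next
    case (Suc j')
    have 2: "(\<lambda>z. cmod z ^ (2 * Suc i) * Re ((cnj c * e) * z ^ j')) \<in> harm (Suc d)"
      by (rule harm.base) (use base Suc in simp)
    have "Re (c * z) * (cmod z ^ (2 * i) * Re (e * z ^ j)) =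
      1/2 * (cmod z ^ (2 * i) * Re ((c * e) * z ^ Suc j)) + 1/2 * (cmod z ^ (2 * Suc i) * Re ((cnj c * e) * z ^ j'))" for z
    proof -
      have "cnj (c * z) * (e * z ^ j) = of_real ((cmod z)\<^sup>2) * ((cnj c * e) * z ^ j')"
        unfolding Suc complex_norm_square by (simp add: mult_ac)
      then have "Re (cnj (c * z) * (e * z ^ j)) = (cmod z)\<^sup>2 * Re ((cnj c * e) * z ^ j')"
        by (simp only: times_complex.sel Re_complex_of_real Im_complex_of_real)
      moreover have "(c * z) * (e * z ^ j) = (c * e) * z ^ Suc j" by simp
      ultimately have "Re (c * z) * Re (e * z ^ j) =
          1/2 * Re ((c * e) * z ^ Suc j) + 1/2 * ((cmod z)\<^sup>2 * Re ((cnj c * e) * z ^ j'))"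
        by (simp only: prod)
      then have "cmod z ^ (2 * i) * (Re (c * z) * Re (e * z ^ j)) = cmod z ^ (2 * i) *
          (1/2 * Re ((c * e) * z ^ Suc j) + 1/2 * ((cmod z)\<^sup>2 * Re ((cnj c * e) * z ^ j')))"
        by (simp only:)
      moreover have "cmod z ^ (2 * Suc i) = cmod z ^ (2 * i) * (cmod z)\<^sup>2"
        by (simp add: power_add[symmetric])
      ultimately show ?thesis
        by (simp only: distrib_left mult_ac)
    qed
    then show ?thesis using harm.add[OF 1 2, of "1/2" "1/2"] by presburger
  qed
next
  case (add f g a b)
  have "(\<lambda>z. Re (c * z) * (a * f z + b * g z)) = (\<lambda>z. a * (Re (c * z) * f z) + b * (Re (c * z) * g z))"
    by (simp only: distrib_left mult_ac)
  then show ?case using harm.add[OF add.IH, of a b] by presburger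
qed

text \<open>Multiplication by x and by y is \<open>harm_mult\<close> with c = 1 and c =
  \<open>- \<i>\<close>.\<close>

lemma Re_Im_powers_in_harm: "(\<lambda>z. Re z ^ a * Im z ^ b) \<in> harm (a + b)"
proof (induction a)
  case 0
  show ?case
  proof (induction b)
    case 0
    show ?case using harm.base[of 0 0 0 1] by simp
  next
    case (Suc b)
    then show ?case using harm_mult[OF Suc, of "- \<i>"] by simp
  qed
next
  case (Suc a)
  then show ?case using harm_mult[OF Suc, of 1] by (simp add: mult.assoc)
qed

text \<open>One factor z = x + \<open>\<i>\<close> y is split off; its imaginary part changes the
  constant to \<open>c * \<i>\<close>, which is why c is arbitrary in the induction.\<close>

lemma Re_power_in_Pi3: "(\<lambda>p. Re (c * pt p ^ j)) \<in> Pi3 j"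
proof (induction j arbitrary: c)
  case 0
  have "(\<lambda>p. Re c * mono3 0 0 0 p) \<in> Pi3 0"
    by (intro lin_closed_scale lin_closed_Pi3 mono3_in_Pi3) simp
  then show ?case by simp
next
  case (Suc j)
  have "(\<lambda>p. mono3 1 0 0 p * Re (c * pt p ^ j)) \<in> Pi3 (Suc j)"
    "(\<lambda>p. mono3 0 1 0 p * Re ((c * \<i>) * pt p ^ j)) \<in> Pi3 (Suc j)"
    by (intro Pi3_mult_mono3[OF Suc]; simp)+
  from lin_closed_add[OF lin_closed_Pi3 this, of 1 1]
  show ?case
    by (simp add: algebra_simps)
qed

lemma solid_harmonic_in_Pi3:
  assumes "2 * i + j + k \<le> n"
  shows "(\<lambda>p. cmod (pt p) ^ (2 * i) * Re (c * pt p ^ j) * snd p ^ k) \<in> Pi3 n"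
  using assms
proof (induction i arbitrary: n)
  case 0
  have "(\<lambda>p. mono3 0 0 k p * Re (c * pt p ^ j)) \<in> Pi3 n"
    using 0 by (intro Pi3_mult_mono3[OF Re_power_in_Pi3]) auto
  then show ?case by (simp add: mult.commute)
next
  case (Suc i)
  define m where "m = n - 2"
  have m: "2 * i + j + k \<le> m" "m + 2 \<le> n" using Suc.prems by (auto simp: m_def)
  have "(\<lambda>p. mono3 2 0 0 p * (cmod (pt p) ^ (2 * i) * Re (c * pt p ^ j) * snd p ^ k)) \<in> Pi3 n"
    "(\<lambda>p. mono3 0 2 0 p * (cmod (pt p) ^ (2 * i) * Re (c * pt p ^ j) * snd p ^ k)) \<in> Pi3 n"
    using m(2) by (intro Pi3_mult_mono3[OF Suc.IH[OF m(1)]]; simp)+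
  from lin_closed_add[OF lin_closed_Pi3 this, of 1 1]
  have "(\<lambda>p. 1 * (mono3 2 0 0 p * (cmod (pt p) ^ (2 * i) * Re (c * pt p ^ j) * snd p ^ k)) +
      1 * (mono3 0 2 0 p * (cmod (pt p) ^ (2 * i) * Re (c * pt p ^ j) * snd p ^ k))) \<in> Pi3 n" .
  also have "(\<lambda>p. 1 * (mono3 2 0 0 p * (cmod (pt p) ^ (2 * i) * Re (c * pt p ^ j) * snd p ^ k)) +
      1 * (mono3 0 2 0 p * (cmod (pt p) ^ (2 * i) * Re (c * pt p ^ j) * snd p ^ k))) =
      (\<lambda>p. cmod (pt p) ^ (2 * Suc i) * Re (c * pt p ^ j) * snd p ^ k)"
  proof
    fix p
    define X where "X = cmod (pt p) ^ (2 * i) * Re (c * pt p ^ j) * snd p ^ k"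
    have "cmod (pt p) ^ (2 * Suc i) = (cmod (pt p))\<^sup>2 * cmod (pt p) ^ (2 * i)"
      by (simp add: power_add[symmetric])
    then have "cmod (pt p) ^ (2 * Suc i) * Re (c * pt p ^ j) * snd p ^ k = (cmod (pt p))\<^sup>2 * X"
      by (simp only: X_def mult.assoc)
    also have "\<dots> = 1 * (mono3 2 0 0 p * X) + 1 * (mono3 0 2 0 p * X)"
      by (simp add: cmod_power2 distrib_right)
    finally show "1 * (mono3 2 0 0 p * (cmod (pt p) ^ (2 * i) * Re (c * pt p ^ j) * snd p ^ k)) +
      1 * (mono3 0 2 0 p * (cmod (pt p) ^ (2 * i) * Re (c * pt p ^ j) * snd p ^ k)) =
      cmod (pt p) ^ (2 * Suc i) * Re (c * pt p ^ j) * snd p ^ k"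
      unfolding X_def by (rule sym)
  qed
  finally show ?case .
qed

lemma Re_mult_disk_base:
  "Re (u * disk_base \<mu> j l z) = Re (u * z ^ j) * poly (jac l (\<mu> - 1/2) (real j)) (2 * (cmod z)\<^sup>2 - 1)"
  unfolding disk_base_def mult.assoc[symmetric]
  by (simp only: times_complex.sel(1)[of _ "of_real _"] Re_complex_of_real Im_complex_of_real mult_zero_right diff_zero)

lemma poly_half_plus_power: "poly (half_plus ^ i) (2 * r\<^sup>2 - 1) = r ^ (2 * i)"
  by (simp add: poly_half_plus power_mult)

lemma disk_poly_mult_power_in_Pi3:
  assumes mu: "\<mu> \<ge> 0" and l: "2 * l \<le> k" and n: "k + i \<le> n"
  shows "(\<lambda>p. disk_poly \<mu> k l \<epsilon> (fst p) * snd p ^ i) \<in> Pi3 n"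
proof -
  define j where "j = k - 2 * l"
  obtain c where c: "jac l (\<mu> - 1/2) (real j) = (\<Sum>i\<le>l. smult (c i) (half_plus ^ i))"
    by (rule disk_base_expansion)
  have "(\<lambda>p. \<Sum>s\<le>l. disk_const \<mu> k l * c s *
      (cmod (pt p) ^ (2 * s) * Re (phase \<epsilon> * pt p ^ j) * snd p ^ i)) \<in> Pi3 n"
    using l n by (intro lin_closed_sum[OF lin_closed_Pi3] solid_harmonic_in_Pi3) (auto simp: j_def)
  also have "(\<lambda>p. \<Sum>s\<le>l. disk_const \<mu> k l * c s *
      (cmod (pt p) ^ (2 * s) * Re (phase \<epsilon> * pt p ^ j) * snd p ^ i)) =
      (\<lambda>p. disk_poly \<mu> k l \<epsilon> (fst p) * snd p ^ i)"
    unfolding disk_poly_eq[OF mu] case_prod_beta Re_mult_disk_base j_def[symmetric] c poly_sum poly_smult poly_half_plus_power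
      sum_distrib_left sum_distrib_right
    by (simp only: mult_ac)
  finally show ?thesis .
qed

lemma disk_poly_mult_poly_in_Pi3:
  assumes mu: "\<mu> \<ge> 0" and l: "2 * l \<le> k" and n: "k + degree q \<le> n"
  shows "(\<lambda>p. disk_poly \<mu> k l \<epsilon> (fst p) * poly q (snd p)) \<in> Pi3 n"
proof -
  have "(\<lambda>p. \<Sum>i\<le>degree q. coeff q i * (disk_poly \<mu> k l \<epsilon> (fst p) * snd p ^ i)) \<in> Pi3 n"
    using n by (intro lin_closed_sum[OF lin_closed_Pi3] disk_poly_mult_power_in_Pi3[OF mu l]) auto
  then show ?thesis
    by (simp add: poly_altdef sum_distrib_left mult_ac)
qed

lemma degree_p_L: "L > 0 \<Longrightarrow> degree (p_L L k) = k"
  using degree_cheb[of k] by (simp add: p_L_eq cheb_L_def degree_pcompose pcompose_1)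

lemma T_kernel_in_Pi3:
  assumes mu: "\<mu> \<ge> 0" and L: "L > 0"
  shows "T_kernel \<mu> L n t lam \<nu> j i \<in> Pi3 n"
proof -
  note lc = lin_closed_Pi3[of n]
  have 1: "(\<lambda>p. disk_poly \<mu> k (fst s) (snd s) (fst p) * poly (p_L L l) (snd p)) \<in> Pi3 n"
    if "k \<le> n" "l \<le> n - k" "s \<in> admissible k" for k l s
    using that by (intro disk_poly_mult_poly_in_Pi3[OF mu]) (auto simp: degree_p_L[OF L] admissible_def)
  define D where "D k = (real k + \<mu> + 1/2) / (\<mu> + 1/2) * poly (gegenbauer k (\<mu> + 1/2)) (t j)" for k
  define E where "E k s = lambda_const \<mu> (fst s) k * disk_poly \<mu> k (fst s) (snd s) (cos (xi n \<nu>), sin (xi n \<nu>))" for k s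
  have "(\<lambda>p. \<Sum>k\<le>n. D k * (\<Sum>s\<in>admissible k. E k s * (\<Sum>l\<le>n - k. poly (p_L L l) (zpt L n i) *
      (disk_poly \<mu> k (fst s) (snd s) (fst p) * poly (p_L L l) (snd p))))) \<in> Pi3 n"
    by (intro lin_closed_sum[OF lc] 1) auto
  also have "(\<lambda>p. \<Sum>k\<le>n. D k * (\<Sum>s\<in>admissible k. E k s * (\<Sum>l\<le>n - k. poly (p_L L l) (zpt L n i) *
      (disk_poly \<mu> k (fst s) (snd s) (fst p) * poly (p_L L l) (snd p))))) =
      Phi \<mu> L n (xi n \<nu>) (zpt L n i) (t j)"
  proof -
    have "(\<Sum>s\<in>admissible k. E k s * (\<Sum>l\<le>n - k. poly (p_L L l) (zpt L n i) *
        (disk_poly \<mu> k (fst s) (snd s) (fst p) * poly (p_L L l) (snd p)))) =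
      (\<Sum>s\<in>admissible k. E k s * disk_poly \<mu> k (fst s) (snd s) (fst p)) *
      (\<Sum>l\<le>n - k. poly (p_L L l) (zpt L n i) * poly (p_L L l) (snd p))" for k p
      by (simp only: sum_product) (simp only: sum_distrib_left mult_ac)
    then show ?thesis
      unfolding Phi_def D_kernel_def D_kernel0_def D_def[symmetric] case_prod_unfold E_def[symmetric]
      by (simp only: mult.assoc)
  qed
  finally have "(\<lambda>p. a_const \<mu> * lam j / (real (n + 1))\<^sup>2 * (1 - (t j)\<^sup>2) powr (- \<mu>) *
     Phi \<mu> L n (xi n \<nu>) (zpt L n i) (t j) p) \<in> Pi3 n"
    by (rule lin_closed_scale[OF lc])
  then show ?thesis
    unfolding T_kernel_def .
qed

lemma B_op_in_Pi3:
  assumes mu: "\<mu> \<ge> 0" and L: "L > 0"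
  shows "B_op \<mu> L n t lam f \<in> Pi3 n"
proof -
  have "(\<lambda>x. \<Sum>\<nu>\<le>n. 1 * (\<Sum>j\<le>n. 1 * (\<Sum>i\<le>n.
        radon \<mu> (xi n \<nu>) (\<lambda>v. f (v, zpt L n i)) (t j) * T_kernel \<mu> L n t lam \<nu> j i x))) \<in> Pi3 n"
    by (intro lin_closed_sum[OF lin_closed_Pi3] T_kernel_in_Pi3[OF mu L])
  then show ?thesis by (simp add: B_op_def[abs_def])
qed

section \<open>Linearity of the operator\<close>

lemma radon_node_in_disk:
  assumes t: "t \<in> {-1<..<1}" and s: "s \<in> {- sqrt (1 - t\<^sup>2)..sqrt (1 - t\<^sup>2)}"
  shows "(t * cos \<theta> - s * sin \<theta>, t * sin \<theta> + s * cos \<theta>) \<in> cball (0, 0) 1"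
proof -
  have "1 - t\<^sup>2 \<ge> 0" using t by (simp add: abs_square_le_1 abs_le_iff)
  have "\<bar>s\<bar> \<le> sqrt (1 - t\<^sup>2)" using s by auto
  then have "\<bar>s\<bar>\<^sup>2 \<le> (sqrt (1 - t\<^sup>2))\<^sup>2" by (intro power_mono) auto
  then have "s\<^sup>2 \<le> 1 - t\<^sup>2" using \<open>1 - t\<^sup>2 \<ge> 0\<close> by simp
  moreover have "(t * cos \<theta> - s * sin \<theta>)\<^sup>2 + (t * sin \<theta> + s * cos \<theta>)\<^sup>2 = (t\<^sup>2 + s\<^sup>2) * ((sin \<theta>)\<^sup>2 + (cos \<theta>)\<^sup>2)"
    by algebra
  ultimately have "(t * cos \<theta> - s * sin \<theta>)\<^sup>2 + (t * sin \<theta> + s * cos \<theta>)\<^sup>2 \<le> 1"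
    by simp
  moreover have "(u, v) \<in> cball (0, 0) 1" if "u\<^sup>2 + v\<^sup>2 \<le> 1" for u v :: real
    using that by (simp add: dist_Pair_Pair dist_real_def)
  ultimately show ?thesis by blast
qed

text \<open>Rescaling by the half-length r > 0 of the chord turns the weight into a constant
  multiple of the one on [-1, 1].\<close>

lemma integrable_radon_weight:
  assumes mu: "\<mu> \<ge> 0" and t: "t \<in> {-1<..<1}"
  shows "(\<lambda>s. (1 - s\<^sup>2 - t\<^sup>2) powr (\<mu> - 1/2)) integrable_on {- sqrt (1 - t\<^sup>2)..sqrt (1 - t\<^sup>2)}"
proof -
  define r where "r = sqrt (1 - t\<^sup>2)"
  have p: "1 - t\<^sup>2 > 0" using t by (simp add: abs_square_less_1 abs_less_iff)
  then have r: "r > 0" "r\<^sup>2 = 1 - t\<^sup>2" by (simp_all add: r_def)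
  define w where "w s = (1 - s\<^sup>2) powr (\<mu> - 1/2)" for s :: real
  have "w integrable_on {-1..1}"
    using has_integral_sym_weight[of "\<mu> - 1/2"] mu unfolding w_def by (auto simp: has_integral_iff)
  then have "(\<lambda>x. w (1 / r * x)) integrable_on ((\<lambda>x. x / (1 / r)) ` {-1..1})"
    using r(1) by (intro integrable_stretch_real) auto
  moreover have "(\<lambda>x. x / (1 / r)) ` {-1..1} = {-r..r}"
    using r(1) image_mult_atLeastAtMost[of r "-1" 1] by (simp add: mult.commute[of _ r])
  ultimately have "(\<lambda>x. (r\<^sup>2) powr (\<mu> - 1/2) * w (1 / r * x)) integrable_on {-r..r}"
    by (intro integrable_on_mult_right) simp
  moreover have "(r\<^sup>2) powr (\<mu> - 1/2) * w (1 / r * s) = (1 - s\<^sup>2 - t\<^sup>2) powr (\<mu> - 1/2)" if s: "s \<in> {-r..r}" for s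
  proof -
    have "\<bar>s\<bar>\<^sup>2 \<le> r\<^sup>2" using s by (intro power_mono) auto
    then have "1 - (1 / r * s)\<^sup>2 \<ge> 0" using r(1) by (simp add: power_divide)
    moreover have "r\<^sup>2 * (1 - (1 / r * s)\<^sup>2) = 1 - s\<^sup>2 - t\<^sup>2"
    proof -
      have "r\<^sup>2 * (1 - (1 / r * s)\<^sup>2) = r\<^sup>2 - s\<^sup>2" using r(1) by (simp add: power_divide right_diff_distrib)
      then show ?thesis using r(2) by simp
    qed
    ultimately show ?thesis
      unfolding w_def by (subst powr_mult[symmetric]) auto
  qed
  ultimately show ?thesis
    unfolding r_def[symmetric] by (rule integrable_eq) 
qed

lemma integrable_radon:
  assumes mu: "\<mu> \<ge> 0" and t: "t \<in> {-1<..<1}" and g: "continuous_on (cball (0, 0) 1) g"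
  shows "(\<lambda>s. g (t * cos \<theta> - s * sin \<theta>, t * sin \<theta> + s * cos \<theta>) * (1 - s\<^sup>2 - t\<^sup>2) powr (\<mu> - 1/2))
     integrable_on {- sqrt (1 - t\<^sup>2)..sqrt (1 - t\<^sup>2)}"
proof -
  have "continuous_on {- sqrt (1 - t\<^sup>2)..sqrt (1 - t\<^sup>2)}
      (\<lambda>s. g (t * cos \<theta> - s * sin \<theta>, t * sin \<theta> + s * cos \<theta>))"
    by (rule continuous_on_compose2[OF g]) (auto intro!: continuous_intros radon_node_in_disk[OF t])
  from integrable_continuous_weight[OF this integrable_radon_weight[OF mu t]]
  show ?thesis by (simp add: mult.commute)
qed

lemma radon_linear:
  assumes mu: "\<mu> \<ge> 0" and t: "t \<in> {-1<..<1}"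
    and f: "continuous_on (cball (0, 0) 1) f" and g: "continuous_on (cball (0, 0) 1) g"
  shows "radon \<mu> \<theta> (\<lambda>v. a * f v + b * g v) t = a * radon \<mu> \<theta> f t + b * radon \<mu> \<theta> g t"
proof -
  note i = integrable_radon[OF mu t f, of \<theta>] integrable_radon[OF mu t g, of \<theta>]
  show ?thesis
    unfolding radon_def distrib_right mult.assoc
    by (subst integral_add) (auto intro!: integrable_on_mult_right i)
qed

lemma radon_cong:
  assumes t: "t \<in> {-1<..<1}" and e: "\<And>v. v \<in> cball (0, 0) 1 \<Longrightarrow> f v = g v"
  shows "radon \<mu> \<theta> f t = radon \<mu> \<theta> g t"
  unfolding radon_def by (rule integral_cong) (simp only: e[OF radon_node_in_disk[OF t]])

lemma zpt_in_interval: "L > 0 \<Longrightarrow> zpt L n i \<in> {0..L}"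
proof -
  assume L: "L > 0"
  let ?c = "cos (real (2 * i + 1) * pi / real (2 * n + 2))"
  have "L / 2 * (1 + ?c) \<le> L / 2 * 2" using L by (intro mult_left_mono) (simp_all add: add.commute[of 1])
  moreover have "-1 \<le> ?c" by simp
  then have "0 \<le> L / 2 * (1 + ?c)" using L by (intro mult_nonneg_nonneg) linarith+
  ultimately show ?thesis by (simp add: zpt_def)
qed

lemma B_op_cong:
  assumes L: "L > 0" and t: "\<And>j. j \<le> n \<Longrightarrow> t j \<in> {-1<..<1}" and e: "\<And>x. x \<in> B_L L \<Longrightarrow> f x = g x"
  shows "B_op \<mu> L n t lam f = B_op \<mu> L n t lam g"
proof -
  have "radon \<mu> (xi n \<nu>) (\<lambda>v. f (v, zpt L n i)) (t j) = radon \<mu> (xi n \<nu>) (\<lambda>v. g (v, zpt L n i)) (t j)"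
    if "j \<le> n" for \<nu> j i
    using zpt_in_interval[OF L, of n i] by (intro radon_cong t that e) (simp add: B_L_def)
  then show ?thesis
    unfolding B_op_def[abs_def] by (intro ext sum.cong refl) simp
qed

lemma B_op_linear:
  assumes mu: "\<mu> \<ge> 0" and L: "L > 0" and t: "\<And>j. j \<le> n \<Longrightarrow> t j \<in> {-1<..<1}"
    and f: "continuous_on (B_L L) f" and g: "continuous_on (B_L L) g"
  shows "B_op \<mu> L n t lam (\<lambda>x. a * f x + b * g x) =
    (\<lambda>x. a * B_op \<mu> L n t lam f x + b * B_op \<mu> L n t lam g x)"
proof -
  have c: "continuous_on (cball (0, 0) 1) (\<lambda>v. h (v, zpt L n i))" if "continuous_on (B_L L) h" for h i
    by (rule continuous_on_compose2[OF that])
       (use zpt_in_interval[OF L, of n i] in \<open>auto simp: B_L_def intro!: continuous_intros\<close>)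
  show ?thesis
  proof
    fix x
    have "B_op \<mu> L n t lam (\<lambda>x. a * f x + b * g x) x = (\<Sum>\<nu>\<le>n. \<Sum>j\<le>n. \<Sum>i\<le>n.
      (a * radon \<mu> (xi n \<nu>) (\<lambda>v. f (v, zpt L n i)) (t j) + b * radon \<mu> (xi n \<nu>) (\<lambda>v. g (v, zpt L n i)) (t j)) *
      T_kernel \<mu> L n t lam \<nu> j i x)"
      unfolding B_op_def by (intro sum.cong refl) (simp add: radon_linear[OF mu t c[OF f] c[OF g]])
    also have "\<dots> = a * B_op \<mu> L n t lam f x + b * B_op \<mu> L n t lam g x"
      by (simp only: B_op_def distrib_right sum.distrib sum_distrib_left mult.assoc)
    finally show "B_op \<mu> L n t lam (\<lambda>x. a * f x + b * g x) x =
      a * B_op \<mu> L n t lam f x + b * B_op \<mu> L n t lam g x" .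
  qed
qed

section \<open>The projection property\<close>

lemma B_op_fixes_Pi3:
  assumes mu: "\<mu> \<ge> 0" and L: "L > 0"
    and t: "\<And>j. j \<le> n \<Longrightarrow> t j \<in> {-1<..<1}"
    and quad: "\<And>g :: real poly. degree g \<le> 2 * n \<Longrightarrow>
           integral {-1..1} (\<lambda>s. poly g s * (1 - s\<^sup>2) powr \<mu>) = (\<Sum>j\<le>n. lam j * poly g (t j))"
    and q: "q \<in> Pi3 n"
  shows "B_op \<mu> L n t lam q = q"
proof -
  \<comment> \<open>Continuity belongs to \<open>S\<close> because \<open>B_op_linear\<close> rests
    on the existence of the Radon integrals.\<close>
  define S where "S = {f. continuous_on (B_L L) f \<and> B_op \<mu> L n t lam f = f}"
  have lin: "lin_closed S"
    unfolding lin_closed_def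
  proof (intro conjI ballI allI)
    show "(\<lambda>x. 0) \<in> S"
      by (simp add: S_def B_op_def[abs_def] radon_def)
    fix f g a b assume "f \<in> S" "g \<in> S"
    then show "(\<lambda>x. a * f x + b * g x) \<in> S"
      by (auto simp: S_def B_op_linear[OF mu L t] intro!: continuous_intros)
  qed
  have 1: "(\<lambda>p. disk_poly \<mu> m l \<epsilon> (fst p) * poly (p_L L c) (snd p)) \<in> S"
    if le: "(l, \<epsilon>) \<in> admissible m" and mc: "m + c \<le> n" for l \<epsilon> m c
  proof -
    have "2 * l \<le> m" using le by (auto simp: admissible_def)
    then have "(\<lambda>p. disk_poly \<mu> m l \<epsilon> (fst p) * poly (p_L L c) (snd p)) \<in> Pi3 n"
      using mc by (intro disk_poly_mult_poly_in_Pi3[OF mu]) (simp_all add: degree_p_L[OF L])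
    then have "continuous_on (B_L L) (\<lambda>p. disk_poly \<mu> m l \<epsilon> (fst p) * poly (p_L L c) (snd p))"
      by (rule continuous_on_Pi3)
    moreover have "B_op \<mu> L n t lam (\<lambda>p. disk_poly \<mu> m l \<epsilon> (fst p) * poly (p_L L c) (snd p)) =
        (\<lambda>p. disk_poly \<mu> m l \<epsilon> (fst p) * poly (p_L L c) (snd p))"
    proof -
      have "B_op \<mu> L n t lam (\<lambda>(v, z). disk_poly \<mu> m l \<epsilon> v * poly (p_L L c) z) (v, z) =
        disk_poly \<mu> m l \<epsilon> v * poly (p_L L c) z" for v z
        by (rule B_op_reproduces[OF mu L]) (assumption | rule t quad le mc)+
      then show ?thesis by (simp add: fun_eq_iff case_prod_unfold)
    qed
    ultimately show ?thesis by (simp add: S_def)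
  qed
  \<comment> \<open>The change of basis from \<open>p_L\<close> to powers of z does not raise the
    degree, so the bound on the total degree is kept.\<close>
  have 2: "(\<lambda>p. disk_poly \<mu> m l \<epsilon> (fst p) * snd p ^ k) \<in> S"
    if le: "(l, \<epsilon>) \<in> admissible m" and mk: "m + k \<le> n" for l \<epsilon> m k
  proof -
    have "p_L L i \<noteq> 0" for i
      using L degree_cheb[of i] by (auto simp: p_L_eq cheb_L_def pcompose_eq_0_iff)
    then obtain c where c: "monom 1 k = (\<Sum>i\<le>k. smult (c i) (p_L L i))"
      using poly_expansion[of "p_L L" "monom 1 k" k] degree_p_L[OF L] by (auto simp: degree_monom_le)
    have "(\<lambda>p. \<Sum>i\<le>k. c i * (disk_poly \<mu> m l \<epsilon> (fst p) * poly (p_L L i) (snd p))) \<in> S"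
      using mk by (intro lin_closed_sum[OF lin] 1[OF le]) auto
    moreover have "z ^ k = (\<Sum>i\<le>k. c i * poly (p_L L i) z)" for z
      using arg_cong[OF c, of "\<lambda>p. poly p z"] by (simp add: poly_monom poly_sum)
    ultimately show ?thesis
      by (simp add: sum_distrib_left mult_ac)
  qed
  \<comment> \<open>The radial expansion is inverted: \<open>half_plus ^ i\<close> is a combination
    of \<open>jac l\<close> with l \<le> i, which brings in disk polynomials of degree j + 2 l, at
    most j + 2 i.\<close>
  have 3: "(\<lambda>p. cmod (pt p) ^ (2 * i) * Re (phase \<epsilon> * pt p ^ j) * snd p ^ k) \<in> S"
    if ijk: "2 * i + j + k \<le> n" and \<epsilon>: "\<epsilon> \<le> 1" for i j k \<epsilon>
  proof (cases "\<epsilon> = 1 \<and> j = 0")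
    \<comment> \<open>The sine of frequency 0 is not admissible as an index, but the function itself
      is 0.\<close>
    case True
    then show ?thesis using lin by (simp add: phase_def lin_closed_def)
  next
    case False
    have ab: "\<mu> - 1/2 > -1" "real j > -1" "\<mu> - 1/2 + real j + 1 > 0" using mu by auto
    interpret ortho_system "jacobi_int (\<mu> - 1/2) (real j)" "\<lambda>l. jac l (\<mu> - 1/2) (real j)"
      by (rule ortho_system_jac[OF ab])
    obtain c where c: "half_plus ^ i = (\<Sum>l\<le>i. smult (c l) (jac l (\<mu> - 1/2) (real j)))"
      using poly_expansion[of "\<lambda>l. jac l (\<mu> - 1/2) (real j)" "half_plus ^ i" i] deg nonzero degree_half_plus_power by auto
    \<comment> \<open>A product with this factor equals 1, so the factor cannot vanish.\<close>
    have K: "disk_const \<mu> (j + 2 * l) l \<noteq> 0" for l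
      using lambda_disk_const[OF mu, of l "j + 2 * l"] by auto
    have "(\<lambda>p. \<Sum>l\<le>i. c l / disk_const \<mu> (j + 2 * l) l * (disk_poly \<mu> (j + 2 * l) l \<epsilon> (fst p) * snd p ^ k)) \<in> S"
      using False \<epsilon> ijk by (intro lin_closed_sum[OF lin] 2) (auto simp: admissible_def)
    moreover have "c l / disk_const \<mu> (j + 2 * l) l * (disk_poly \<mu> (j + 2 * l) l \<epsilon> (fst p) * snd p ^ k) =
       c l * poly (jac l (\<mu> - 1/2) (real j)) (2 * (cmod (pt p))\<^sup>2 - 1) * Re (phase \<epsilon> * pt p ^ j) * snd p ^ k" for l p
    proof -
      have j: "j + 2 * l - 2 * l = j" by simp
      show ?thesis
        unfolding disk_poly_eq[OF mu] case_prod_beta Re_mult_disk_base j using K[of l] by (simp add: mult_ac)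
    qed
    moreover have "cmod z ^ (2 * i) = (\<Sum>l\<le>i. c l * poly (jac l (\<mu> - 1/2) (real j)) (2 * (cmod z)\<^sup>2 - 1))" for z
      using arg_cong[OF c, of "\<lambda>p. poly p (2 * (cmod z)\<^sup>2 - 1)"] by (simp only: poly_half_plus_power poly_sum poly_smult)
    ultimately show ?thesis
      by (simp only: sum_distrib_right)
  qed
  have 4: "(\<lambda>p. f (pt p) * snd p ^ k) \<in> S" if f: "f \<in> harm d" and dk: "d + k \<le> n" for f d k
    using f dk
  proof induction
    case (base i j c)
    have "2 * i + j + k \<le> n" using base by simp
    \<comment> \<open>An arbitrary complex c is split as Re (c w) = Re c * Re w - Im c * Im w; the
      two phases supply Re w and Im w.\<close>
    from lin_closed_add[OF lin 3[OF this, of 0] 3[OF this, of 1], of "Re c" "- Im c"]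
    show ?case by (simp add: phase_def algebra_simps)
  next
    case (add f g a b)
    from lin_closed_add[OF lin add.IH(1)[OF add.prems] add.IH(2)[OF add.prems], of a b]
    show ?case by (simp add: distrib_right mult.assoc)
  qed
  have "Pi3 n \<subseteq> S"
  proof (rule Pi3_subset[OF lin])
    fix i j k assume "i + j + k \<le> n"
    then show "mono3 i j k \<in> S"
      using 4[OF Re_Im_powers_in_harm[of i j], of k] by simp
  qed
  then show ?thesis using q by (auto simp: S_def)
qed

theorem theorem5p5:
  fixes \<mu> L a :: real and n :: nat and t lam :: "nat \<Rightarrow> real"
  assumes "\<mu> \<ge> 0" and "L > 0"
    and "inj_on t {..n}"
    and "\<And>j. j \<le> n \<Longrightarrow> t j \<in> {-1<..<1}"
    and "\<And>j. j \<le> n \<Longrightarrow>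
           poly (gegenbauer (n + 1) (\<mu> + 1/2) + smult a (gegenbauer n (\<mu> + 1/2))) (t j) = 0"
    and "\<And>j. j \<le> n \<Longrightarrow> lam j > 0"
    and "\<And>g :: real poly. degree g \<le> 2 * n \<Longrightarrow>
           integral {-1..1} (\<lambda>s. poly g s * (1 - s\<^sup>2) powr \<mu>) = (\<Sum>j\<le>n. lam j * poly g (t j))"
  shows "projection_onto_Pi3 L n (B_op \<mu> L n t lam)"
  unfolding projection_onto_Pi3_def
proof (intro conjI allI impI ballI)
  fix f g :: "(real \<times> real) \<times> real \<Rightarrow> real" and a b :: real
  assume "continuous_on (B_L L) f" "continuous_on (B_L L) g"
  then show "B_op \<mu> L n t lam (\<lambda>x. a * f x + b * g x) =
      (\<lambda>x. a * B_op \<mu> L n t lam f x + b * B_op \<mu> L n t lam g x)"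
    by - (rule B_op_linear, (assumption | rule assms(1,2,4))+)
next
  fix f show "B_op \<mu> L n t lam f \<in> Pi3 n"
    by (rule B_op_in_Pi3[OF assms(1,2)])
next
  fix f q assume q: "q \<in> Pi3 n" and e: "\<forall>x\<in>B_L L. f x = q x"
  \<comment> \<open>The operator samples its argument only on chords of the disk at heights in
    [0, L], so agreement on \<open>B_L L\<close> suffices.\<close>
  have "B_op \<mu> L n t lam f = B_op \<mu> L n t lam q"
    using e by (intro B_op_cong[OF assms(2,4)]) auto
  also have "\<dots> = q"
    by (rule B_op_fixes_Pi3) (assumption | rule assms(1,2,4,7) q)+
  finally show "B_op \<mu> L n t lam f = q" .
qed

end
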